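(* Let $F_2$ be the free group of rank $2$. There is a finitely generated subgroup $H=\langle h_1,\ldots,h_k\rangle$ of $F_2\times F_2$ such that the bounded generalized word problem $\mathbf{BGWP}(F_2\times F_2;h_1,\ldots,h_k)$ is $\mathbf{NP}$-complete.
   Context: For a finitely generated group $G$ and fixed elements $h_1,\ldots,h_k\in G$, the problem $\mathbf{BGWP}(G;h_1,\ldots,h_k)$ is: given $g\in G$ and a natural number $n$ in unary, $1^n$, decide whether $g$ can be expressed in $G$ as a product $g=h_{i_1}^{\pm1}h_{i_2}^{\pm1}\cdots h_{i_l}^{\pm1}$ with $l\le n$ and $1\le i_1,\ldots,i_l\le k$. Here $g$ is given as a word over a fixed finite generating set of $G$ and its inverses, with size equal to its length; the group $G$ and the elements $h_1,\ldots,h_k$ are fixed and not part of the input. $\mathbf{NP}$-completeness is with respect to many-to-one polynomial-time (Karp) reductions. *)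

theory Defs
  imports "HOL-Algebra.Generated_Groups" "HOL-Computational_Algebra.Polynomial"
begin

section \<open>Turing machines and polynomial time\<close>

text \<open>
  Single-tape Turing machines with a two-way infinite tape. States and tape symbols are natural
  numbers, and the blank is \<^term>\<open>None\<close>. The machine is given by a finite set of instructions, so
  only finitely many states and symbols matter, and several instructions may apply to the same
  configuration. A computation halts when no instruction applies.
\<close>

datatype move = Move_Left | Stay | Move_Right

fun offset :: "move \<Rightarrow> int" where
  "offset Move_Left = -1"
| "offset Stay = 0"
| "offset Move_Right = 1"

type_synonym cell = "nat option"

record turing_machine =
  instructions :: "((nat \<times> cell) \<times> (nat \<times> cell \<times> move)) set"
  start_state :: nat
  accept_state :: nat

definition well_formed_tm :: "turing_machine \<Rightarrow> bool" where
  "well_formed_tm M \<longleftrightarrow> finite (instructions M)"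

definition deterministic_tm :: "turing_machine \<Rightarrow> bool" where
  "deterministic_tm M \<longleftrightarrow> single_valued (instructions M)"

text \<open>A configuration consists of the state, the position of the head, and the tape.\<close>

type_synonym config = "nat \<times> int \<times> (int \<Rightarrow> cell)"

inductive tm_step :: "turing_machine \<Rightarrow> config \<Rightarrow> config \<Rightarrow> bool" for M :: turing_machine where
  "((q, t h), (q', b, m)) \<in> instructions M \<Longrightarrow> tm_step M (q, h, t) (q', h + offset m, t(h := b))"

definition halted :: "turing_machine \<Rightarrow> config \<Rightarrow> bool" where
  "halted M c \<longleftrightarrow> (\<nexists>c'. tm_step M c c')"

definition tape_of :: "nat list \<Rightarrow> int \<Rightarrow> cell" where
  "tape_of x i = (if 0 \<le> i \<and> i < int (length x) then Some (x ! nat i) else None)"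

definition initial_config :: "turing_machine \<Rightarrow> nat list \<Rightarrow> config" where
  "initial_config M x = (start_state M, 0, tape_of x)"

definition accepts :: "turing_machine \<Rightarrow> nat list \<Rightarrow> bool" where
  "accepts M x \<longleftrightarrow> (\<exists>h t. (tm_step M)\<^sup>*\<^sup>* (initial_config M x) (accept_state M, h, t)
                      \<and> halted M (accept_state M, h, t))"

text \<open>Every computation branch, accepting or not, stops within the time bound.\<close>

definition polynomial_time_tm :: "nat set \<Rightarrow> turing_machine \<Rightarrow> bool" where
  "polynomial_time_tm \<Sigma> M \<longleftrightarrow> (\<exists>p :: nat poly. \<forall>x \<in> lists \<Sigma>. \<forall>n c.
     (tm_step M ^^ n) (initial_config M x) c \<longrightarrow> n \<le> poly p (length x))"

section \<open>NP-completeness\<close>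

text \<open>A decision problem is a language \<open>L\<close> over a finite alphabet \<open>\<Sigma>\<close>.\<close>

definition in_NP :: "nat set \<Rightarrow> nat list set \<Rightarrow> bool" where
  "in_NP \<Sigma> L \<longleftrightarrow> finite \<Sigma> \<and> L \<subseteq> lists \<Sigma> \<and>
     (\<exists>M. well_formed_tm M \<and> polynomial_time_tm \<Sigma> M \<and> (\<forall>x \<in> lists \<Sigma>. x \<in> L \<longleftrightarrow> accepts M x))"

text \<open>
  The machine computing \<open>f\<close> on \<open>x\<close> halts with exactly \<open>f x\<close> on the tape, written from cell 0 on,
  and with the head back on cell 0; the final state is irrelevant.
\<close>

definition polynomial_time_computable :: "nat set \<Rightarrow> (nat list \<Rightarrow> nat list) \<Rightarrow> bool" where
  "polynomial_time_computable \<Sigma> f \<longleftrightarrow>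
     (\<exists>M. well_formed_tm M \<and> deterministic_tm M \<and> polynomial_time_tm \<Sigma> M \<and>
       (\<forall>x \<in> lists \<Sigma>. \<exists>q. (tm_step M)\<^sup>*\<^sup>* (initial_config M x) (q, 0, tape_of (f x))
                          \<and> halted M (q, 0, tape_of (f x))))"

definition karp_reducible :: "nat set \<Rightarrow> nat list set \<Rightarrow> nat set \<Rightarrow> nat list set \<Rightarrow> bool" where
  "karp_reducible \<Sigma> L \<Sigma>' L' \<longleftrightarrow> (\<exists>f \<in> lists \<Sigma> \<rightarrow> lists \<Sigma>'.
     polynomial_time_computable \<Sigma> f \<and> (\<forall>x \<in> lists \<Sigma>. x \<in> L \<longleftrightarrow> f x \<in> L'))"

definition NP_complete :: "nat set \<Rightarrow> nat list set \<Rightarrow> bool" where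
  "NP_complete \<Sigma> L \<longleftrightarrow> in_NP \<Sigma> L \<and> (\<forall>\<Sigma>' L'. in_NP \<Sigma>' L' \<longrightarrow> karp_reducible \<Sigma>' L' \<Sigma> L)"

section \<open>Free groups\<close>

text \<open>
  The letter \<open>(x, True)\<close> is the generator \<open>x\<close> and \<open>(x, False)\<close> is its inverse. The elements of the
  free group on \<open>X\<close> are the freely reduced words over \<open>X\<close>, multiplied by concatenation followed by
  free reduction.
\<close>

type_synonym 'a gword = "('a \<times> bool) list"

definition inverse_letters :: "'a \<times> bool \<Rightarrow> 'a \<times> bool \<Rightarrow> bool" where
  "inverse_letters x y \<longleftrightarrow> fst x = fst y \<and> snd x \<noteq> snd y"

definition reduced :: "'a gword \<Rightarrow> bool" where
  "reduced w \<longleftrightarrow> successively (\<lambda>x y. \<not> inverse_letters x y) w"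

fun push_letter :: "'a \<times> bool \<Rightarrow> 'a gword \<Rightarrow> 'a gword" where
  "push_letter x [] = [x]"
| "push_letter x (y # ys) = (if inverse_letters x y then ys else x # y # ys)"

definition free_group :: "'a set \<Rightarrow> 'a gword monoid" where
  "free_group X = \<lparr>carrier = {w \<in> lists (X \<times> UNIV). reduced w},
                   monoid.mult = (\<lambda>u v. foldr push_letter u v),
                   one = []\<rparr>"

lemma reduced_push_letter: "reduced w \<Longrightarrow> reduced (push_letter x w)"
  by (cases w) (auto simp: reduced_def successively_Cons)

lemma reduced_foldr_push: "reduced w \<Longrightarrow> reduced (foldr push_letter u w)"
  by (induction u) (auto intro: reduced_push_letter)

lemma push_letter_inverse:
  assumes "reduced w" "inverse_letters x y"
  shows "push_letter x (push_letter y w) = w"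
  using assms
  by (cases w; cases "tl w") (auto simp: reduced_def inverse_letters_def prod_eq_iff)

lemma foldr_push_push:
  assumes "reduced w"
  shows "foldr push_letter (push_letter x v) w = push_letter x (foldr push_letter v w)"
  using assms by (cases v) (auto simp: push_letter_inverse reduced_foldr_push)

lemma foldr_push_assoc:
  assumes "reduced w"
  shows "foldr push_letter (foldr push_letter u v) w = foldr push_letter u (foldr push_letter v w)"
  using assms by (induction u) (auto simp: foldr_push_push)

lemma foldr_push_Nil: "reduced w \<Longrightarrow> foldr push_letter w [] = w"
proof (induction w)
  case (Cons x w)
  then show ?case by (cases w) (auto simp: reduced_def)
qed auto

lemma push_letter_in_lists: "x \<in> A \<Longrightarrow> w \<in> lists A \<Longrightarrow> push_letter x w \<in> lists A"
  by (cases w) auto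

lemma foldr_push_in_lists: "u \<in> lists A \<Longrightarrow> w \<in> lists A \<Longrightarrow> foldr push_letter u w \<in> lists A"
proof (induction u)
  case (Cons x u)
  then show ?case using push_letter_in_lists[of x A "foldr push_letter u w"] by simp
qed simp

lemma group_free_group: "group (free_group X)"
proof (rule groupI, goal_cases)
  case (5 w)
  define v where "v = foldr push_letter (rev (map (\<lambda>(x, b). (x, \<not> b)) w)) []"
  have "foldr push_letter (foldr push_letter (rev (map (\<lambda>(x, b). (x, \<not> b)) w)) []) w = []"
  proof -
    have *: "foldr push_letter (rev (map (\<lambda>(x, b). (x, \<not> b)) w)) (foldr push_letter w z) = z"
      if "reduced z" for z
      using that
      by (induction w arbitrary: z)
        (auto simp: push_letter_inverse reduced_foldr_push inverse_letters_def)
    from 5 have "reduced w" by (simp add: free_group_def)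
    then show ?thesis
      using *[of "[]"] by (simp add: foldr_push_assoc foldr_push_Nil) (simp add: reduced_def)
  qed
  moreover have "v \<in> lists (X \<times> UNIV)"
    unfolding v_def using 5
    by (intro foldr_push_in_lists) (auto simp: free_group_def)
  moreover have "reduced v"
    unfolding v_def by (rule reduced_foldr_push) (simp add: reduced_def)
  ultimately show ?case
    by (auto simp: free_group_def v_def)
next
  case (1 x y)
  then show ?case
    using foldr_push_in_lists[of x "X \<times> UNIV" y]
    by (simp add: free_group_def reduced_foldr_push del: lists_eq_set)
qed (auto simp: free_group_def foldr_push_assoc reduced_def)

definition F2 :: "nat gword monoid" where
  "F2 = free_group {0, 1}"

section \<open>The bounded generalized word problem\<close>

text \<open>A word over the list \<open>S\<close> refers to the elements of \<open>S\<close> by their positions.\<close>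

fun letter_value :: "('g, 'm) monoid_scheme \<Rightarrow> 'g list \<Rightarrow> nat \<times> bool \<Rightarrow> 'g" where
  "letter_value G S (i, b) = (if b then S ! i else inv\<^bsub>G\<^esub> (S ! i))"

definition word_value :: "('g, 'm) monoid_scheme \<Rightarrow> 'g list \<Rightarrow> nat gword \<Rightarrow> 'g" where
  "word_value G S w = foldr (\<lambda>x g. letter_value G S x \<otimes>\<^bsub>G\<^esub> g) w \<one>\<^bsub>G\<^esub>"

definition words_over :: "'g list \<Rightarrow> nat gword set" where
  "words_over S = lists ({..<length S} \<times> UNIV)"

definition generating_tuple :: "('g, 'm) monoid_scheme \<Rightarrow> 'g list \<Rightarrow> bool" where
  "generating_tuple G S \<longleftrightarrow>
     distinct S \<and> set S \<subseteq> carrier G \<and> generate G (set S) = carrier G"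

definition bounded_product :: "('g, 'm) monoid_scheme \<Rightarrow> 'g list \<Rightarrow> 'g \<Rightarrow> nat \<Rightarrow> bool" where
  "bounded_product G hs g n \<longleftrightarrow> (\<exists>u \<in> words_over hs. length u \<le> n \<and> g = word_value G hs u)"

text \<open>
  The instance \<open>(w, 1\<^sup>n)\<close> is the string of the letters of \<open>w\<close> followed by \<open>n\<close> copies of the unary
  digit. The digit is the symbol 0, which does not encode a letter, so the pair can be recovered
  from the string. Strings not of this form are not in the language.
\<close>

fun encode_letter :: "nat \<times> bool \<Rightarrow> nat" where
  "encode_letter (i, b) = (if b then 2 * i + 1 else 2 * i + 2)"

definition encode_instance :: "nat gword \<Rightarrow> nat \<Rightarrow> nat list" where
  "encode_instance w n = map encode_letter w @ replicate n 0"

definition BGWP_alphabet :: "'g list \<Rightarrow> nat set" where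
  "BGWP_alphabet S = {0..2 * length S}"

text \<open>\<open>S\<close> is the fixed generating tuple over which the input element is written.\<close>

definition BGWP :: "('g, 'm) monoid_scheme \<Rightarrow> 'g list \<Rightarrow> 'g list \<Rightarrow> nat list set" where
  "BGWP G S hs = {encode_instance w n | w n.
     w \<in> words_over S \<and> bounded_product G hs (word_value G S w) n}"

end

theory Submission
  imports Defs "HOL-Library.Countable"
begin

text \<open>
  Hardness rests on a fixed finite-state transducer that is universal under iteration: a row holds a
  word together with a table of length-preserving rewriting rules, and one sweep over the row carries
  out one step of an application of a rule. A row written in the first component of
  \<open>F2 \<times> F2\<close> is consumed letter by letter by generators that write the output row into the second
  component; a second kind of generator moves the row back. State letters in the first component
  cancel only if consecutive transitions fit together, and marks separate the sweeps.
  The bound \<open>n\<close> is exactly the number of generators that \<open>k\<close> sweeps need. A weight that grows by at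
  most 1 per generator has to reach \<open>n\<close>, which forces every generator to be used positively and in the
  right order, so that a short product is a run of the transducer. The letters are encoded by the
  words \<open>0\<^sup>i 1 0\<^sup>-\<^sup>i\<close> in the two free generators.

  Machines that repeatedly remove the first letter of a queue and append a word make the time bounds
  manageable: every such machine is simulated by a Turing machine with polynomial overhead, and both the
  reduction and the guess-and-cancel procedure for membership in NP are of this form.
\<close>

section \<open>Queue machines\<close>

type_synonym queue_rules = "((nat \<times> nat option) \<times> (nat \<times> nat list)) set"

definition first :: "'a list \<Rightarrow> 'a option" where
  "first w = (case w of [] \<Rightarrow> None | a # _ \<Rightarrow> Some a)"

lemma first_simps [simp]: "first [] = None" "first (a # w) = Some a"
  by (simp_all add: first_def)

inductive queue_step :: "queue_rules \<Rightarrow> nat \<times> nat list \<Rightarrow> nat \<times> nat list \<Rightarrow> bool"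
  for \<Delta> :: queue_rules where
  "((q, first w), (q', \<beta>)) \<in> \<Delta> \<Longrightarrow> queue_step \<Delta> (q, w) (q', tl w @ \<beta>)"

datatype sim_state = Main nat | Write nat "nat list" | Back nat "nat option"

instance sim_state :: countable
  by countable_datatype

inductive_set sim_instructions :: "nat set \<Rightarrow> queue_rules \<Rightarrow> ((nat \<times> cell) \<times> (nat \<times> cell \<times> move)) set"
  for \<Gamma> :: "nat set" and \<Delta> :: queue_rules where
  sim_read: "((q, a), (q', \<beta>)) \<in> \<Delta> \<Longrightarrow>
    ((to_nat (Main q), a), (to_nat (Write q' \<beta>), None, Move_Right)) \<in> sim_instructions \<Gamma> \<Delta>"
| sim_move: "((q, a), (q', \<gamma> @ \<beta>)) \<in> \<Delta> \<Longrightarrow> s \<in> \<Gamma> \<Longrightarrow>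
    ((to_nat (Write q' \<beta>), Some s), (to_nat (Write q' \<beta>), Some s, Move_Right)) \<in> sim_instructions \<Gamma> \<Delta>"
| sim_write: "((q, a), (q', \<gamma> @ b # \<beta>)) \<in> \<Delta> \<Longrightarrow>
    ((to_nat (Write q' (b # \<beta>)), None), (to_nat (Write q' \<beta>), Some b, Move_Right)) \<in> sim_instructions \<Gamma> \<Delta>"
| sim_turn: "((q, a), (q', \<beta>)) \<in> \<Delta> \<Longrightarrow>
    ((to_nat (Write q' []), None), (to_nat (Back q' None), None, Move_Left)) \<in> sim_instructions \<Gamma> \<Delta>"
| sim_back: "((q, a), (q', \<beta>)) \<in> \<Delta> \<Longrightarrow> c \<in> insert None (Some ` \<Gamma>) \<Longrightarrow> s \<in> \<Gamma> \<Longrightarrow>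
    ((to_nat (Back q' c), Some s), (to_nat (Back q' (Some s)), c, Move_Left)) \<in> sim_instructions \<Gamma> \<Delta>"
| sim_end: "((q, a), (q', \<beta>)) \<in> \<Delta> \<Longrightarrow> c \<in> insert None (Some ` \<Gamma>) \<Longrightarrow>
    ((to_nat (Back q' c), None), (to_nat (Main q'), c, Stay)) \<in> sim_instructions \<Gamma> \<Delta>"

definition sim_tm :: "nat set \<Rightarrow> queue_rules \<Rightarrow> nat \<Rightarrow> nat \<Rightarrow> turing_machine" where
  "sim_tm \<Gamma> \<Delta> q0 qa = \<lparr>instructions = sim_instructions \<Gamma> \<Delta>,
     start_state = to_nat (Main q0), accept_state = to_nat (Main qa)\<rparr>"

lemma finite_sim_instructions:
  assumes "finite \<Gamma>" "finite \<Delta>"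
  shows "finite (sim_instructions \<Gamma> \<Delta>)"
proof -
  define C where "C = insert None (Some ` \<Gamma>) \<union> (\<lambda>r. snd (fst r)) ` \<Delta> \<union> (\<Union>r \<in> \<Delta>. Some ` set (snd (snd r)))"
  define W where "W = (\<Union>r \<in> \<Delta>. (\<lambda>i. Write (fst (snd r)) (drop i (snd (snd r)))) ` {..length (snd (snd r))})"
  define Q where "Q = (\<lambda>r. Main (fst (fst r))) ` \<Delta> \<union> (\<lambda>r. Main (fst (snd r))) ` \<Delta> \<union> W \<union>
    (\<Union>r \<in> \<Delta>. Back (fst (snd r)) ` C)"
  have W: "Write q' \<beta> \<in> W" if "((q, a), (q', \<gamma> @ \<beta>)) \<in> \<Delta>" for q a q' \<beta> \<gamma>
  proof -
    have "Write q' (drop (length \<gamma>) (\<gamma> @ \<beta>)) \<in> (\<lambda>i. Write q' (drop i (\<gamma> @ \<beta>))) ` {..length (\<gamma> @ \<beta>)}"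
      by (rule imageI) simp
    then show ?thesis using that unfolding W_def by (intro UN_I[OF that]) simp
  qed
  have Q: "Main q \<in> Q" "Main q' \<in> Q" "a \<in> C" "s \<in> set \<beta> \<Longrightarrow> Some s \<in> C"
    if "((q, a), (q', \<beta>)) \<in> \<Delta>" for q a q' \<beta> s
    using imageI[OF that, of "\<lambda>r. Main (fst (fst r))"] imageI[OF that, of "\<lambda>r. Main (fst (snd r))"]
      imageI[OF that, of "\<lambda>r. snd (fst r)"] UN_I[OF that, of "Some s" "\<lambda>r. Some ` set (snd (snd r))"]
    by (simp_all add: Q_def C_def)
  have B: "Back q' c \<in> Q" if "((q, a), (q', \<beta>)) \<in> \<Delta>" "c \<in> C" for q a q' \<beta> c
    using UN_I[OF that(1), of "Back q' c" "\<lambda>r. Back (fst (snd r)) ` C"] that(2) by (simp add: Q_def)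
  have C: "None \<in> C" "\<And>s. s \<in> \<Gamma> \<Longrightarrow> Some s \<in> C" by (simp_all add: C_def)
  have WQ: "x \<in> W \<Longrightarrow> x \<in> Q" for x by (simp add: Q_def)
  have W': "Write q' \<beta> \<in> W" if "((q, a), (q', \<gamma> @ b # \<beta>)) \<in> \<Delta>" for q a q' \<beta> \<gamma> b
    using W[of q a q' "\<gamma> @ [b]"] that by simp
  have "sim_instructions \<Gamma> \<Delta> \<subseteq> (to_nat ` Q \<times> C) \<times> (to_nat ` Q \<times> C \<times> {Move_Left, Stay, Move_Right})"
  proof (intro subrelI)
    fix p x assume x: "(p, x) \<in> sim_instructions \<Gamma> \<Delta>"
    obtain n a n' b m where px: "p = (n, a)" "x = (n', b, m)" by (cases p; cases x)
    from x[unfolded px] show "(p, x) \<in> (to_nat ` Q \<times> C) \<times> (to_nat ` Q \<times> C \<times> {Move_Left, Stay, Move_Right})"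
      unfolding px
    proof (induction rule: sim_instructions.induct)
      case (sim_read q a q' \<beta>)
      then show ?case using W[of q a q' "[]" \<beta>] by (simp add: Q C WQ)
    next
      case (sim_move q a q' \<gamma> \<beta> s)
      then show ?case using W by (simp add: Q C WQ)
    next
      case (sim_write q a q' \<gamma> b \<beta>)
      then show ?case using WQ[OF W[OF sim_write]] WQ[OF W'[OF sim_write]] Q(4)[OF sim_write, of b] by (simp add: C)
    next
      case (sim_turn q a q' \<beta>)
      then show ?case using W[of q a q' \<beta> "[]"] by (simp add: B C WQ)
    next
      case (sim_back q a q' \<beta> c s)
      then have "c \<in> C" "Some s \<in> C" by (auto simp: C_def)
      then show ?case using B[OF sim_back(1)] by simp
    next
      case (sim_end q a q' \<beta> c)
      then have "c \<in> C" by (auto simp: C_def)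
      then show ?case using Q(2)[OF sim_end(1)] B[OF sim_end(1)] C by simp
    qed
  qed
  moreover have "finite C" using assms by (simp add: C_def)
  moreover from this have "finite Q" using assms by (simp add: Q_def W_def)
  ultimately show ?thesis by (auto intro: finite_subset)
qed

lemma sim_Main_iff:
  "((to_nat (Main q), a), x) \<in> sim_instructions \<Gamma> \<Delta> \<longleftrightarrow>
     (\<exists>q' \<beta>. ((q, a), (q', \<beta>)) \<in> \<Delta> \<and> x = (to_nat (Write q' \<beta>), None, Move_Right))"
  by (cases x) (auto simp: sim_instructions.simps)

lemma sim_Write_Some_iff:
  "((to_nat (Write q' \<beta>), Some s), x) \<in> sim_instructions \<Gamma> \<Delta> \<longleftrightarrow>
     s \<in> \<Gamma> \<and> (\<exists>q a \<gamma>. ((q, a), (q', \<gamma> @ \<beta>)) \<in> \<Delta>) \<and> x = (to_nat (Write q' \<beta>), Some s, Move_Right)"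
  by (cases x) (auto simp: sim_instructions.simps)

lemma sim_Write_None_iff:
  "((to_nat (Write q' \<beta>), None), x) \<in> sim_instructions \<Gamma> \<Delta> \<longleftrightarrow>
     (\<exists>q a \<gamma>. ((q, a), (q', \<gamma> @ \<beta>)) \<in> \<Delta>) \<and>
     x = (case \<beta> of [] \<Rightarrow> (to_nat (Back q' None), None, Move_Left)
                  | b # \<beta>' \<Rightarrow> (to_nat (Write q' \<beta>'), Some b, Move_Right))"
proof (cases \<beta>)
  case Nil
  have "(\<exists>q a \<beta>. ((q, a), (q', \<beta>)) \<in> \<Delta>) \<longleftrightarrow> (\<exists>q a \<gamma>. ((q, a), (q', \<gamma> @ [])) \<in> \<Delta>)" by simp
  then show ?thesis using Nil by (cases x) (auto simp: sim_instructions.simps)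
qed (cases x, auto simp: sim_instructions.simps)

lemma sim_Back_iff:
  "((to_nat (Back q' c), y), x) \<in> sim_instructions \<Gamma> \<Delta> \<longleftrightarrow>
     (\<exists>q a \<beta>. ((q, a), (q', \<beta>)) \<in> \<Delta>) \<and> c \<in> insert None (Some ` \<Gamma>) \<and> y \<in> insert None (Some ` \<Gamma>) \<and>
     x = (case y of None \<Rightarrow> (to_nat (Main q'), c, Stay) | Some s \<Rightarrow> (to_nat (Back q' (Some s)), c, Move_Left))"
  by (cases y; cases x) (auto simp: sim_instructions.simps)

lemma deterministic_sim_tm:
  assumes "single_valued \<Delta>"
  shows "deterministic_tm (sim_tm \<Gamma> \<Delta> q0 qa)"
  unfolding deterministic_tm_def
proof (rule single_valuedI)
  fix p x y
  assume x: "(p, x) \<in> instructions (sim_tm \<Gamma> \<Delta> q0 qa)" and y: "(p, y) \<in> instructions (sim_tm \<Gamma> \<Delta> q0 qa)"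
  obtain n a where p: "p = (n, a)" by (cases p)
  have "\<exists>s. n = to_nat (s :: sim_state)"
    using x p by (cases x) (auto simp: sim_tm_def elim: sim_instructions.cases)
  then obtain s :: sim_state where n: "n = to_nat s" by blast
  show "x = y"
  proof (cases s)
    case (Main q)
    then show ?thesis
      using x y assms by (auto simp: p n sim_tm_def sim_Main_iff dest: single_valuedD)
  next
    case (Write q \<gamma>)
    then show ?thesis
      using x y by (cases a) (auto simp: p n sim_tm_def sim_Write_Some_iff sim_Write_None_iff)
  next
    case (Back q c)
    then show ?thesis
      using x y by (auto simp: p n sim_tm_def sim_Back_iff)
  qed
qed

definition tape_from :: "int \<Rightarrow> nat list \<Rightarrow> int \<Rightarrow> cell" where
  "tape_from l x i = (if l \<le> i \<and> i < l + int (length x) then Some (x ! nat (i - l)) else None)"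

lemma tape_from_0: "tape_from 0 x = tape_of x"
  by (auto simp: tape_from_def tape_of_def)

lemma tape_from_tl: "(tape_from 0 w)(0 := None) = tape_from 1 (tl w)"
  by (cases w) (auto simp: tape_from_def fun_eq_iff nth_Cons' nat_diff_distrib' intro!: arg_cong[of _ _ "(!) _"])

lemma tape_from_snoc: "(tape_from 1 w)(1 + int (length w) := Some b) = tape_from 1 (w @ [b])"
  by (auto simp: tape_from_def fun_eq_iff nth_append)

lemma tape_from_replace:
  "(tape_from 1 (u @ s # v))(1 + int (length u) := Some c) = tape_from 1 (u @ c # v)"
  by (auto simp: tape_from_def fun_eq_iff nth_append nth_Cons')

lemma tape_from_butlast: "(tape_from 1 (u @ [s]))(1 + int (length u) := None) = tape_from 1 u"
  by (auto simp: tape_from_def fun_eq_iff nth_append nth_Cons')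

lemma tape_from_Cons: "(tape_from 1 v)(0 := Some c) = tape_from 0 (c # v)"
  by (auto simp: tape_from_def fun_eq_iff nth_Cons' nat_diff_distrib' intro!: arg_cong[of _ _ "(!) _"])

inductive forced :: "turing_machine \<Rightarrow> nat \<Rightarrow> config \<Rightarrow> config \<Rightarrow> bool" for M where
  forced_0: "forced M 0 c c"
| forced_Suc: "\<forall>q. fst c \<noteq> to_nat (Main q) \<Longrightarrow> \<forall>d. tm_step M c d \<longleftrightarrow> d = c1 \<Longrightarrow> forced M n c1 c' \<Longrightarrow> forced M (Suc n) c c'"

lemma forced_trans: "forced M n a b \<Longrightarrow> forced M m b c \<Longrightarrow> forced M (n + m) a c"
  by (induction rule: forced.induct) (auto intro: forced_Suc)

lemma forced_one: "\<forall>q. fst c \<noteq> to_nat (Main q) \<Longrightarrow> \<forall>d. tm_step M c d \<longleftrightarrow> d = c1 \<Longrightarrow> forced M 1 c c1"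
  using forced_Suc[OF _ _ forced_0] by simp

lemma forced_run:
  assumes "forced M n c c'" "(tm_step M ^^ m) c d"
  shows "(m < n \<and> (\<forall>q. fst d \<noteq> to_nat (Main q))) \<or> (n \<le> m \<and> (tm_step M ^^ (m - n)) c' d)"
  using assms
proof (induction arbitrary: m rule: forced.induct)
  case (forced_Suc c c1 n c')
  show ?case
  proof (cases m)
    case (Suc m')
    then have "(tm_step M ^^ m') c1 d"
      using forced_Suc.prems forced_Suc.hyps(2) by (metis relpowp_Suc_D2)
    then show ?thesis using forced_Suc.IH[of m'] Suc by auto
  qed (use forced_Suc in auto)
qed auto

lemma forced_reach: "forced M n c c' \<Longrightarrow> (tm_step M)\<^sup>*\<^sup>* c c'"
proof (induction rule: forced.induct)
  case (forced_Suc c c1 n c')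
  have "tm_step M c c1" using forced_Suc.hyps(2) by blast
  then show ?case using forced_Suc.IH by (rule converse_rtranclp_into_rtranclp)
qed simp

lemma tm_step_iff:
  "tm_step M (q, h, t) d \<longleftrightarrow> (\<exists>q' b m. ((q, t h), (q', b, m)) \<in> instructions M \<and> d = (q', h + offset m, t(h := b)))"
  by (auto simp: tm_step.simps)

definition main_config :: "nat \<Rightarrow> nat list \<Rightarrow> config" where
  "main_config q w = (to_nat (Main q), 0, tape_from 0 w)"

lemma tape_from_0_at_0: "tape_from 0 w 0 = first w"
  by (cases w) (auto simp: tape_from_def)

locale queue_simulation =
  fixes \<Gamma> :: "nat set" and \<Delta> :: queue_rules and q0 qa :: nat
  assumes fin: "finite \<Gamma>" "finite \<Delta>"
    and symbols: "((q, a), (q', \<beta>)) \<in> \<Delta> \<Longrightarrow> set \<beta> \<subseteq> \<Gamma>"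
begin

abbreviation "M \<equiv> sim_tm \<Gamma> \<Delta> q0 qa"

lemma main_step_iff:
  "tm_step M (main_config q w) d \<longleftrightarrow>
     (\<exists>q' \<beta>. ((q, first w), (q', \<beta>)) \<in> \<Delta> \<and> d = (to_nat (Write q' \<beta>), 1, tape_from 1 (tl w)))"
  by (auto simp: main_config_def tm_step_iff sim_tm_def sim_Main_iff tape_from_0_at_0 tape_from_tl)

lemma halted_main_iff: "halted M (main_config q w) \<longleftrightarrow> (\<nexists>q' \<beta>. ((q, first w), (q', \<beta>)) \<in> \<Delta>)"
  by (auto simp: halted_def main_step_iff)

context
  fixes q a q' \<beta>
  assumes rule: "((q, a), (q', \<beta>)) \<in> \<Delta>"
begin

lemma forced_write_move:
  assumes "set w \<subseteq> \<Gamma>" "j \<le> length w"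
  shows "forced M j (to_nat (Write q' \<beta>), 1 + int (length w) - int j, tape_from 1 w)
     (to_nat (Write q' \<beta>), 1 + int (length w), tape_from 1 w)"
  using assms(2)
proof (induction j)
  case (Suc j)
  define h where "h = 1 + int (length w) - int (Suc j)"
  have *: "tape_from 1 w h = Some (w ! nat (h - 1))" "w ! nat (h - 1) \<in> \<Gamma>"
    using Suc.prems assms(1) by (auto simp: h_def tape_from_def intro!: subsetD[OF assms(1)] nth_mem)
  have rule': "\<exists>q a \<gamma>. ((q, a), (q', \<gamma> @ \<beta>)) \<in> \<Delta>"
    by (intro exI[of _ q] exI[of _ a] exI[of _ "[]"]) (simp add: rule)
  have "forced M 1 (to_nat (Write q' \<beta>), h, tape_from 1 w) (to_nat (Write q' \<beta>), h + 1, tape_from 1 w)"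
    by (rule forced_one) (use * rule' in \<open>auto simp: tm_step_iff sim_tm_def sim_Write_Some_iff fun_upd_idem\<close>)
  moreover have "forced M j (to_nat (Write q' \<beta>), h + 1, tape_from 1 w) (to_nat (Write q' \<beta>), 1 + int (length w), tape_from 1 w)"
    using Suc by (simp add: h_def algebra_simps)
  ultimately show ?case using forced_trans[of M 1] by (metis h_def plus_1_eq_Suc)
qed (auto intro: forced_0)

lemma forced_write:
  assumes "i \<le> length \<beta>"
  shows "forced M (length \<beta> - i) (to_nat (Write q' (drop i \<beta>)), 1 + int (length w), tape_from 1 w)
     (to_nat (Write q' []), 1 + int (length (w @ drop i \<beta>)), tape_from 1 (w @ drop i \<beta>))"
  using assms
proof (induction "length \<beta> - i" arbitrary: i w)
  case 0
  then show ?case by (auto intro: forced_0)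
next
  case (Suc n)
  then have i: "i < length \<beta>" by simp
  then have d: "drop i \<beta> = \<beta> ! i # drop (Suc i) \<beta>" by (simp add: Cons_nth_drop_Suc)
  have None: "tape_from 1 w (1 + int (length w)) = None" by (simp add: tape_from_def)
  have r: "((q, a), (q', take i \<beta> @ \<beta> ! i # drop (Suc i) \<beta>)) \<in> \<Delta>" using rule i by (simp add: id_take_nth_drop[symmetric])
  have "forced M 1 (to_nat (Write q' (drop i \<beta>)), 1 + int (length w), tape_from 1 w)
     (to_nat (Write q' (drop (Suc i) \<beta>)), 1 + int (length (w @ [\<beta> ! i])), tape_from 1 (w @ [\<beta> ! i]))"
    by (rule forced_one) (use None r in \<open>auto simp: tm_step_iff sim_tm_def sim_Write_None_iff tape_from_snoc d\<close>)
  from forced_trans[OF this Suc.hyps(1)[of "Suc i" "w @ [\<beta> ! i]"]] i Suc.hyps(2)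
  show ?case by (simp add: d) (metis Suc_diff_Suc Suc_inject d)
qed

lemma forced_turn:
  "forced M 1 (to_nat (Write q' []), 1 + int (length w), tape_from 1 w)
     (to_nat (Back q' None), int (length w), tape_from 1 w)"
proof -
  have "tape_from 1 w (1 + int (length w)) = None" by (simp add: tape_from_def)
  then show ?thesis
    by (intro forced_one)
      (use rule in \<open>auto simp: tm_step_iff sim_tm_def sim_Write_None_iff fun_upd_idem intro!: exI[of _ \<beta>]\<close>)
qed

text \<open>The cells \<open>1, \<dots>\<close> hold \<open>u @ v\<close>, where \<open>v\<close> has already been shifted and the carried symbol stands between \<open>u\<close> and \<open>v\<close>.\<close>

lemma forced_back:
  assumes "set u \<subseteq> \<Gamma>" "c = None \<and> v = [] \<or> (\<exists>s \<in> \<Gamma>. c = Some s)"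
  shows "forced M (Suc (length u)) (to_nat (Back q' c), int (length u), tape_from 1 (u @ v))
     (main_config q' (u @ (case c of None \<Rightarrow> [] | Some s \<Rightarrow> [s]) @ v))"
  using assms
proof (induction u arbitrary: c v rule: rev_induct)
  case Nil
  have "tape_from 1 v 0 = None" by (simp add: tape_from_def)
  then have *: "tm_step M (to_nat (Back q' c), 0, tape_from 1 v) d \<longleftrightarrow> d = (to_nat (Main q'), 0, (tape_from 1 v)(0 := c))" for d
    using Nil rule by (auto simp: tm_step_iff sim_tm_def sim_Back_iff)
  have "(tape_from 1 v)(0 := c) = tape_from 0 ((case c of None \<Rightarrow> [] | Some s \<Rightarrow> [s]) @ v)"
    using Nil by (auto simp: tape_from_Cons) (auto simp: tape_from_def)
  then show ?case
    using forced_one[of "(to_nat (Back q' c), 0, tape_from 1 v)" M] * by (simp add: main_config_def)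
next
  case (snoc s u)
  have s: "tape_from 1 (u @ s # v) (1 + int (length u)) = Some s" by (simp add: tape_from_def)
  have t: "(tape_from 1 (u @ s # v))(1 + int (length u) := c) = tape_from 1 (u @ (case c of None \<Rightarrow> [] | Some s \<Rightarrow> [s]) @ v)"
    using snoc.prems by (auto simp: tape_from_butlast tape_from_replace)
  have "forced M 1 (to_nat (Back q' c), 1 + int (length u), tape_from 1 (u @ s # v))
    (to_nat (Back q' (Some s)), int (length u), tape_from 1 (u @ (case c of None \<Rightarrow> [] | Some s \<Rightarrow> [s]) @ v))"
    by (rule forced_one) (use s snoc.prems rule in \<open>auto simp: tm_step_iff sim_tm_def sim_Back_iff t\<close>)
  from forced_trans[OF this snoc.IH] snoc.prems show ?case by (simp add: add.commute)
qed

lemma forced_round: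
  assumes "set w \<subseteq> \<Gamma>"
  shows "forced M (2 * (length w + length \<beta>) + 2) (to_nat (Write q' \<beta>), 1, tape_from 1 w) (main_config q' (w @ \<beta>))"
proof -
  have s: "set (w @ \<beta>) \<subseteq> \<Gamma>" using symbols[OF rule] assms by auto
  have "forced M (length w) (to_nat (Write q' \<beta>), 1, tape_from 1 w) (to_nat (Write q' \<beta>), 1 + int (length w), tape_from 1 w)"
    using forced_write_move[OF assms, of "length w"] by simp
  moreover have "forced M (length \<beta>) (to_nat (Write q' \<beta>), 1 + int (length w), tape_from 1 w)
     (to_nat (Write q' []), 1 + int (length (w @ \<beta>)), tape_from 1 (w @ \<beta>))"
    using forced_write[of 0 w] by simp
  moreover have "forced M (Suc (length (w @ \<beta>))) (to_nat (Back q' None), int (length (w @ \<beta>)), tape_from 1 (w @ \<beta>))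
     (main_config q' (w @ \<beta>))"
    using forced_back[OF s, of None "[]"] by simp
  ultimately have "forced M (length w + (length \<beta> + (1 + Suc (length (w @ \<beta>))))) (to_nat (Write q' \<beta>), 1, tape_from 1 w) (main_config q' (w @ \<beta>))"
    by (blast intro: forced_trans forced_turn)
  moreover have "length w + (length \<beta> + (1 + Suc (length (w @ \<beta>)))) = 2 * (length w + length \<beta>) + 2" by simp
  ultimately show ?thesis by metis
qed

end

lemma queue_step_symbols: "queue_step \<Delta> (q, w) (q', w') \<Longrightarrow> set w \<subseteq> \<Gamma> \<Longrightarrow> set w' \<subseteq> \<Gamma>"
  by (cases w) (auto elim!: queue_step.cases dest!: symbols)

lemma queue_reach:
  "(queue_step \<Delta>)\<^sup>*\<^sup>* (q, w) (q', w') \<Longrightarrow> set w \<subseteq> \<Gamma> \<Longrightarrow> (tm_step M)\<^sup>*\<^sup>* (main_config q w) (main_config q' w')"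
proof (induction q w rule: converse_rtranclp_induct2)
  case (step q w p v)
  from step.hyps(1) obtain \<beta> where r: "((q, first w), (p, \<beta>)) \<in> \<Delta>" and v: "v = tl w @ \<beta>"
    by (auto elim: queue_step.cases)
  have "set (tl w) \<subseteq> \<Gamma>" using step.prems by (cases w) auto
  from forced_reach[OF forced_round[OF r this]]
  have "(tm_step M)\<^sup>*\<^sup>* (main_config q w) (main_config p v)"
    using r v by (metis converse_rtranclp_into_rtranclp main_step_iff)
  moreover have "set v \<subseteq> \<Gamma>" using step queue_step_symbols by blast
  ultimately show ?case using step.IH by (meson rtranclp_trans)
qed auto

lemma tm_run_decompose:
  assumes "(tm_step M ^^ Suc n) (main_config q w) c" "set w \<subseteq> \<Gamma>"
  obtains q' \<beta> where "((q, first w), (q', \<beta>)) \<in> \<Delta>" "queue_step \<Delta> (q, w) (q', tl w @ \<beta>)"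
    "n < 2 * (length (tl w) + length \<beta>) + 2 \<and> (\<forall>q. fst c \<noteq> to_nat (Main q)) \<or>
     2 * (length (tl w) + length \<beta>) + 2 \<le> n \<and>
       (tm_step M ^^ (n - (2 * (length (tl w) + length \<beta>) + 2))) (main_config q' (tl w @ \<beta>)) c"
proof -
  from assms(1) obtain d where d: "tm_step M (main_config q w) d" "(tm_step M ^^ n) d c"
    by (metis relpowp_Suc_D2)
  then obtain q' \<beta> where r: "((q, first w), (q', \<beta>)) \<in> \<Delta>" and "d = (to_nat (Write q' \<beta>), 1, tape_from 1 (tl w))"
    by (auto simp: main_step_iff)
  moreover have "set (tl w) \<subseteq> \<Gamma>" using assms(2) by (cases w) auto
  ultimately show thesis
    using forced_run[OF forced_round[OF r] d(2)[unfolded \<open>d = _\<close>]] that[OF r queue_step.intros[OF r]] by blast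
qed

lemma tm_run_main:
  assumes "(tm_step M ^^ n) (main_config q w) c" "set w \<subseteq> \<Gamma>" "fst c = to_nat (Main p)"
  shows "\<exists>w'. c = main_config p w' \<and> (queue_step \<Delta>)\<^sup>*\<^sup>* (q, w) (p, w')"
  using assms
proof (induction n arbitrary: q w rule: less_induct)
  case (less n)
  show ?case
  proof (cases n)
    case 0
    then have "c = main_config q w" using less.prems by simp
    then show ?thesis using less.prems(3) by (auto simp: main_config_def)
  next
    case (Suc m)
    from less.prems(1)[unfolded Suc] less.prems(2) obtain q' \<beta> where
      s: "queue_step \<Delta> (q, w) (q', tl w @ \<beta>)" and
      "(tm_step M ^^ (m - (2 * (length (tl w) + length \<beta>) + 2))) (main_config q' (tl w @ \<beta>)) c"
      by (rule tm_run_decompose) (use less.prems(3) in blast)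
    moreover define k where "k = m - (2 * (length (tl w) + length \<beta>) + 2)"
    ultimately have k: "k < n" "(tm_step M ^^ k) (main_config q' (tl w @ \<beta>)) c" using Suc by simp_all
    have "set (tl w @ \<beta>) \<subseteq> \<Gamma>" using queue_step_symbols[OF s] less.prems(2) by blast
    from less.IH[OF k this less.prems(3)] obtain w' where
      "c = main_config p w'" "(queue_step \<Delta>)\<^sup>*\<^sup>* (q', tl w @ \<beta>) (p, w')" by blast
    then show ?thesis using converse_rtranclp_into_rtranclp[of "queue_step \<Delta>", OF s] by blast
  qed
qed

lemma tm_run_bound:
  assumes "(tm_step M ^^ n) (main_config q w) c" "set w \<subseteq> \<Gamma>"
    and "\<And>m d. (queue_step \<Delta> ^^ m) (q, w) d \<Longrightarrow> m \<le> T \<and> length (snd d) \<le> L"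
  shows "n \<le> (T + 1) * (2 * L + 3)"
  using assms
proof (induction T arbitrary: n q w)
  case (0 n q w)
  show ?case
  proof (cases n)
    case (Suc m)
    from 0(1)[unfolded Suc] 0(2) obtain q' \<beta> where "queue_step \<Delta> (q, w) (q', tl w @ \<beta>)"
      by (rule tm_run_decompose) auto
    then have "(queue_step \<Delta> ^^ 1) (q, w) (q', tl w @ \<beta>)" by (simp add: relcompp_apply)
    then show ?thesis using 0(3) by fastforce
  qed simp
next
  case (Suc T n q w)
  show ?case
  proof (cases n)
    case (Suc m)
    from \<open>(tm_step M ^^ n) _ _\<close>[unfolded Suc] \<open>set w \<subseteq> \<Gamma>\<close> obtain q' \<beta> where
      s: "queue_step \<Delta> (q, w) (q', tl w @ \<beta>)" and
      c: "m < 2 * (length (tl w) + length \<beta>) + 2 \<or> 2 * (length (tl w) + length \<beta>) + 2 \<le> m \<and>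
       (tm_step M ^^ (m - (2 * (length (tl w) + length \<beta>) + 2))) (main_config q' (tl w @ \<beta>)) c"
      by (rule tm_run_decompose) blast
    have "(queue_step \<Delta> ^^ 1) (q, w) (q', tl w @ \<beta>)" using s by (simp add: relcompp_apply)
    then have L: "length (tl w) + length \<beta> \<le> L" using Suc.prems(3) by fastforce
    have b: "m' \<le> T \<and> length (snd d) \<le> L" if "(queue_step \<Delta> ^^ m') (q', tl w @ \<beta>) d" for m' d
      using Suc.prems(3)[of "Suc m'" d] relpowp_Suc_I2[of "queue_step \<Delta>", OF s that] by simp
    have sy: "set (tl w @ \<beta>) \<subseteq> \<Gamma>" using queue_step_symbols[OF s] Suc.prems(2) by blast
    from c show ?thesis
    proof
      assume "m < 2 * (length (tl w) + length \<beta>) + 2"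
      then show ?thesis using L Suc by (simp add: algebra_simps)
    next
      assume *: "2 * (length (tl w) + length \<beta>) + 2 \<le> m \<and>
       (tm_step M ^^ (m - (2 * (length (tl w) + length \<beta>) + 2))) (main_config q' (tl w @ \<beta>)) c"
      then have "m - (2 * (length (tl w) + length \<beta>) + 2) \<le> (T + 1) * (2 * L + 3)"
        using Suc.IH[OF _ sy b] by blast
      then show ?thesis using L Suc * by (simp add: algebra_simps)
    qed
  qed simp
qed

end

lemma poly_of_bound: "\<exists>p :: nat poly. \<forall>n. poly p n = C * (n + 1) ^ e"
  by (rule exI[of _ "smult C ([:1, 1:] ^ e)"]) (simp add: poly_power)

lemma poly_le_power: "\<exists>C e. \<forall>n. poly (p :: nat poly) n \<le> C * (n + 1) ^ e"
proof (induction p)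
  case (pCons a p)
  then obtain C e where *: "\<And>n. poly p n \<le> C * (n + 1) ^ e" by blast
  have "poly (pCons a p) n \<le> (a + C) * (n + 1) ^ Suc e" for n
  proof -
    have "n * poly p n \<le> (n + 1) * (C * (n + 1) ^ e)" by (intro mult_mono *) auto
    moreover have "a * 1 \<le> a * (n + 1) ^ Suc e" by (intro mult_left_mono one_le_power) auto
    ultimately show ?thesis by (simp add: algebra_simps)
  qed
  then show ?case by blast
qed auto

lemma queue_step_length_bound:
  assumes "finite \<Delta>"
  obtains K where "\<And>m q w d. (queue_step \<Delta> ^^ m) (q, w) d \<Longrightarrow> length (snd d) \<le> length w + K * m"
proof -
  define K where "K = Max (insert 0 ((\<lambda>r. length (snd (snd r))) ` \<Delta>))"
  have K: "length \<beta> \<le> K" if "((q, a), (q', \<beta>)) \<in> \<Delta>" for q a q' \<beta>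
    unfolding K_def using imageI[OF that, of "\<lambda>r. length (snd (snd r))"] assms by (intro Max_ge) auto
  have "length (snd d) \<le> length (snd c) + K * m" if "(queue_step \<Delta> ^^ m) c d" for m c d
    using that
  proof (induction m arbitrary: d)
    case (Suc m)
    then obtain b where b: "(queue_step \<Delta> ^^ m) c b" "queue_step \<Delta> b d" by auto
    from b(2) have "length (snd d) \<le> length (snd b) + K" by (auto elim!: queue_step.cases dest: K)
    with Suc.IH[OF b(1)] show ?case by simp
  qed simp
  then show thesis using that by fastforce
qed

definition queue_alphabet :: "nat set \<Rightarrow> queue_rules \<Rightarrow> nat set" where
  "queue_alphabet \<Sigma> \<Delta> = \<Sigma> \<union> (\<Union>r \<in> \<Delta>. set (snd (snd r)))"

lemma queue_simulation_alphabet: "finite \<Sigma> \<Longrightarrow> finite \<Delta> \<Longrightarrow> queue_simulation (queue_alphabet \<Sigma> \<Delta>) \<Delta>"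
  by unfold_locales (force simp: queue_alphabet_def)+

lemma polynomial_time_sim_tm:
  assumes "finite \<Sigma>" "finite \<Delta>"
    and "\<And>x m d. x \<in> lists \<Sigma> \<Longrightarrow> (queue_step \<Delta> ^^ m) (q0, x) d \<Longrightarrow> m \<le> C * (length x + 1) ^ e"
  shows "polynomial_time_tm \<Sigma> (sim_tm (queue_alphabet \<Sigma> \<Delta>) \<Delta> q0 qa)"
proof -
  interpret queue_simulation "queue_alphabet \<Sigma> \<Delta>" \<Delta> q0 qa
    using assms(1,2) by (rule queue_simulation_alphabet)
  obtain K where K: "\<And>m q w d. (queue_step \<Delta> ^^ m) (q, w) d \<Longrightarrow> length (snd d) \<le> length w + K * m"
    using queue_step_length_bound[OF assms(2)] by blast
  obtain t :: "nat poly" where t: "\<And>n. poly t n = C * (n + 1) ^ e" using poly_of_bound by blast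
  have "n \<le> poly ((t + 1) * (smult 2 ([:0, 1:] + smult K t) + [:3:])) (length x)"
    if "x \<in> lists \<Sigma>" "(tm_step M ^^ n) (initial_config M x) c" for x n c
  proof -
    have "(tm_step M ^^ n) (main_config q0 x) c"
      using that(2) by (simp add: initial_config_def main_config_def tape_from_0 sim_tm_def)
    moreover have "set x \<subseteq> queue_alphabet \<Sigma> \<Delta>" using that(1) by (auto simp: queue_alphabet_def)
    moreover have "m \<le> poly t (length x) \<and> length (snd d) \<le> length x + K * poly t (length x)"
      if "(queue_step \<Delta> ^^ m) (q0, x) d" for m d
    proof -
      have "m \<le> poly t (length x)" using assms(3)[OF \<open>x \<in> lists \<Sigma>\<close> that] t by simp
      moreover from this have "length x + K * m \<le> length x + K * poly t (length x)" by simp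
      ultimately show ?thesis using K[OF that] by linarith
    qed
    ultimately have "n \<le> (poly t (length x) + 1) * (2 * (length x + K * poly t (length x)) + 3)"
      by (rule tm_run_bound)
    then show ?thesis by simp
  qed
  then show ?thesis unfolding polynomial_time_tm_def by blast
qed

lemma in_NP_queueI:
  assumes "finite \<Sigma>" "L \<subseteq> lists \<Sigma>" "finite \<Delta>"
    and final: "\<And>a r. ((qa, a), r) \<notin> \<Delta>"
    and time: "\<And>x m d. x \<in> lists \<Sigma> \<Longrightarrow> (queue_step \<Delta> ^^ m) (q0, x) d \<Longrightarrow> m \<le> C * (length x + 1) ^ e"
    and correct: "\<And>x. x \<in> lists \<Sigma> \<Longrightarrow> x \<in> L \<longleftrightarrow> (\<exists>w. (queue_step \<Delta>)\<^sup>*\<^sup>* (q0, x) (qa, w))"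
  shows "in_NP \<Sigma> L"
proof -
  interpret queue_simulation "queue_alphabet \<Sigma> \<Delta>" \<Delta> q0 qa
    using assms(1,3) by (rule queue_simulation_alphabet)
  have "x \<in> L \<longleftrightarrow> accepts M x" if x: "x \<in> lists \<Sigma>" for x
  proof -
    have sx: "set x \<subseteq> queue_alphabet \<Sigma> \<Delta>" using x by (auto simp: queue_alphabet_def)
    have i: "initial_config M x = main_config q0 x"
      by (simp add: initial_config_def main_config_def tape_from_0 sim_tm_def)
    show ?thesis
    proof
      assume "x \<in> L"
      then obtain w where "(queue_step \<Delta>)\<^sup>*\<^sup>* (q0, x) (qa, w)" using correct[OF x] by blast
      from queue_reach[OF this sx] show "accepts M x"
        using halted_main_iff[of qa w] final
        unfolding accepts_def i by (auto simp: main_config_def sim_tm_def)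
    next
      assume "accepts M x"
      moreover have "accept_state M = to_nat (Main qa)" by (simp add: sim_tm_def)
      ultimately obtain h t where "(tm_step M)\<^sup>*\<^sup>* (main_config q0 x) (to_nat (Main qa), h, t)"
        unfolding accepts_def i by metis
      from rtranclp_imp_relpowp[OF this] obtain n where
        "(tm_step M ^^ n) (main_config q0 x) (to_nat (Main qa), h, t)" by blast
      from tm_run_main[OF this sx] show "x \<in> L" using correct[OF x] by auto
    qed
  qed
  moreover have "well_formed_tm M"
    using fin by (simp add: well_formed_tm_def sim_tm_def finite_sim_instructions)
  moreover have "polynomial_time_tm \<Sigma> M"
    by (rule polynomial_time_sim_tm[OF assms(1,3)]) (erule (1) time)
  ultimately show ?thesis
    using assms(1,2) unfolding in_NP_def by blast
qed

definition queue_computable :: "nat list set \<Rightarrow> (nat list \<Rightarrow> nat list) \<Rightarrow> bool" where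
  "queue_computable X f \<longleftrightarrow> (\<exists>\<Delta> q0 qf C e. finite \<Delta> \<and> single_valued \<Delta> \<and> (\<forall>a r. ((qf, a), r) \<notin> \<Delta>) \<and>
     (\<forall>x \<in> X. \<exists>m \<le> C * (length x + 1) ^ e. (queue_step \<Delta> ^^ m) (q0, x) (qf, f x)))"

lemma queue_step_deterministic:
  "single_valued \<Delta> \<Longrightarrow> queue_step \<Delta> c d \<Longrightarrow> queue_step \<Delta> c d' \<Longrightarrow> d = d'"
  by (auto elim!: queue_step.cases dest: single_valuedD)

lemma deterministic_run_le:
  assumes "\<And>c d d'. R c d \<Longrightarrow> R c d' \<Longrightarrow> d = d'" "(R ^^ m) c d" "\<And>d'. \<not> R d d'" "(R ^^ n) c c'"
  shows "n \<le> (m :: nat)"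
  using assms(2,4)
proof (induction m arbitrary: n c)
  case 0
  have "c = d" using 0(1) by (rule relpowp_0_E)
  show ?case
  proof (cases n)
    case (Suc k)
    obtain b where "R c b" using 0(2)[unfolded Suc] by (rule relpowp_Suc_E2)
    then show ?thesis using assms(3) \<open>c = d\<close> by blast
  qed simp
next
  case (Suc m)
  show ?case
  proof (cases n)
    case (Suc k)
    obtain b where b: "R c b" "(R ^^ m) b d" using Suc.prems(1) by (rule relpowp_Suc_E2)
    obtain b' where b': "R c b'" "(R ^^ k) b' c'" using Suc.prems(2)[unfolded \<open>n = Suc k\<close>] by (rule relpowp_Suc_E2)
    have "b' = b" using assms(1) b(1) b'(1) by blast
    then have "k \<le> m" using Suc.IH[OF b(2)] b'(2) by simp
    then show ?thesis using \<open>n = Suc k\<close> by simp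
  qed simp
qed

lemma polynomial_time_computable_queueI:
  assumes "finite \<Sigma>" "queue_computable (lists \<Sigma>) f"
  shows "polynomial_time_computable \<Sigma> f"
proof -
  obtain \<Delta> q0 qf C e where \<Delta>: "finite \<Delta>" "single_valued \<Delta>" and final: "\<And>a r. ((qf, a), r) \<notin> \<Delta>"
    and run: "\<And>x. x \<in> lists \<Sigma> \<Longrightarrow> \<exists>m \<le> C * (length x + 1) ^ e. (queue_step \<Delta> ^^ m) (q0, x) (qf, f x)"
    using assms(2) unfolding queue_computable_def by blast
  interpret queue_simulation "queue_alphabet \<Sigma> \<Delta>" \<Delta> q0 qf
    using assms(1) \<Delta>(1) by (rule queue_simulation_alphabet)
  have halt: "\<not> queue_step \<Delta> (qf, w) d" for w d
    using final by (auto elim: queue_step.cases)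
  have "polynomial_time_tm \<Sigma> M"
  proof (rule polynomial_time_sim_tm[OF assms(1) \<Delta>(1)])
    fix x m d assume "x \<in> lists \<Sigma>" and d: "(queue_step \<Delta> ^^ m) (q0, x) d"
    from run[OF this(1)] obtain k where k: "k \<le> C * (length x + 1) ^ e" "(queue_step \<Delta> ^^ k) (q0, x) (qf, f x)" by blast
    have "m \<le> k"
      by (rule deterministic_run_le[OF queue_step_deterministic[OF \<Delta>(2)] k(2) halt d])
    then show "m \<le> C * (length x + 1) ^ e" using k(1) by simp
  qed
  moreover have "\<exists>q. (tm_step M)\<^sup>*\<^sup>* (initial_config M x) (q, 0, tape_of (f x)) \<and> halted M (q, 0, tape_of (f x))"
    if x: "x \<in> lists \<Sigma>" for x
  proof -
    have sx: "set x \<subseteq> queue_alphabet \<Sigma> \<Delta>" using x by (auto simp: queue_alphabet_def)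
    obtain m where "(queue_step \<Delta> ^^ m) (q0, x) (qf, f x)" using run[OF x] by blast
    from queue_reach[OF relpowp_imp_rtranclp[OF this] sx] halted_main_iff[of qf "f x"] final
    show ?thesis
      by (auto simp: initial_config_def main_config_def tape_from_0 sim_tm_def)
  qed
  moreover have "well_formed_tm M"
    using fin by (simp add: well_formed_tm_def sim_tm_def finite_sim_instructions)
  ultimately show ?thesis
    using deterministic_sim_tm[OF \<Delta>(2)] unfolding polynomial_time_computable_def by blast
qed

definition rename_rules :: "(nat \<Rightarrow> nat) \<Rightarrow> queue_rules \<Rightarrow> queue_rules" where
  "rename_rules r \<Delta> = (\<lambda>((q, a), (q', \<beta>)). ((r q, a), (r q', \<beta>))) ` \<Delta>"

lemma rename_run:
  assumes "(queue_step \<Delta> ^^ m) (q, w) (q', w')"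
  shows "(queue_step (rename_rules r \<Delta> \<union> \<Delta>') ^^ m) (r q, w) (r q', w')"
  using assms
proof (induction m arbitrary: q' w')
  case (Suc m)
  then obtain p v where p: "(queue_step \<Delta> ^^ m) (q, w) (p, v)" "queue_step \<Delta> (p, v) (q', w')" by auto
  from p(2) obtain \<beta> where "((p, first v), (q', \<beta>)) \<in> \<Delta>" "w' = tl v @ \<beta>" by (auto elim: queue_step.cases)
  then have "queue_step (rename_rules r \<Delta> \<union> \<Delta>') (r p, v) (r q', w')"
    by (auto simp: rename_rules_def intro!: queue_step.intros rev_image_eqI)
  with Suc.IH[OF p(1)] show ?case by auto
qed simp

lemma queue_computable_comp:
  assumes f: "queue_computable X f" and g: "queue_computable Y g" and XY: "\<And>x. x \<in> X \<Longrightarrow> f x \<in> Y"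
  shows "queue_computable X (\<lambda>x. g (f x))"
proof -
  obtain \<Delta>1 p0 pf C1 e1 where 1: "finite \<Delta>1" "single_valued \<Delta>1" "\<And>a r. ((pf, a), r) \<notin> \<Delta>1"
    "\<And>x. x \<in> X \<Longrightarrow> \<exists>m \<le> C1 * (length x + 1) ^ e1. (queue_step \<Delta>1 ^^ m) (p0, x) (pf, f x)"
    using f unfolding queue_computable_def by metis
  obtain \<Delta>2 q0 qf C2 e2 where 2: "finite \<Delta>2" "single_valued \<Delta>2" "\<And>a r. ((qf, a), r) \<notin> \<Delta>2"
    "\<And>x. x \<in> Y \<Longrightarrow> \<exists>m \<le> C2 * (length x + 1) ^ e2. (queue_step \<Delta>2 ^^ m) (q0, x) (qf, g x)"
    using g unfolding queue_computable_def by metis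
  define r1 where "r1 q = (if q = pf then 2 * q0 + 1 else 2 * q)" for q
  define r2 :: "nat \<Rightarrow> nat" where "r2 q = 2 * q + 1" for q
  define \<Delta> where "\<Delta> = rename_rules r1 \<Delta>1 \<union> rename_rules r2 \<Delta>2"
  obtain K where K: "\<And>m q w d. (queue_step \<Delta>1 ^^ m) (q, w) d \<Longrightarrow> length (snd d) \<le> length w + K * m"
    using queue_step_length_bound[OF 1(1)] by blast
  have par: "2 * (a::nat) \<noteq> Suc (2 * b)" "Suc (2 * b) \<noteq> 2 * a" for a b by presburger+
  have "finite \<Delta>" using 1 2 by (simp add: \<Delta>_def rename_rules_def)
  moreover have "single_valued \<Delta>"
  proof (rule single_valuedI)
    fix k x y assume "(k, x) \<in> \<Delta>" "(k, y) \<in> \<Delta>"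
    then show "x = y"
      using 1(2,3) 2(2) unfolding \<Delta>_def rename_rules_def r1_def r2_def
      by (auto split: if_splits simp: par dest: single_valuedD)
  qed
  moreover have "((r2 qf, a), r) \<notin> \<Delta>" for a r
    using 1(3) 2(3) unfolding \<Delta>_def rename_rules_def r1_def r2_def by (auto split: if_splits simp: par)
  moreover have "\<exists>m \<le> (C1 + C2 * (1 + K * C1) ^ e2) * (length x + 1) ^ (e1 + (e1 + 1) * e2).
     (queue_step \<Delta> ^^ m) (r1 p0, x) (r2 qf, g (f x))" if x: "x \<in> X" for x
  proof -
    let ?n = "length x + 1"
    obtain m where m: "m \<le> C1 * ?n ^ e1" "(queue_step \<Delta>1 ^^ m) (p0, x) (pf, f x)" using 1(4)[OF x] by blast
    obtain k where k: "k \<le> C2 * (length (f x) + 1) ^ e2" "(queue_step \<Delta>2 ^^ k) (q0, f x) (qf, g (f x))"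
      using 2(4)[OF XY[OF x]] by blast
    have a: "(queue_step \<Delta> ^^ m) (r1 p0, x) (r2 q0, f x)"
      using rename_run[OF m(2), of r1] by (simp add: \<Delta>_def r1_def r2_def)
    have b: "(queue_step \<Delta> ^^ k) (r2 q0, f x) (r2 qf, g (f x))"
      using rename_run[OF k(2), of r2] by (simp add: \<Delta>_def Un_commute)
    have run: "(queue_step \<Delta> ^^ (m + k)) (r1 p0, x) (r2 qf, g (f x))"
      using a b by (auto simp: relpowp_add)
    have pow: "?n ^ i \<le> ?n ^ j" if "i \<le> j" for i j using that by (intro power_increasing) auto
    have "length (f x) \<le> length x + K * m" using K[OF m(2)] by simp
    with mult_le_mono2[OF m(1), of K] have "length (f x) + 1 \<le> ?n + K * (C1 * ?n ^ e1)" by linarith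
    moreover have "?n \<le> ?n ^ (e1 + 1)" using pow[of 1 "e1 + 1"] by simp
    moreover have "K * (C1 * ?n ^ e1) \<le> K * (C1 * ?n ^ (e1 + 1))" by (intro mult_left_mono pow) auto
    ultimately have "length (f x) + 1 \<le> ?n ^ (e1 + 1) + K * (C1 * ?n ^ (e1 + 1))" by linarith
    then have "length (f x) + 1 \<le> (1 + K * C1) * ?n ^ (e1 + 1)" by (simp only: add_mult_distrib mult_1 mult.assoc)
    then have "(length (f x) + 1) ^ e2 \<le> ((1 + K * C1) * ?n ^ (e1 + 1)) ^ e2" by (rule power_mono) simp
    also have "\<dots> = (1 + K * C1) ^ e2 * ?n ^ ((e1 + 1) * e2)" by (simp only: power_mult_distrib power_mult)
    also have "\<dots> \<le> (1 + K * C1) ^ e2 * ?n ^ (e1 + (e1 + 1) * e2)" by (intro mult_left_mono pow) auto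
    finally have "k \<le> C2 * ((1 + K * C1) ^ e2 * ?n ^ (e1 + (e1 + 1) * e2))"
      using k(1) by (meson le_trans mult_le_mono2)
    moreover have "m \<le> C1 * ?n ^ (e1 + (e1 + 1) * e2)"
      using m(1) pow[of e1 "e1 + (e1 + 1) * e2"] by (meson le_add1 le_trans mult_le_mono2)
    ultimately have "m + k \<le> (C1 + C2 * (1 + K * C1) ^ e2) * ?n ^ (e1 + (e1 + 1) * e2)"
      unfolding add_mult_distrib mult.assoc by (rule add_mono[rotated])
    then show ?thesis using run by blast
  qed
  ultimately show ?thesis unfolding queue_computable_def by blast
qed

definition rules_of :: "nat set \<Rightarrow> nat set \<Rightarrow> (nat \<Rightarrow> nat option \<Rightarrow> (nat \<times> nat list) option) \<Rightarrow> queue_rules" where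
  "rules_of Q \<Gamma> \<delta> = {((q, a), r) | q a r. q \<in> Q \<and> a \<in> insert None (Some ` \<Gamma>) \<and> \<delta> q a = Some r}"

lemma finite_rules_of: "finite Q \<Longrightarrow> finite \<Gamma> \<Longrightarrow> finite (rules_of Q \<Gamma> \<delta>)"
  by (rule finite_subset[of _ "(\<lambda>(q, a). ((q, a), the (\<delta> q a))) ` (Q \<times> insert None (Some ` \<Gamma>))"])
    (auto simp: rules_of_def image_iff)

lemma single_valued_rules_of: "single_valued (rules_of Q \<Gamma> \<delta>)"
  by (auto simp: rules_of_def single_valued_def)

lemma rules_of_step:
  assumes "q \<in> Q" "a \<in> \<Gamma>" "\<delta> q (Some a) = Some (q', \<beta>)" "(queue_step (rules_of Q \<Gamma> \<delta>) ^^ m) (q', w @ \<beta>) d"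
  shows "(queue_step (rules_of Q \<Gamma> \<delta>) ^^ Suc m) (q, a # w) d"
proof -
  have "((q, first (a # w)), (q', \<beta>)) \<in> rules_of Q \<Gamma> \<delta>" using assms by (simp add: rules_of_def)
  from queue_step.intros[OF this] assms(4) show ?thesis by (metis list.sel(3) relpowp_Suc_I2)
qed

lemma rules_of_sweep:
  assumes "q \<in> Q" "set w \<subseteq> \<Gamma>" "\<And>a. a \<in> set w \<Longrightarrow> \<delta> q (Some a) = Some (q, h a)"
    and "(queue_step (rules_of Q \<Gamma> \<delta>) ^^ m) (q, v @ concat (map h w)) d"
  shows "(queue_step (rules_of Q \<Gamma> \<delta>) ^^ (length w + m)) (q, w @ v) d"
  using assms(2-)
proof (induction w arbitrary: v)
  case (Cons a w)
  then show ?case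
    using rules_of_step[of q Q a \<Gamma> \<delta> q "h a" "length w + m" "w @ v" d] assms(1) by simp
qed simp

lemma ex_fresh: "finite (A :: nat set) \<Longrightarrow> \<exists>a. a \<notin> A"
  using ex_new_if_finite infinite_UNIV_nat by blast

lemma queue_computable_affine:
  assumes "finite \<Sigma>"
  shows "queue_computable (lists \<Sigma>) (\<lambda>x. pre @ concat (map h x) @ post)"
proof -
  obtain mk where mk: "mk \<notin> \<Sigma>" using ex_fresh[OF assms] by blast
  define \<delta> where "\<delta> q a = (if q = (0::nat) then (case a of None \<Rightarrow> Some (2 :: nat, pre @ post) | Some a \<Rightarrow> Some (1, mk # pre @ h a))
     else (case a of None \<Rightarrow> None | Some a \<Rightarrow> if a = mk then Some (2, post) else Some (1, h a)))" for q a
  let ?\<Delta> = "rules_of {0, 1} (insert mk \<Sigma>) \<delta>"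
  have "\<exists>m \<le> 2 * (length x + 1) ^ 1. (queue_step ?\<Delta> ^^ m) (0, x) (2, pre @ concat (map h x) @ post)"
    if x: "x \<in> lists \<Sigma>" for x
  proof (cases x)
    case Nil
    have "((0, first []), (2, pre @ post)) \<in> ?\<Delta>" by (simp add: rules_of_def \<delta>_def)
    from queue_step.intros[OF this] Nil show ?thesis by (auto intro!: exI[of _ 1])
  next
    case (Cons a w)
    have "(queue_step ?\<Delta> ^^ Suc (length w + Suc 0)) (0, a # w) (2, pre @ concat (map h x) @ post)"
    proof (rule rules_of_step)
      show "(queue_step ?\<Delta> ^^ (length w + Suc 0)) (1, w @ mk # pre @ h a) (2, pre @ concat (map h x) @ post)"
      proof (rule rules_of_sweep)
        show "(queue_step ?\<Delta> ^^ Suc 0) (1, (mk # pre @ h a) @ concat (map h w)) (2, pre @ concat (map h x) @ post)"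
          using rules_of_step[of 1 "{0, 1}" mk "insert mk \<Sigma>" \<delta> 2 post 0 "pre @ h a @ concat (map h w)"] Cons
          by (simp add: \<delta>_def)
      qed (use x Cons mk in \<open>auto simp: \<delta>_def\<close>)
    qed (use x Cons in \<open>auto simp: \<delta>_def\<close>)
    then show ?thesis using Cons by (intro exI[of _ "Suc (length w + Suc 0)"] conjI) simp_all
  qed
  moreover have "((2, a), r) \<notin> ?\<Delta>" for a r by (auto simp: rules_of_def)
  ultimately show ?thesis
    using assms unfolding queue_computable_def
    by (intro exI[of _ ?\<Delta>] exI[of _ 0] exI[of _ 2] exI[of _ 2] exI[of _ 1])
      (simp add: finite_rules_of single_valued_rules_of)
qed

lemma partition_run:
  fixes B :: "nat set"
  assumes "finite \<Sigma>" "D \<notin> \<Sigma>" "E \<notin> \<Sigma>" "D \<noteq> E"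
  defines "\<delta> \<equiv> \<lambda>q a. (case a of None \<Rightarrow> None | Some a \<Rightarrow>
     if q = (0::nat) then (if a = D then Some (1, []) else if a \<in> B then Some (a + 3, []) else Some (0, [a]))
     else if q = 1 then (if a = E then Some (2, []) else Some (1, [a]))
     else (if a = E then Some (0, [q - 3, E]) else Some (q, [a])))"
  defines "\<Delta> \<equiv> rules_of ({0, 1} \<union> (\<lambda>a. a + 3) ` \<Sigma>) (insert D (insert E \<Sigma>)) \<delta>"
  assumes "set s \<subseteq> \<Sigma>" "set z \<subseteq> \<Sigma>"
  shows "\<exists>m \<le> (length s + 1) * (length s + length z + 3). (queue_step \<Delta> ^^ m) (0, s @ D # z @ [E])
     (2, filter (\<lambda>a. a \<notin> B) s @ z @ filter (\<lambda>a. a \<in> B) s)"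
  using assms(7,8)
proof (induction "length s" arbitrary: s z rule: less_induct)
  case less
  have cm: "concat (map (\<lambda>a. [a]) w) = w" for w :: "nat list" by (induction w) auto
  show ?case
  proof (cases "\<exists>b \<in> set s. b \<in> B")
    case False
    have s: "filter (\<lambda>a. a \<notin> B) s = s" "filter (\<lambda>a. a \<in> B) s = []"
      using False by (auto simp: filter_id_conv filter_empty_conv)
    have "(queue_step \<Delta> ^^ (length s + Suc (length z + Suc 0))) (0, s @ D # z @ [E]) (2, s @ z)"
      unfolding \<Delta>_def
    proof (rule rules_of_sweep[where h = "\<lambda>a. [a]"])
      show "(queue_step (rules_of ({0, 1} \<union> (\<lambda>a. a + 3) ` \<Sigma>) (insert D (insert E \<Sigma>)) \<delta>) ^^ Suc (length z + Suc 0))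
         (0, (D # z @ [E]) @ concat (map (\<lambda>a. [a]) s)) (2, s @ z)"
        unfolding append_Cons
      proof (rule rules_of_step[where q' = 1 and \<beta> = "[]"], goal_cases)
        case 4
        have "(queue_step (rules_of ({0, 1} \<union> (\<lambda>a. a + 3) ` \<Sigma>) (insert D (insert E \<Sigma>)) \<delta>) ^^ (length z + Suc 0))
         (1, z @ E # s) (2, s @ z)"
        proof (rule rules_of_sweep[where h = "\<lambda>a. [a]"], goal_cases)
          case 4
          show ?case unfolding append_Cons
            by (rule rules_of_step[where q' = 2 and \<beta> = "[]"]) (simp_all add: \<delta>_def cm)
        qed (use less.prems assms(2-4) in \<open>auto simp: \<delta>_def\<close>)
        then show ?case by (simp add: cm)
      qed (simp_all add: \<delta>_def)
    qed (use less.prems assms(2-4) False in \<open>auto simp: \<delta>_def\<close>)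
    then show ?thesis by (intro exI[of _ "length s + Suc (length z + Suc 0)"]) (simp add: s)
  next
    case True
    then obtain s1 b s2 where s: "s = s1 @ b # s2" "b \<in> B" "\<forall>a \<in> set s1. a \<notin> B"
      using split_list_first_prop[of s "\<lambda>b. b \<in> B"] by blast
    have b: "b \<in> \<Sigma>" "b \<noteq> D" "b \<noteq> E" using s less.prems assms(2,3) by auto
    have "set (s1 @ s2) \<subseteq> \<Sigma>" "set (z @ [b]) \<subseteq> \<Sigma>" using s(1) less.prems by auto
    with less.hyps[of "s1 @ s2" "z @ [b]"] s(1) obtain m where
      m: "m \<le> (length (s1 @ s2) + 1) * (length (s1 @ s2) + length (z @ [b]) + 3)"
         "(queue_step \<Delta> ^^ m) (0, (s1 @ s2) @ D # (z @ [b]) @ [E])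
       (2, filter (\<lambda>a. a \<notin> B) (s1 @ s2) @ (z @ [b]) @ filter (\<lambda>a. a \<in> B) (s1 @ s2))"
      by fastforce
    have r: "filter (\<lambda>a. a \<notin> B) (s1 @ s2) @ (z @ [b]) @ filter (\<lambda>a. a \<in> B) (s1 @ s2) =
        filter (\<lambda>a. a \<notin> B) s @ z @ filter (\<lambda>a. a \<in> B) s"
      using s by (auto simp: filter_empty_conv)
    let ?d = "(2, filter (\<lambda>a. a \<notin> B) s @ z @ filter (\<lambda>a. a \<in> B) s)"
    have "(queue_step \<Delta> ^^ (length s1 + Suc (length (s2 @ D # z) + Suc m))) (0, s1 @ b # s2 @ D # z @ [E]) ?d"
      unfolding \<Delta>_def
    proof (rule rules_of_sweep[where h = "\<lambda>a. [a]"], goal_cases)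
      case 4
      show ?case unfolding append_Cons
      proof (rule rules_of_step[where q' = "b + 3" and \<beta> = "[]"], goal_cases)
        case 4
        have "(queue_step \<Delta> ^^ (length (s2 @ D # z) + Suc m)) (b + 3, (s2 @ D # z) @ E # s1) ?d"
          unfolding \<Delta>_def
        proof (rule rules_of_sweep[where h = "\<lambda>a. [a]"], goal_cases)
          case 4
          show ?case unfolding append_Cons
            by (rule rules_of_step[where q' = 0 and \<beta> = "[b, E]"])
              (use b m(2)[unfolded r] in \<open>simp_all add: \<delta>_def cm \<Delta>_def\<close>)
        qed (use less.prems assms(2-4) b s in \<open>auto simp: \<delta>_def\<close>)
        then show ?case by (simp add: cm \<Delta>_def)
      qed (use b s in \<open>simp_all add: \<delta>_def\<close>)
    qed (use less.prems assms(2-4) s in \<open>auto simp: \<delta>_def\<close>)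
    then have "(queue_step \<Delta> ^^ (length s1 + Suc (length (s2 @ D # z) + Suc m))) (0, s @ D # z @ [E]) ?d"
      using s(1) by simp
    moreover have "length s1 + Suc (length (s2 @ D # z) + Suc m) \<le> (length s + 1) * (length s + length z + 3)"
      using m(1) s(1) by (simp add: algebra_simps)
    ultimately show ?thesis by blast
  qed
qed

lemma queue_computable_partition:
  assumes "finite \<Sigma>"
  shows "queue_computable (lists \<Sigma>) (\<lambda>x. filter (\<lambda>a. a \<notin> B) x @ filter (\<lambda>a. a \<in> B) x)"
proof -
  obtain D where D: "D \<notin> \<Sigma>" using ex_fresh[OF assms] by blast
  obtain E where "E \<notin> insert D \<Sigma>" using ex_fresh[of "insert D \<Sigma>"] assms by blast
  then have E: "E \<notin> \<Sigma>" "D \<noteq> E" by auto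
  define \<delta> where "\<delta> = (\<lambda>q a. (case a of None \<Rightarrow> None | Some a \<Rightarrow>
     if q = (0::nat) then (if a = D then Some (1, []) else if a \<in> B then Some (a + 3, []) else Some (0, [a]))
     else if q = 1 then (if a = E then Some (2, []) else Some (1, [a]))
     else (if a = E then Some (0, [q - 3, E]) else Some (q, [a]))))"
  define \<Delta> where "\<Delta> = rules_of ({0, 1} \<union> (\<lambda>a. a + 3) ` \<Sigma>) (insert D (insert E \<Sigma>)) \<delta>"
  define f where "f = (\<lambda>x. filter (\<lambda>a. a \<notin> B) x @ filter (\<lambda>a. a \<in> B) x)"
  have "queue_computable ((\<lambda>s. s @ [D, E]) ` lists \<Sigma>) (\<lambda>x. f (butlast (butlast x)))"
    unfolding queue_computable_def
  proof (intro exI conjI)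
    show "finite \<Delta>" using assms by (simp add: \<Delta>_def finite_rules_of)
    show "single_valued \<Delta>" by (simp add: \<Delta>_def single_valued_rules_of)
    show "\<forall>a r. ((2, a), r) \<notin> \<Delta>" by (auto simp: \<Delta>_def rules_of_def)
    show "\<forall>x \<in> (\<lambda>s. s @ [D, E]) ` lists \<Sigma>. \<exists>m \<le> 1 * (length x + 1) ^ 2.
      (queue_step \<Delta> ^^ m) (0, x) (2, f (butlast (butlast x)))"
    proof
      fix x assume "x \<in> (\<lambda>s. s @ [D, E]) ` lists \<Sigma>"
      then obtain s where s: "x = s @ [D, E]" "set s \<subseteq> \<Sigma>" by auto
      then have "butlast (butlast x) = s" by (simp add: butlast_append)
      with partition_run[OF assms D E(1,2) s(2), of "[]" B] s(1) obtain m where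
        "m \<le> (length s + 1) * (length s + 3)" "(queue_step \<Delta> ^^ m) (0, x) (2, f (butlast (butlast x)))"
        by (auto simp: \<Delta>_def \<delta>_def f_def)
      moreover have "(length s + 1) * (length s + 3) \<le> 1 * (length x + 1) ^ 2"
        using s(1) by (simp add: power2_eq_square algebra_simps)
      ultimately show "\<exists>m \<le> 1 * (length x + 1) ^ 2. (queue_step \<Delta> ^^ m) (0, x) (2, f (butlast (butlast x)))"
        by (meson le_trans)
    qed
  qed
  moreover have "queue_computable (lists \<Sigma>) (\<lambda>x. [] @ concat (map (\<lambda>a. [a]) x) @ [D, E])"
    by (rule queue_computable_affine[OF assms])
  moreover have "concat (map (\<lambda>a. [a]) x) = x" for x :: "nat list" by (induction x) auto
  ultimately have "queue_computable (lists \<Sigma>) (\<lambda>x. f (butlast (butlast (x @ [D, E]))))"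
    using queue_computable_comp[of "lists \<Sigma>" "\<lambda>x. x @ [D, E]" _ "\<lambda>x. f (butlast (butlast x))"] by simp
  then show ?thesis by (simp add: butlast_append f_def)
qed

definition fill :: "nat \<Rightarrow> nat list \<Rightarrow> nat \<Rightarrow> nat list \<Rightarrow> nat list" where
  "fill b t n s = concat (map (\<lambda>a. if a = b then b # concat (replicate n t) else [a]) s)"

lemma queue_computable_fill:
  assumes "finite \<Sigma>" "c \<notin> \<Sigma>" "d \<notin> \<Sigma>" "c \<noteq> d" "set t \<subseteq> \<Sigma>" "b \<notin> set t"
  shows "queue_computable {replicate n c @ d # s | n s. s \<in> lists \<Sigma>}
     (\<lambda>x. fill b t (length (takeWhile (\<lambda>a. a = c) x)) (tl (dropWhile (\<lambda>a. a = c) x)))"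
proof -
  obtain mk where "mk \<notin> insert c (insert d \<Sigma>)" using ex_fresh[of "insert c (insert d \<Sigma>)"] assms(1) by blast
  then have mk: "mk \<notin> \<Sigma>" "mk \<noteq> c" "mk \<noteq> d" by auto
  define h where "h a = (if a = b then b # t else [a])" for a
  define \<delta> where "\<delta> q a = (case a of None \<Rightarrow> None | Some a \<Rightarrow>
     if q = (0::nat) then (if a = c then Some (1 :: nat, [mk]) else if a = d then Some (2, []) else None)
     else if a = mk then Some (0, []) else if a = c \<or> a = d then Some (1, [a]) else Some (1, h a))" for q a
  define \<Gamma> where "\<Gamma> = insert mk (insert c (insert d \<Sigma>))"
  define \<Delta> where "\<Delta> = rules_of {0, 1} \<Gamma> \<delta>"
  have ff: "concat (map h (fill b t n s)) = fill b t (Suc n) s" for n s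
  proof -
    have "concat (map h t) = t" using assms(6) by (induction t) (auto simp: h_def)
    then have "concat (map h (concat (replicate n t))) = concat (replicate n t)" by (induction n) auto
    then show ?thesis
      by (induction s) (auto simp: fill_def h_def)
  qed
  have fs: "set (fill b t n s) \<subseteq> \<Sigma>" if "set s \<subseteq> \<Sigma>" for n s
    using that assms(5) by (auto simp: fill_def split: if_splits)
  have fl: "length (fill b t n s) \<le> (1 + n * length t) * length s" for n s
    by (induction s) (auto simp: fill_def length_concat sum_list_replicate algebra_simps)
  have mono: "length (fill b t n s) \<le> length (fill b t (Suc n) s)" for n s
    by (induction s) (auto simp: fill_def)
  have round: "\<exists>m \<le> (i + 1) * (i + length (fill b t (j + i) s) + 3).
      (queue_step \<Delta> ^^ m) (0, replicate i c @ d # fill b t j s) (2, fill b t (j + i) s)"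
    if s: "set s \<subseteq> \<Sigma>" for i j s
  proof (induction i arbitrary: j)
    case 0
    have "(queue_step \<Delta> ^^ Suc 0) (0, d # fill b t j s) (2, fill b t j s)"
      unfolding \<Delta>_def by (rule rules_of_step[where q' = 2 and \<beta> = "[]"]) (use assms(4) in \<open>auto simp: \<delta>_def \<Gamma>_def\<close>)
    then show ?case by (intro exI[of _ "Suc 0"]) simp
  next
    case (Suc i)
    define w where "w = replicate i c @ d # fill b t j s"
    define h' where "h' a = (if a = c \<or> a = d then [a] else h a)" for a
    have "b = c \<or> b = d \<Longrightarrow> h' b = [b]" by (simp add: h'_def)
    have hw: "concat (map h' w) = replicate i c @ d # fill b t (Suc j) s"
    proof -
      have "concat (map h' (fill b t j s)) = concat (map h (fill b t j s))"
        using fs[OF s, of j] assms(2,3) by (intro arg_cong[of _ _ concat] map_cong) (auto simp: h'_def)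
      moreover have "concat (map h' (replicate i c)) = replicate i c" by (induction i) (auto simp: h'_def)
      ultimately show ?thesis using ff by (simp add: w_def h'_def)
    qed
    from Suc[of "Suc j"] obtain m where m: "m \<le> (i + 1) * (i + length (fill b t (j + Suc i) s) + 3)"
      "(queue_step \<Delta> ^^ m) (0, replicate i c @ d # fill b t (Suc j) s) (2, fill b t (j + Suc i) s)" by auto
    have "(queue_step \<Delta> ^^ Suc (length w + Suc m)) (0, c # w) (2, fill b t (j + Suc i) s)"
      unfolding \<Delta>_def
    proof (rule rules_of_step[where q' = 1 and \<beta> = "[mk]"], goal_cases)
      case 4
      show ?case
      proof (rule rules_of_sweep[where h = h'], goal_cases)
        case 4
        show ?case unfolding append_Cons
          by (rule rules_of_step[where q' = 0 and \<beta> = "[]"]) (use m(2) hw in \<open>simp_all add: \<delta>_def \<Gamma>_def \<Delta>_def\<close>)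
      qed (use fs[OF s, of j] mk in \<open>auto simp: w_def \<Gamma>_def \<delta>_def h'_def\<close>)
    qed (simp_all add: \<delta>_def \<Gamma>_def)
    moreover have "length (fill b t j s) \<le> length (fill b t (j + Suc i) s)"
      using lift_Suc_mono_le[of "\<lambda>n. length (fill b t n s)", OF mono] by simp
    then have "Suc (length w + Suc m) \<le> (Suc i + 1) * (Suc i + length (fill b t (j + Suc i) s) + 3)"
      using m(1) by (simp add: w_def algebra_simps)
    ultimately show ?case by (intro exI[of _ "Suc (length w + Suc m)"]) (simp add: w_def)
  qed
  show ?thesis
    unfolding queue_computable_def
  proof (intro exI conjI)
    show "finite \<Delta>" using assms by (simp add: \<Delta>_def \<Gamma>_def finite_rules_of)
    show "single_valued \<Delta>" by (simp add: \<Delta>_def single_valued_rules_of)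
    show "\<forall>a r. ((2, a), r) \<notin> \<Delta>" by (auto simp: \<Delta>_def rules_of_def)
    show "\<forall>x \<in> {replicate n c @ d # s | n s. s \<in> lists \<Sigma>}. \<exists>m \<le> (5 + length t) * (length x + 1) ^ 3.
      (queue_step \<Delta> ^^ m) (0, x) (2, fill b t (length (takeWhile (\<lambda>a. a = c) x)) (tl (dropWhile (\<lambda>a. a = c) x)))"
    proof
      fix x assume "x \<in> {replicate n c @ d # s | n s. s \<in> lists \<Sigma>}"
      then obtain n s where x: "x = replicate n c @ d # s" and s: "set s \<subseteq> \<Sigma>" by auto
      have tw: "length (takeWhile (\<lambda>a. a = c) x) = n" "tl (dropWhile (\<lambda>a. a = c) x) = s"
        using assms(4) by (auto simp: x takeWhile_append dropWhile_append)
      have f0: "fill b t 0 s = s" by (induction s) (auto simp: fill_def)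
      from round[OF s, of n 0] obtain m where m: "m \<le> (n + 1) * (n + length (fill b t n s) + 3)"
        "(queue_step \<Delta> ^^ m) (0, x) (2, fill b t n s)" by (auto simp: x f0)
      let ?N = "length x + 1"
      have N: "?N \<le> ?N ^ 2" by (simp add: power2_eq_square)
      have "n + 1 \<le> ?N" "length s \<le> ?N" by (simp_all add: x)
      moreover have "(1 + n * length t) * length s \<le> ?N + length t * ?N ^ 2"
      proof -
        have "n * length s \<le> ?N * ?N" by (intro mult_le_mono) (simp_all add: x)
        then have "length t * (n * length s) \<le> length t * (?N * ?N)" by (rule mult_le_mono2)
        moreover have "length s \<le> ?N" by (simp add: x)
        ultimately have "length s + length t * (n * length s) \<le> ?N + length t * (?N * ?N)" by (rule add_mono[rotated])
        moreover have "(1 + n * length t) * length s = length s + length t * (n * length s)" by (simp add: algebra_simps)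
        ultimately show ?thesis by (simp only: power2_eq_square)
      qed
      moreover have "length (fill b t n s) \<le> (1 + n * length t) * length s" by (rule fl)
      ultimately have "n + length (fill b t n s) + 3 \<le> ?N + (?N + length t * ?N ^ 2) + 3" by linarith
      also have "\<dots> \<le> ?N ^ 2 + (?N ^ 2 + length t * ?N ^ 2) + 3 * ?N ^ 2"
        using N by (intro add_mono) auto
      also have "\<dots> = (5 + length t) * ?N ^ 2" by (simp only: add_mult_distrib)
      finally have "(n + 1) * (n + length (fill b t n s) + 3) \<le> ?N * ((5 + length t) * ?N ^ 2)"
        by (intro mult_le_mono) (simp_all add: x)
      also have "\<dots> = (5 + length t) * ?N ^ 3" by (simp only: power3_eq_cube power2_eq_square mult.commute mult.left_commute)
      finally show "\<exists>m \<le> (5 + length t) * (length x + 1) ^ 3.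
        (queue_step \<Delta> ^^ m) (0, x) (2, fill b t (length (takeWhile (\<lambda>a. a = c) x)) (tl (dropWhile (\<lambda>a. a = c) x)))"
        unfolding tw using m by (meson le_trans)
    qed
  qed
qed

section \<open>Free reduction\<close>

definition red :: "'a gword \<Rightarrow> 'a gword" where
  "red w = foldr push_letter w []"

definition inv_letter :: "'a \<times> bool \<Rightarrow> 'a \<times> bool" where
  "inv_letter x = (fst x, \<not> snd x)"

definition winv :: "'a gword \<Rightarrow> 'a gword" where
  "winv w = rev (map inv_letter w)"

lemma inv_letter_simps [simp]: "inv_letter (x, b) = (x, \<not> b)" "inv_letter (inv_letter z) = z"
  by (simp_all add: inv_letter_def)

lemma inverse_letters_iff: "inverse_letters x y \<longleftrightarrow> y = inv_letter x"
  by (cases x; cases y) (auto simp: inverse_letters_def)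

lemma winv_simps [simp]: "winv [] = []" "winv (x # w) = winv w @ [inv_letter x]" "winv (u @ v) = winv v @ winv u"
  by (simp_all add: winv_def)

lemma winv_winv [simp]: "winv (winv w) = w"
  by (induction w) auto

lemma length_winv [simp]: "length (winv w) = length w"
  by (simp add: winv_def)

lemma reduced_Nil [simp]: "reduced []"
  by (simp add: reduced_def)

lemma reduced_red [simp]: "reduced (red w)"
  by (simp add: red_def reduced_foldr_push)

lemma red_Nil [simp]: "red [] = []"
  by (simp add: red_def)

lemma red_Cons: "red (x # w) = push_letter x (red w)"
  by (simp add: red_def)

lemma red_append: "red (u @ v) = foldr push_letter u (red v)"
  by (simp add: red_def)

lemma red_of_reduced: "reduced w \<Longrightarrow> red w = w"
  by (simp add: red_def foldr_push_Nil)

lemma red_red [simp]: "red (red w) = red w"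
  by (simp add: red_of_reduced)

lemma red_append_red [simp]: "red (u @ red v) = red (u @ v)" "red (red u @ v) = red (u @ v)"
proof -
  show "red (u @ red v) = red (u @ v)" by (simp add: red_append)
  show "red (red u @ v) = red (u @ v)"
    using foldr_push_assoc[of "red v" u "[]"] by (simp add: red_append red_def[of u])
qed

lemma red_cong: "red u = red u' \<Longrightarrow> red v = red v' \<Longrightarrow> red (u @ v) = red (u' @ v')"
  by (metis red_append_red)

lemma red_cancel: "red (u @ x # inv_letter x # v) = red (u @ v)"
proof -
  have "push_letter x (push_letter (inv_letter x) (red v)) = red v"
    by (rule push_letter_inverse) (auto simp: inverse_letters_iff)
  then show ?thesis by (simp add: red_append red_Cons)
qed

lemma red_winv_left: "red (winv w @ w @ v) = red v"
proof (induction w arbitrary: v)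
  case (Cons x w)
  have "red (winv (x # w) @ (x # w) @ v) = red (winv w @ inv_letter x # inv_letter (inv_letter x) # (w @ v))" by simp
  then show ?case using Cons by (simp only: red_cancel)
qed simp

lemma red_winv_right: "red (w @ winv w @ v) = red v"
  using red_winv_left[of "winv w" v] by simp

lemma red_left_cancel: "red (u @ v) = red (u @ w) \<longleftrightarrow> red v = red w"
  by (metis red_append_red(1) red_winv_left)

lemma red_right_cancel: "red (v @ u) = red (w @ u) \<longleftrightarrow> red v = red w"
proof
  assume "red (v @ u) = red (w @ u)"
  then have "red ((v @ u) @ winv u) = red ((w @ u) @ winv u)" using red_cong by blast
  moreover have "red (v @ u @ winv u) = red v" for v
    using red_winv_right[of u "[]"] red_cong[of v v "u @ winv u" "[]"] by simp
  ultimately show "red v = red w" by simp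
qed (auto intro: red_cong)

lemma red_append_eq_iff: "red (u @ v) = red w \<longleftrightarrow> red v = red (winv u @ w)"
  using red_left_cancel[of "winv u" "u @ v" w] by (simp add: red_winv_left)

lemma red_winv_cong: "red u = red v \<Longrightarrow> red (winv u) = red (winv v)"
  by (metis append_Nil2 red_append_eq_iff red_right_cancel red_winv_left winv_winv)

lemma set_push_letter: "set (push_letter x w) \<subseteq> insert x (set w)"
  by (cases w) auto

lemma set_red: "set (red w) \<subseteq> set w"
proof (induction w)
  case (Cons x w)
  then show ?case using set_push_letter[of x "red w"] by (auto simp: red_Cons)
qed simp

lemma red_action:
  assumes "\<And>x s. act x (act (inv_letter x) s) = s"
  shows "foldr act (red w) s = foldr act w s"
proof (induction w)
  case (Cons x w)
  have "foldr act (push_letter x v) s = act x (foldr act v s)" for v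
    using assms by (cases v) (auto simp: inverse_letters_iff)
  with Cons show ?case by (simp add: red_Cons)
qed simp

lemma red_action_eq:
  assumes "\<And>x s. act x (act (inv_letter x) s) = s" "red v = red w"
  shows "foldr act v s = foldr act w s"
  using red_action[of act, OF assms(1)] assms(2) by metis

lemma exists_adjacent_inverse:
  assumes "red w = []" "w \<noteq> []"
  obtains u x v where "w = u @ x # inv_letter x # v"
proof -
  have "\<not> reduced w" using assms red_of_reduced by metis
  then have "\<exists>u x v. w = u @ x # inv_letter x # v"
  proof (induction w rule: induct_list012)
    case (3 x y zs)
    show ?case
    proof (cases "inverse_letters x y")
      case True
      then show ?thesis by (metis append_Nil inverse_letters_iff)
    next
      case False
      then have "\<not> reduced (y # zs)" using 3 by (simp add: reduced_def)
      then show ?thesis using 3 by (metis append_Cons)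
    qed
  qed (auto simp: reduced_def)
  then show thesis using that by blast
qed

lemma red_separator:
  assumes Z: "\<And>z. z \<in> Z \<Longrightarrow> inv_letter z \<notin> Z" and z: "z \<in> Z"
    and a: "\<And>x. x \<in> set a \<Longrightarrow> x \<notin> Z \<and> inv_letter x \<notin> Z"
    and b: "\<And>x. x \<in> set b \<Longrightarrow> inv_letter x \<notin> Z"
  shows "red (a @ z # b) = red a @ z # red b"
proof -
  have zb: "red (z # b) = z # red b"
  proof (cases "red b")
    case (Cons y ys)
    then have "y \<in> set b" using set_red[of b] by auto
    with b have "inv_letter y \<notin> Z" by blast
    with z have "y \<noteq> inv_letter z" by auto
    then show ?thesis using Cons by (simp add: red_Cons inverse_letters_iff)
  qed (simp add: red_Cons)
  have "foldr push_letter a (z # R) = red a @ z # R" for R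
    using a
  proof (induction a)
    case (Cons x a)
    then have "z \<noteq> inv_letter x" using z by (metis inv_letter_simps(2) list.set_intros(1))
    then show ?case using Cons by (cases "red a") (auto simp: red_Cons inverse_letters_iff)
  qed simp
  then show ?thesis using zb by (simp add: red_append)
qed

lemma red_separator_eq:
  assumes Z: "\<And>z. z \<in> Z \<Longrightarrow> inv_letter z \<notin> Z" and z: "z \<in> Z" "z' \<in> Z"
    and a: "\<And>x. x \<in> set a \<union> set a' \<Longrightarrow> x \<notin> Z \<and> inv_letter x \<notin> Z"
    and b: "\<And>x. x \<in> set b \<union> set b' \<Longrightarrow> inv_letter x \<notin> Z"
    and eq: "red (a @ z # b) = red (a' @ z' # b')"
  shows "red a = red a' \<and> z = z' \<and> red b = red b'"
proof -
  have "red a @ z # red b = red a' @ z' # red b'"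
    using eq red_separator[of Z z a b] red_separator[of Z z' a' b'] assms by simp
  moreover have "\<forall>x \<in> set (red a) \<union> set (red a'). x \<notin> Z"
    using a set_red[of a] set_red[of a'] by blast
  moreover have "xs = xs' \<and> z = z' \<and> ys = ys'"
    if "xs @ z # ys = xs' @ z' # ys'" "\<forall>x \<in> set xs \<union> set xs'. x \<notin> Z" for xs xs' ys ys'
    using that z by (induction xs arbitrary: xs') (auto simp: Cons_eq_append_conv append_eq_Cons_conv)
  ultimately show ?thesis by blast
qed

lemma red_separator_neq:
  assumes Z: "\<And>z. z \<in> Z \<Longrightarrow> inv_letter z \<notin> Z" and z: "z \<in> Z"
    and a: "\<And>x. x \<in> set a \<Longrightarrow> x \<notin> Z \<and> inv_letter x \<notin> Z"
    and b: "\<And>x. x \<in> set b \<Longrightarrow> inv_letter x \<notin> Z"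
    and c: "\<And>x. x \<in> set c \<Longrightarrow> x \<notin> Z"
  shows "red (a @ z # b) \<noteq> red c"
proof
  assume "red (a @ z # b) = red c"
  then have "z \<in> set (red c)" using red_separator[of Z z a b] assms by (metis in_set_conv_decomp)
  then show False using set_red[of c] c z by blast
qed

definition letter_word :: "nat gword list \<Rightarrow> nat \<times> bool \<Rightarrow> nat gword" where
  "letter_word R l = (if snd l then R ! fst l else winv (R ! fst l))"

definition flat_word :: "nat gword list \<Rightarrow> nat gword \<Rightarrow> nat gword" where
  "flat_word R w = concat (map (letter_word R) w)"

lemma letter_word_inv: "winv (letter_word R l) = letter_word R (inv_letter l)"
  by (simp add: letter_word_def inv_letter_def)

lemma flat_word_simps [simp]: "flat_word R [] = []" "flat_word R (l # w) = letter_word R l @ flat_word R w"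
  "flat_word R (u @ v) = flat_word R u @ flat_word R v"
  by (simp_all add: flat_word_def)

lemma flat_word_winv: "flat_word R (winv w) = winv (flat_word R w)"
  by (induction w) (auto simp: letter_word_inv)

lemma carrier_F2: "w \<in> carrier F2 \<longleftrightarrow> set w \<subseteq> {0, 1} \<times> UNIV \<and> reduced w"
  by (auto simp: F2_def free_group_def)

lemma group_F2: "group F2"
  by (simp add: F2_def group_free_group)

lemma mult_F2: "u \<otimes>\<^bsub>F2\<^esub> v = foldr push_letter u v"
  by (simp add: F2_def free_group_def)

lemma one_F2: "\<one>\<^bsub>F2\<^esub> = []"
  by (simp add: F2_def free_group_def)

lemma mult_F2_pair: "(a, b) \<otimes>\<^bsub>F2 \<times>\<times> F2\<^esub> (c, d) = (foldr push_letter a c, foldr push_letter b d)"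
  by (simp add: DirProd_def mult_F2)

lemma red_in_F2: "set w \<subseteq> {0, 1} \<times> UNIV \<Longrightarrow> red w \<in> carrier F2"
  using set_red[of w] by (auto simp: carrier_F2)

lemma set_winv: "set w \<subseteq> {0, 1} \<times> UNIV \<Longrightarrow> set (winv w) \<subseteq> {0, 1} \<times> UNIV"
  by (auto simp: winv_def inv_letter_def)

lemma inv_F2:
  assumes "w \<in> carrier F2"
  shows "inv\<^bsub>F2\<^esub> w = red (winv w)"
proof (rule group.inv_equality[OF group_F2])
  have "red (red (winv w) @ w) = []" using red_winv_left[of w "[]"] by simp
  then show "red (winv w) \<otimes>\<^bsub>F2\<^esub> w = \<one>\<^bsub>F2\<^esub>"
    using assms by (simp add: mult_F2 one_F2 red_append carrier_F2 red_of_reduced)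
  show "red (winv w) \<in> carrier F2" using assms by (intro red_in_F2 set_winv) (simp add: carrier_F2)
qed (fact assms)

lemma letter_word_letters:
  assumes "set R \<subseteq> carrier F2" "fst l < length R"
  shows "set (letter_word R l) \<subseteq> {0, 1} \<times> UNIV"
proof -
  have "R ! fst l \<in> carrier F2" using assms by auto
  then show ?thesis using set_winv[of "R ! fst l"] by (auto simp: letter_word_def carrier_F2)
qed

lemma letter_value_F2:
  assumes "set S \<subseteq> carrier (F2 \<times>\<times> F2)" "fst l < length S"
  shows "letter_value (F2 \<times>\<times> F2) S l = (red (letter_word (map fst S) l), red (letter_word (map snd S) l))"
proof -
  have "S ! fst l \<in> carrier (F2 \<times>\<times> F2)" using assms by auto
  then obtain u v where S: "S ! fst l = (u, v)" "u \<in> carrier F2" "v \<in> carrier F2" by (auto simp: DirProd_def)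
  have "inv\<^bsub>F2 \<times>\<times> F2\<^esub> (u, v) = (inv\<^bsub>F2\<^esub> u, inv\<^bsub>F2\<^esub> v)"
    using inv_DirProd[OF group_F2 group_F2 S(2,3)] .
  then show ?thesis
    using S assms(2) by (cases l) (auto simp: letter_word_def inv_F2 carrier_F2 red_of_reduced)
qed

lemma word_value_F2:
  assumes "set S \<subseteq> carrier (F2 \<times>\<times> F2)" "w \<in> words_over S"
  shows "word_value (F2 \<times>\<times> F2) S w = (red (flat_word (map fst S) w), red (flat_word (map snd S) w))"
  using assms(2)
proof (induction w)
  case Nil
  then show ?case by (simp add: word_value_def one_F2 DirProd_def)
next
  case (Cons l w)
  then have l: "fst l < length S" and w: "w \<in> words_over S" by (auto simp: words_over_def)
  have "word_value (F2 \<times>\<times> F2) S (l # w) = letter_value (F2 \<times>\<times> F2) S l \<otimes>\<^bsub>F2 \<times>\<times> F2\<^esub> word_value (F2 \<times>\<times> F2) S w"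
    by (simp add: word_value_def)
  also have "\<dots> = (red (red (letter_word (map fst S) l) @ flat_word (map fst S) w),
      red (red (letter_word (map snd S) l) @ flat_word (map snd S) w))"
    unfolding letter_value_F2[OF assms(1) l] Cons.IH[OF w]
    by (simp add: mult_F2 red_append del: red_append_red)
  finally show ?case by simp
qed

lemma generate_words:
  assumes "set S \<subseteq> carrier (F2 \<times>\<times> F2)" "g \<in> generate (F2 \<times>\<times> F2) (set S)"
  shows "\<exists>w \<in> words_over S. word_value (F2 \<times>\<times> F2) S w = g"
  using assms(2)
proof (induction rule: generate.induct)
  case one
  show ?case by (rule bexI[of _ "[]"]) (auto simp: word_value_def words_over_def)
next
  case (incl h)
  then obtain i where i: "i < length S" "h = S ! i" by (auto simp: in_set_conv_nth)
  have w: "[(i, True)] \<in> words_over S" using i by (simp add: words_over_def)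
  have "h \<in> carrier (F2 \<times>\<times> F2)" using incl assms(1) by auto
  then show ?case using i word_value_F2[OF assms(1) w]
    by (intro bexI[OF _ w]) (auto simp: DirProd_def letter_word_def carrier_F2 red_of_reduced)
next
  case (inv h)
  then obtain i where i: "i < length S" "h = S ! i" by (auto simp: in_set_conv_nth)
  have w: "[(i, False)] \<in> words_over S" using i by (simp add: words_over_def)
  show ?case using i word_value_F2[OF assms(1) w] letter_value_F2[OF assms(1), of "(i, False)"]
    by (intro bexI[OF _ w]) auto
next
  case (eng h1 h2)
  then obtain u v where u: "u \<in> words_over S" "word_value (F2 \<times>\<times> F2) S u = h1"
    and v: "v \<in> words_over S" "word_value (F2 \<times>\<times> F2) S v = h2" by auto
  have w: "u @ v \<in> words_over S" using u v by (simp add: words_over_def)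
  have "h1 \<otimes>\<^bsub>F2 \<times>\<times> F2\<^esub> h2 = (red (flat_word (map fst S) u @ flat_word (map fst S) v),
      red (flat_word (map snd S) u @ flat_word (map snd S) v))"
    unfolding u(2)[symmetric] v(2)[symmetric] word_value_F2[OF assms(1) u(1)] word_value_F2[OF assms(1) v(1)]
      mult_F2_pair red_append[symmetric] red_append_red ..
  then have "word_value (F2 \<times>\<times> F2) S (u @ v) = h1 \<otimes>\<^bsub>F2 \<times>\<times> F2\<^esub> h2"
    using word_value_F2[OF assms(1) w] by simp
  then show ?case using w by blast
qed

section \<open>Membership in NP\<close>

type_synonym token = "bool \<times> nat \<times> bool"

definition track :: "bool \<Rightarrow> token list \<Rightarrow> nat gword" where
  "track c s = map snd (filter (\<lambda>t. fst t = c) s)"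

definition trivial_tokens :: "token list \<Rightarrow> bool" where
  "trivial_tokens s \<longleftrightarrow> red (track True s) = [] \<and> red (track False s) = []"

lemma track_simps [simp]: "track c [] = []" "track c (t # s) = (if fst t = c then snd t # track c s else track c s)"
  "track c (s @ s') = track c s @ track c s'"
  by (simp_all add: track_def)

lemma trivial_tokens_iff: "trivial_tokens s \<longleftrightarrow> (\<forall>c. red (track c s) = [])"
  by (auto simp: trivial_tokens_def all_bool_eq)

lemma track_other: "\<forall>x \<in> set m. fst x \<noteq> c \<Longrightarrow> track c m = []"
  by (auto simp: track_def filter_empty_conv)

lemma trivial_tokens_cancel:
  assumes "fst v = fst t" "snd v = inv_letter (snd t)" "\<forall>x \<in> set m. fst x \<noteq> fst t"
  shows "trivial_tokens (u @ t # m @ v # w) \<longleftrightarrow> trivial_tokens (u @ m @ w)"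
proof -
  have "red (track c (u @ t # m @ v # w)) = red (track c (u @ m @ w))" for c
    using assms track_other[OF assms(3)] by (cases "fst t = c") (auto simp: red_cancel)
  then show ?thesis by (simp add: trivial_tokens_iff)
qed

lemma trivial_tokens_decompose:
  assumes "trivial_tokens s" "s \<noteq> []"
  obtains u t m v w where "s = u @ t # m @ v # w" "fst v = fst t" "snd v = inv_letter (snd t)" "\<forall>x \<in> set m. fst x \<noteq> fst t"
proof -
  obtain t0 s0 where "s = t0 # s0" using assms(2) by (cases s) auto
  then have "track (fst t0) s \<noteq> []" by simp
  then obtain c where c: "track c s \<noteq> []" "red (track c s) = []" using assms(1) by (auto simp: trivial_tokens_iff)
  obtain us x vs where x: "track c s = us @ x # inv_letter x # vs"
    using exists_adjacent_inverse[OF c(2,1)] by blast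
  have split: "\<exists>u t v. s = u @ t # v \<and> fst t = c \<and> snd t = y \<and> track c u = us \<and> track c v = vs"
    if "track c s = us @ y # vs" for s us y vs
    using that
  proof (induction s arbitrary: us)
    case (Cons t s)
    show ?case
    proof (cases "fst t = c \<and> us = []")
      case True
      then show ?thesis using Cons.prems by (intro exI[of _ "[]"] exI[of _ t] exI[of _ s]) auto
    next
      case False
      define us' where "us' = (if fst t = c then tl us else us)"
      have "track c s = us' @ y # vs" using Cons.prems False by (cases us) (auto simp: us'_def split: if_splits)
      from Cons.IH[OF this] obtain u t' v where
        *: "s = u @ t' # v" "fst t' = c" "snd t' = y" "track c u = us'" "track c v = vs" by blast
      have "track c (t # u) = us" using Cons.prems False * by (cases us) (auto simp: us'_def split: if_splits)
      then show ?thesis using * by (intro exI[of _ "t # u"] exI[of _ t'] exI[of _ v]) auto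
    qed
  qed simp
  from split[OF x] obtain u t r where 1: "s = u @ t # r" "fst t = c" "snd t = x" "track c r = [] @ inv_letter x # vs" by auto
  from split[OF 1(4)] obtain m v w where 2: "r = m @ v # w" "fst v = c" "snd v = inv_letter x" "track c m = []" by auto
  have "\<forall>x \<in> set m. fst x \<noteq> c" using 2(4) by (auto simp: track_def filter_empty_conv)
  then show thesis using 1 2 that by auto
qed

text \<open>The queue machine first replaces every letter of the input by the tokens of its two components and
  every unary digit by a guessed letter over \<open>hs\<close> or nothing; then every pass over the queue cancels one
  pair of inverse tokens. State 3 begins a pass, state 4 precedes the first token of the pair, states
  \<open>7, \<dots>\<close> remember that token, and state 5 follows the second one.\<close>

locale bgwp_machine =
  fixes S hs :: "(nat gword \<times> nat gword) list"
  assumes S: "set S \<subseteq> carrier (F2 \<times>\<times> F2)" and hs: "set hs \<subseteq> carrier (F2 \<times>\<times> F2)"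
begin

definition tokens :: "(nat gword \<times> nat gword) list \<Rightarrow> nat \<times> bool \<Rightarrow> token list" where
  "tokens R l = map (Pair True) (letter_word (map fst R) l) @ map (Pair False) (letter_word (map snd R) l)"

definition E :: nat where "E = 2 * length S + 1"
definition enc :: "token \<Rightarrow> nat" where "enc t = 2 * length S + 2 + to_nat t"
definition Tk :: "token set" where "Tk = UNIV \<times> {0, 1} \<times> UNIV"

definition choices :: "nat \<Rightarrow> token list set" where
  "choices a = (if a = 0 then insert [] (tokens hs ` ({..<length hs} \<times> UNIV))
     else tokens S ` {l \<in> {..<length S} \<times> UNIV. encode_letter l = a})"

definition phase :: "nat \<Rightarrow> nat" where "phase a = (if a = 0 then 2 else 1)"

definition rules :: queue_rules where
  "rules = insert ((0, None), (6, [])) (insert ((1, Some E), (3, [E])) (insert ((2, Some E), (3, [E]))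
    (insert ((3, Some E), (6, [])) (insert ((5, Some E), (3, [E]))
    ((\<Union>a \<in> {0..2 * length S}. \<Union>r \<in> choices a.
       {((0, Some a), (phase a, E # map enc r)), ((1, Some a), (phase a, map enc r))}) \<union>
     (\<Union>r \<in> choices 0. {((2, Some 0), (2, map enc r))}) \<union>
     (\<Union>t \<in> Tk. {((3, Some (enc t)), (4, [enc t])), ((4, Some (enc t)), (4, [enc t])),
        ((3, Some (enc t)), (7 + to_nat t, [])), ((4, Some (enc t)), (7 + to_nat t, [])),
        ((5, Some (enc t)), (5, [enc t]))}) \<union>
     (\<Union>t \<in> Tk. \<Union>u \<in> Tk. if fst u \<noteq> fst t then {((7 + to_nat t, Some (enc u)), (7 + to_nat t, [enc u]))}
        else if snd u = inv_letter (snd t) then {((7 + to_nat t, Some (enc u)), (5, []))} else {}))))))"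

lemma finite_Tk: "finite Tk"
  by (simp add: Tk_def)

lemma finite_rules: "finite rules"
proof -
  have "finite (choices a)" for a
    by (auto simp: choices_def)
  then show ?thesis by (auto simp: rules_def finite_Tk)
qed

lemma enc_neq [simp]: "enc t \<noteq> E" "E \<noteq> enc t" "a \<le> 2 * length S \<Longrightarrow> enc t \<noteq> a" "a \<le> 2 * length S \<Longrightarrow> E \<noteq> a"
  "a \<le> 2 * length S \<Longrightarrow> a \<noteq> enc t" "a \<le> 2 * length S \<Longrightarrow> a \<noteq> E"
  by (auto simp: enc_def E_def)

lemma E_large [simp]: "\<not> E \<le> 2 * length S"
  by (simp add: E_def)

lemma enc_inj [simp]: "enc t = enc u \<longleftrightarrow> t = u"
  by (simp add: enc_def)

lemma rule_0: "((0, a), r) \<in> rules \<longleftrightarrow> (case a of None \<Rightarrow> r = (6, [])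
    | Some a \<Rightarrow> a \<le> 2 * length S \<and> (\<exists>s \<in> choices a. r = (phase a, E # map enc s)))"
  by (auto simp: rules_def split: option.splits if_splits)

lemma rule_1: "((Suc 0, a), r) \<in> rules \<longleftrightarrow> a = Some E \<and> r = (3, [E]) \<or>
    (\<exists>b s. a = Some b \<and> b \<le> 2 * length S \<and> s \<in> choices b \<and> r = (phase b, map enc s))"
  by (auto simp: rules_def split: if_splits)

lemma rule_2: "((2, a), r) \<in> rules \<longleftrightarrow> a = Some E \<and> r = (3, [E]) \<or> (\<exists>s \<in> choices 0. a = Some 0 \<and> r = (2, map enc s))"
  by (auto simp: rules_def split: if_splits)

lemma rule_3: "((3, a), r) \<in> rules \<longleftrightarrow> a = Some E \<and> r = (6, []) \<or>
    (\<exists>t \<in> Tk. a = Some (enc t) \<and> (r = (4, [enc t]) \<or> r = (7 + to_nat t, [])))"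
  by (auto simp: rules_def split: if_splits)

lemma rule_4: "((4, a), r) \<in> rules \<longleftrightarrow> (\<exists>t \<in> Tk. a = Some (enc t) \<and> (r = (4, [enc t]) \<or> r = (7 + to_nat t, [])))"
  by (auto simp: rules_def split: if_splits)

lemma rule_5: "((5, a), r) \<in> rules \<longleftrightarrow> a = Some E \<and> r = (3, [E]) \<or> (\<exists>t \<in> Tk. a = Some (enc t) \<and> r = (5, [enc t]))"
  by (auto simp: rules_def split: if_splits)

lemma rule_6: "((6, a), r) \<notin> rules"
  by (auto simp: rules_def split: if_splits)

lemma rule_7: "((7 + to_nat t, a), r) \<in> rules \<longleftrightarrow> t \<in> Tk \<and> (\<exists>u \<in> Tk. a = Some (enc u) \<and>
    (fst u \<noteq> fst t \<and> r = (7 + to_nat t, [enc u]) \<or> fst u = fst t \<and> snd u = inv_letter (snd t) \<and> r = (5, [])))"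
  by (auto simp: rules_def split: if_splits)

lemma tokens_Tk: "set R \<subseteq> carrier (F2 \<times>\<times> F2) \<Longrightarrow> fst l < length R \<Longrightarrow> set (tokens R l) \<subseteq> Tk"
  using letter_word_letters[of "map fst R" l] letter_word_letters[of "map snd R" l]
  by (fastforce simp: tokens_def Tk_def DirProd_def)

lemma track_tokens: "track c (concat (map (tokens R) w)) = flat_word (map (if c then fst else snd) R) w"
proof -
  have "track c (map (Pair d) w) = (if d = c then w else [])" for d w by (induction w) auto
  then have "track c (tokens R l) = letter_word (map (if c then fst else snd) R) l" for l
    by (simp add: tokens_def)
  then show ?thesis by (induction w) simp_all
qed

abbreviation "L \<equiv> BGWP (F2 \<times>\<times> F2) S hs"

lemma L_iff: "y \<in> L \<longleftrightarrow> (\<exists>w n zs. y = encode_instance w n \<and> w \<in> words_over S \<and> zs \<in> words_over hs \<and> length zs \<le> n \<and>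
    trivial_tokens (concat (map (tokens S) w) @ concat (map (tokens hs) zs)))"
proof -
  have tr: "trivial_tokens (concat (map (tokens S) w) @ concat (map (tokens hs) zs)) \<longleftrightarrow>
     word_value (F2 \<times>\<times> F2) S w = word_value (F2 \<times>\<times> F2) hs (winv zs)"
    if w: "w \<in> words_over S" and z: "winv zs \<in> words_over hs" for w zs
  proof -
    have "red (u @ v) = [] \<longleftrightarrow> red u = red (winv v)" for u v :: "nat gword"
    proof -
      have "red u = red (winv v) \<longleftrightarrow> red (u @ v) = red (winv v @ v)" by (simp add: red_right_cancel)
      then show ?thesis using red_winv_left[of v "[]"] by simp
    qed
    then show ?thesis
      unfolding word_value_F2[OF S w] word_value_F2[OF hs z]
      by (simp add: trivial_tokens_def track_tokens flat_word_winv)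
  qed
  have wo: "winv zs \<in> words_over hs \<longleftrightarrow> zs \<in> words_over hs" for zs
    by (fastforce simp: words_over_def winv_def inv_letter_def)
  show ?thesis
  proof
    assume "y \<in> L"
    then obtain w n u where "y = encode_instance w n" "w \<in> words_over S" "u \<in> words_over hs" "length u \<le> n"
      "word_value (F2 \<times>\<times> F2) S w = word_value (F2 \<times>\<times> F2) hs u"
      by (auto simp: BGWP_def bounded_product_def)
    then show "\<exists>w n zs. y = encode_instance w n \<and> w \<in> words_over S \<and> zs \<in> words_over hs \<and> length zs \<le> n \<and>
      trivial_tokens (concat (map (tokens S) w) @ concat (map (tokens hs) zs))"
      using tr[of w "winv u"] wo[of "u"] by (intro exI[of _ w] exI[of _ n] exI[of _ "winv u"]) simp
  next
    assume "\<exists>w n zs. y = encode_instance w n \<and> w \<in> words_over S \<and> zs \<in> words_over hs \<and> length zs \<le> n \<and>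
      trivial_tokens (concat (map (tokens S) w) @ concat (map (tokens hs) zs))"
    then obtain w n zs where "y = encode_instance w n" "w \<in> words_over S" "zs \<in> words_over hs" "length zs \<le> n"
      "trivial_tokens (concat (map (tokens S) w) @ concat (map (tokens hs) zs))" by blast
    then have "bounded_product (F2 \<times>\<times> F2) hs (word_value (F2 \<times>\<times> F2) S w) n"
      using tr[of w zs] wo[of zs] unfolding bounded_product_def by (intro bexI[of _ "winv zs"]) auto
    then show "y \<in> L" using \<open>y = _\<close> \<open>w \<in> _\<close> unfolding BGWP_def by blast
  qed
qed

definition K :: nat where
  "K = Max (insert 0 (length ` (tokens S ` ({..<length S} \<times> UNIV) \<union> tokens hs ` ({..<length hs} \<times> UNIV))))"

lemma choices_length: "s \<in> choices a \<Longrightarrow> length s \<le> K"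
  unfolding K_def by (intro Max_ge) (auto simp: choices_def split: if_splits)

inductive conf :: "nat list \<Rightarrow> nat \<times> nat list \<Rightarrow> nat \<Rightarrow> bool" for y where
  conf_0: "conf y (0, y) (length y + 2 + (K * length y + 2)\<^sup>2)"
| conf_1: "ls \<in> words_over S \<Longrightarrow> y = map encode_letter ls @ xs \<Longrightarrow> s = concat (map (tokens S) ls) \<Longrightarrow>
    conf y (1, xs @ E # map enc s) (length xs + 1 + (length s + K * length xs + 2)\<^sup>2)"
| conf_2: "ls \<in> words_over S \<Longrightarrow> zs \<in> words_over hs \<Longrightarrow> length zs \<le> n \<Longrightarrow> y = map encode_letter ls @ replicate n 0 @ xs \<Longrightarrow>
    s = concat (map (tokens S) ls) @ concat (map (tokens hs) zs) \<Longrightarrow>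
    conf y (2, xs @ E # map enc s) (length xs + 1 + (length s + K * length xs + 2)\<^sup>2)"
| conf_3: "(trivial_tokens s \<Longrightarrow> y \<in> L) \<Longrightarrow> conf y (3, map enc s @ [E]) ((length s + 2)\<^sup>2)"
| conf_4: "(trivial_tokens (s1 @ s2) \<Longrightarrow> y \<in> L) \<Longrightarrow>
    conf y (4, map enc s2 @ E # map enc s1) (length s2 + 1 + (length s1 + length s2)\<^sup>2)"
| conf_5: "(trivial_tokens (s1 @ s2) \<Longrightarrow> y \<in> L) \<Longrightarrow>
    conf y (5, map enc s2 @ E # map enc s1) (length s2 + 1 + (length s1 + length s2 + 2)\<^sup>2)"
| conf_6: "y \<in> L \<Longrightarrow> conf y (6, w) 0"
| conf_7: "(trivial_tokens (s1 @ t # s2) \<Longrightarrow> y \<in> L) \<Longrightarrow>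
    conf y (7 + to_nat t, map enc s2 @ E # map enc s1) (length s2 + 1 + (length s1 + length s2 + 1)\<^sup>2)"

lemma encode_letter_bounds: "encode_letter l > 0" "fst l < length S \<Longrightarrow> encode_letter l \<le> 2 * length S"
  by (cases l; auto)+

lemma conf_step:
  assumes "conf y c \<Phi>" "queue_step rules c d" "E \<notin> set y"
  shows "\<exists>\<Phi>'. \<Phi>' < \<Phi> \<and> conf y d \<Phi>'"
proof -
  obtain q w q' \<beta> where c: "c = (q, w)" "d = (q', tl w @ \<beta>)" and r: "((q, first w), (q', \<beta>)) \<in> rules"
    using assms(2) by cases auto
  have letterS: "l \<in> {..<length S} \<times> UNIV \<Longrightarrow> [l] \<in> words_over S" for l by (simp add: words_over_def)
  from assms(1) show ?thesis
  proof cases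
    case conf_0
    show ?thesis
    proof (cases y)
      case Nil
      have "trivial_tokens (concat (map (tokens S) []) @ concat (map (tokens hs) []))" by (simp add: trivial_tokens_iff)
      then have "y \<in> L" unfolding L_iff Nil
        by (intro exI[of _ "[]"] exI[of _ 0]) (auto simp: encode_instance_def words_over_def)
      then show ?thesis using r conf_0 Nil c by (auto simp: rule_0 intro!: exI[of _ 0] conf.intros)
    next
      case (Cons a x)
      then obtain s where s: "s \<in> choices a" "q' = phase a" "\<beta> = E # map enc s" using r conf_0 c by (auto simp: rule_0)
      have le: "length s \<le> K" by (rule choices_length[OF s(1)])
      have lt: "length x + 1 + (length s + K * length x + 2)\<^sup>2 < length y + 2 + (K * length y + 2)\<^sup>2"
      proof -
        have "(length s + K * length x + 2)\<^sup>2 \<le> (K * length y + 2)\<^sup>2" using le Cons by (intro power_mono) auto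
        moreover have "length y = length x + 1" using Cons by simp
        ultimately show ?thesis by linarith
      qed
      show ?thesis
      proof (cases "a = 0")
        case True
        then have "\<exists>zs. zs \<in> words_over hs \<and> length zs \<le> 1 \<and> s = concat (map (tokens S) []) @ concat (map (tokens hs) zs)"
        proof -
          consider "s = []" | l where "l \<in> {..<length hs} \<times> UNIV" "s = tokens hs l" using s(1) True by (auto simp: choices_def)
          then show ?thesis
          proof cases
            case 1 then show ?thesis by (intro exI[of _ "[]"]) (simp add: words_over_def)
          next
            case (2 l) then show ?thesis by (intro exI[of _ "[l]"]) (simp add: words_over_def)
          qed
        qed
        then obtain zs where "zs \<in> words_over hs" "length zs \<le> 1" "s = concat (map (tokens S) []) @ concat (map (tokens hs) zs)" by blast
        from conf_2[OF _ this(1,2) _ this(3), of y x] have "conf y (2, x @ E # map enc s) (length x + 1 + (length s + K * length x + 2)\<^sup>2)"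
          using True Cons by (simp add: words_over_def)
        moreover have "d = (2, x @ E # map enc s)" using conf_0 c s True Cons by (simp add: phase_def)
        ultimately show ?thesis using lt unfolding conf_0(2) by blast
      next
        case False
        then obtain l where l: "l \<in> {..<length S} \<times> UNIV" "a = encode_letter l" "s = tokens S l" using s(1) by (auto simp: choices_def)
        from conf_1[OF letterS[OF l(1)], of y x s] have "conf y (1, x @ E # map enc s) (length x + 1 + (length s + K * length x + 2)\<^sup>2)"
          using Cons l by simp
        moreover have "d = (1, x @ E # map enc s)" using conf_0 c s False Cons by (simp add: phase_def)
        ultimately show ?thesis using lt unfolding conf_0(2) by blast
      qed
    qed
  next
    case (conf_1 ls xs s)
    show ?thesis
    proof (cases xs)
      case Nil
      then have q': "q' = 3" "\<beta> = [E]" using r conf_1 c by (auto simp: rule_1)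
      have "y \<in> L" if "trivial_tokens s"
        using conf_1 Nil that unfolding L_iff
        by (intro exI[of _ ls] exI[of _ 0] exI[of _ "[]"]) (auto simp: encode_instance_def words_over_def)
      from conf_3[OF this] show ?thesis using q' conf_1 c Nil by auto
    next
      case (Cons a x)
      then obtain s' where s: "s' \<in> choices a" "q' = phase a" "\<beta> = map enc s'" using r conf_1 c assms(3) by (auto simp: rule_1)
      have le: "length s' \<le> K" by (rule choices_length[OF s(1)])
      have lt: "length x + 1 + (length (s @ s') + K * length x + 2)\<^sup>2 < \<Phi>"
      proof -
        have "(length (s @ s') + K * length x + 2)\<^sup>2 \<le> (length s + K * length xs + 2)\<^sup>2" using le Cons by (intro power_mono) auto
        moreover have "length xs = length x + 1" using Cons by simp
        ultimately show ?thesis unfolding conf_1(2) by linarith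
      qed
      show ?thesis
      proof (cases "a = 0")
        case True
        have "\<exists>zs. zs \<in> words_over hs \<and> length zs \<le> 1 \<and> s @ s' = concat (map (tokens S) ls) @ concat (map (tokens hs) zs)"
        proof -
          consider "s' = []" | l where "l \<in> {..<length hs} \<times> UNIV" "s' = tokens hs l" using s(1) True by (auto simp: choices_def)
          then show ?thesis
          proof cases
            case 1 then show ?thesis using conf_1 by (intro exI[of _ "[]"]) (simp add: words_over_def)
          next
            case (2 l) then show ?thesis using conf_1 by (intro exI[of _ "[l]"]) (simp add: words_over_def)
          qed
        qed
        then obtain zs where "zs \<in> words_over hs" "length zs \<le> 1" "s @ s' = concat (map (tokens S) ls) @ concat (map (tokens hs) zs)" by blast
        from conf_2[OF conf_1(3) this(1,2) _ this(3), of y x]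
        have "conf y (2, x @ E # map enc (s @ s')) (length x + 1 + (length (s @ s') + K * length x + 2)\<^sup>2)"
          using True Cons conf_1(4) by simp
        moreover have "d = (2, x @ E # map enc (s @ s'))" using conf_1 c s True Cons by (simp add: phase_def)
        ultimately show ?thesis using lt by blast
      next
        case False
        then obtain l where l: "l \<in> {..<length S} \<times> UNIV" "a = encode_letter l" "s' = tokens S l" using s(1) by (auto simp: choices_def)
        have "ls @ [l] \<in> words_over S" using conf_1(3) l(1) by (simp add: words_over_def)
        from conf.conf_1[OF this, of y x "s @ s'"] have "conf y (1, x @ E # map enc (s @ s')) (length x + 1 + (length (s @ s') + K * length x + 2)\<^sup>2)"
          using Cons l conf_1 by simp
        moreover have "d = (1, x @ E # map enc (s @ s'))" using conf_1 c s False Cons by (simp add: phase_def)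
        ultimately show ?thesis using lt by blast
      qed
    qed
  next
    case (conf_2 ls zs n xs s)
    show ?thesis
    proof (cases xs)
      case Nil
      then have q': "q' = 3" "\<beta> = [E]" using r conf_2 c by (auto simp: rule_2)
      have "y \<in> L" if "trivial_tokens s"
        using conf_2 Nil that unfolding L_iff
        by (intro exI[of _ ls] exI[of _ n] exI[of _ zs]) (auto simp: encode_instance_def)
      from conf_3[OF this] have "conf y (3, map enc s @ [E]) ((length s + 2)\<^sup>2)" .
      moreover have "d = (3, map enc s @ [E])" "(length s + 2)\<^sup>2 < \<Phi>"
        using q' conf_2(1) c Nil by (simp_all add: conf_2(2))
      ultimately show ?thesis by blast
    next
      case (Cons a x)
      then obtain s' where s: "s' \<in> choices 0" "q' = 2" "\<beta> = map enc s'" "a = 0"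
        using r conf_2 c assms(3) by (auto simp: rule_2)
      have le: "length s' \<le> K" by (rule choices_length[OF s(1)])
      have lt: "length x + 1 + (length (s @ s') + K * length x + 2)\<^sup>2 < \<Phi>"
      proof -
        have "(length (s @ s') + K * length x + 2)\<^sup>2 \<le> (length s + K * length xs + 2)\<^sup>2" using le Cons by (intro power_mono) auto
        moreover have "length xs = length x + 1" using Cons by simp
        ultimately show ?thesis unfolding conf_2(2) by linarith
      qed
      have "\<exists>zs'. zs' \<in> words_over hs \<and> length zs' \<le> Suc n \<and> s @ s' = concat (map (tokens S) ls) @ concat (map (tokens hs) zs')"
      proof -
        consider "s' = []" | l where "l \<in> {..<length hs} \<times> UNIV" "s' = tokens hs l" using s(1) by (auto simp: choices_def)
        then show ?thesis
        proof cases
          case 1 then show ?thesis using conf_2 by (intro exI[of _ zs]) simp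
        next
          case (2 l) then show ?thesis using conf_2 by (intro exI[of _ "zs @ [l]"]) (simp add: words_over_def)
        qed
      qed
      then obtain zs' where "zs' \<in> words_over hs" "length zs' \<le> Suc n" "s @ s' = concat (map (tokens S) ls) @ concat (map (tokens hs) zs')" by blast
      from conf.conf_2[OF conf_2(3) this(1,2) _ this(3), of y x]
      have "conf y (2, x @ E # map enc (s @ s')) (length x + 1 + (length (s @ s') + K * length x + 2)\<^sup>2)"
        using s(4) Cons conf_2(6) by (simp add: replicate_app_Cons_same)
      moreover have "d = (2, x @ E # map enc (s @ s'))" using conf_2 c s Cons by simp
      ultimately show ?thesis using lt by blast
    qed
  next
    case (conf_3 s)
    show ?thesis
    proof (cases s)
      case Nil
      then have q': "q' = 6" using r conf_3 c by (auto simp: rule_3)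
      have "y \<in> L" using conf_3 Nil by (simp add: trivial_tokens_iff)
      then show ?thesis using q' c conf_3 by (auto intro!: exI[of _ 0] conf.intros)
    next
      case (Cons t s')
      have "(length s' + 3)\<^sup>2 = (length s' + 1)\<^sup>2 + 4 * length s' + 8" by (simp add: power2_eq_square algebra_simps)
      moreover have "\<Phi> = (length s' + 3)\<^sup>2" using conf_3(2) Cons by (simp add: eval_nat_numeral)
      ultimately have lt: "length s' + 1 + (length s' + 1)\<^sup>2 < \<Phi>" by linarith
      from Cons consider "q' = 4" "\<beta> = [enc t]" | "q' = 7 + to_nat t" "\<beta> = []" using r conf_3 c by (auto simp: rule_3)
      then show ?thesis
      proof cases
        case 1
        have "conf y (4, map enc s' @ E # map enc [t]) (length s' + 1 + (length [t] + length s')\<^sup>2)"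
          by (rule conf_4) (use conf_3 Cons in simp)
        moreover have "d = (4, map enc s' @ E # map enc [t])" using 1 c conf_3(1) Cons by auto
        moreover have "length s' + 1 + (length [t] + length s')\<^sup>2 < \<Phi>" using lt by simp
        ultimately show ?thesis by blast
      next
        case 2
        have "conf y (7 + to_nat t, map enc s' @ E # map enc []) (length s' + 1 + (length ([] :: token list) + length s' + 1)\<^sup>2)"
          by (rule conf_7) (use conf_3 Cons in simp)
        moreover have "d = (7 + to_nat t, map enc s' @ E # map enc [])" using 2 c conf_3(1) Cons by auto
        moreover have "length s' + 1 + (length ([] :: token list) + length s' + 1)\<^sup>2 < \<Phi>" using lt by simp
        ultimately show ?thesis by blast
      qed
    qed
  next
    case (conf_4 s1 s2)
    then obtain t s2' where s2: "s2 = t # s2'" using r c by (cases s2) (auto simp: rule_4)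
    then consider "q' = 4" "\<beta> = [enc t]" | "q' = 7 + to_nat t" "\<beta> = []" using r conf_4 c by (auto simp: rule_4)
    then show ?thesis
    proof cases
      case 1
      have "conf y (4, map enc s2' @ E # map enc (s1 @ [t])) (length s2' + 1 + (length (s1 @ [t]) + length s2')\<^sup>2)"
        by (rule conf.conf_4) (use conf_4 s2 in simp)
      then show ?thesis using 1 c conf_4 s2
        by (intro exI[of _ "length s2' + 1 + (length (s1 @ [t]) + length s2')\<^sup>2"]) auto
    next
      case 2
      have "conf y (7 + to_nat t, map enc s2' @ E # map enc s1) (length s2' + 1 + (length s1 + length s2' + 1)\<^sup>2)"
        by (rule conf_7) (use conf_4 s2 in simp)
      then show ?thesis using 2 c conf_4 s2
        by (intro exI[of _ "length s2' + 1 + (length s1 + length s2' + 1)\<^sup>2"]) auto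
    qed
  next
    case (conf_5 s1 s2)
    show ?thesis
    proof (cases s2)
      case Nil
      then have q': "q' = 3" "\<beta> = [E]" using r conf_5 c by (auto simp: rule_5)
      from conf_3[of s1] conf_5 Nil have "conf y (3, map enc s1 @ [E]) ((length s1 + 2)\<^sup>2)" by simp
      then show ?thesis using q' c conf_5 Nil by auto
    next
      case (Cons t s2')
      then have q': "q' = 5" "\<beta> = [enc t]" using r conf_5 c by (auto simp: rule_5)
      have "conf y (5, map enc s2' @ E # map enc (s1 @ [t])) (length s2' + 1 + (length (s1 @ [t]) + length s2' + 2)\<^sup>2)"
        by (rule conf.conf_5) (use conf_5 Cons in simp)
      then show ?thesis using q' c conf_5 Cons
        by (intro exI[of _ "length s2' + 1 + (length (s1 @ [t]) + length s2' + 2)\<^sup>2"]) auto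
    qed
  next
    case (conf_6 w)
    then show ?thesis using r c by (simp add: rule_6)
  next
    case (conf_7 s1 t s2)
    then obtain u s2' where s2: "s2 = u # s2'" using r c by (cases s2) (auto simp: rule_7)
    with r conf_7 c consider "q' = 7 + to_nat t" "\<beta> = [enc u]" "fst u \<noteq> fst t"
      | "q' = 5" "\<beta> = []" "fst u = fst t" "snd u = inv_letter (snd t)" by (auto simp: rule_7)
    then show ?thesis
    proof cases
      case 1
      have "trivial_tokens (s1 @ t # u # s2') \<longleftrightarrow> trivial_tokens (s1 @ u # t # s2')"
        using 1 by (auto simp: trivial_tokens_iff)
      then have "conf y (7 + to_nat t, map enc s2' @ E # map enc (s1 @ [u])) (length s2' + 1 + (length (s1 @ [u]) + length s2' + 1)\<^sup>2)"
        by (intro conf.conf_7) (use conf_7 s2 in simp)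
      then show ?thesis using 1 c conf_7 s2
        by (intro exI[of _ "length s2' + 1 + (length (s1 @ [u]) + length s2' + 1)\<^sup>2"]) auto
    next
      case 2
      have "trivial_tokens (s1 @ t # u # s2') \<longleftrightarrow> trivial_tokens (s1 @ s2')"
        using 2 trivial_tokens_cancel[of u t "[]" s1 s2'] by simp
      then have "conf y (5, map enc s2' @ E # map enc s1) (length s2' + 1 + (length s1 + length s2' + 2)\<^sup>2)"
        by (intro conf_5) (use conf_7 s2 in simp)
      then show ?thesis using 2 c conf_7 s2
        by (intro exI[of _ "length s2' + 1 + (length s1 + length s2' + 2)\<^sup>2"]) auto
    qed
  qed
qed

lemma conf_run:
  assumes "(queue_step rules ^^ m) (0, y) c" "E \<notin> set y"
  shows "\<exists>\<Phi>. conf y c \<Phi> \<and> \<Phi> + m \<le> length y + 2 + (K * length y + 2)\<^sup>2"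
  using assms(1)
proof (induction m arbitrary: c)
  case 0
  then show ?case using conf_0 by auto
next
  case (Suc m)
  then obtain b where b: "(queue_step rules ^^ m) (0, y) b" "queue_step rules b c" by auto
  from Suc.IH[OF b(1)] obtain \<Phi> where \<Phi>: "conf y b \<Phi>" "\<Phi> + m \<le> length y + 2 + (K * length y + 2)\<^sup>2" by blast
  from conf_step[OF \<Phi>(1) b(2) assms(2)] \<Phi>(2) show ?case by fastforce
qed

lemma conf_bound: "length y + 2 + (K * length y + 2)\<^sup>2 \<le> (2 + (K + 2)\<^sup>2) * (length y + 1) ^ 2"
proof -
  have "(K * length y + 2)\<^sup>2 \<le> ((K + 2) * (length y + 1))\<^sup>2" by (intro power_mono) (auto simp: algebra_simps)
  moreover have "length y + 2 \<le> 2 * (length y + 1)\<^sup>2" by (simp add: power2_eq_square)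
  moreover have "((K + 2) * (length y + 1))\<^sup>2 = (K + 2)\<^sup>2 * (length y + 1)\<^sup>2" by (rule power_mult_distrib)
  moreover have "(2 + (K + 2)\<^sup>2) * (length y + 1)\<^sup>2 = 2 * (length y + 1)\<^sup>2 + (K + 2)\<^sup>2 * (length y + 1)\<^sup>2"
    by (rule add_mult_distrib)
  ultimately show ?thesis by linarith
qed

lemma choices_letter:
  assumes "l \<in> {..<length S} \<times> UNIV"
  shows "tokens S l \<in> choices (encode_letter l)"
proof -
  have "tokens S l \<in> tokens S ` {l' \<in> {..<length S} \<times> UNIV. encode_letter l' = encode_letter l}"
    by (rule imageI) (use assms in simp)
  then show ?thesis using encode_letter_bounds(1)[of l] by (simp add: choices_def)
qed

lemma letter_rules:
  assumes "l \<in> {..<length S} \<times> UNIV"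
  shows "((0, Some (encode_letter l)), (1, E # map enc (tokens S l))) \<in> rules"
    "((1, Some (encode_letter l)), (1, map enc (tokens S l))) \<in> rules"
proof -
  have "encode_letter l \<le> 2 * length S" "phase (encode_letter l) = 1"
    using assms encode_letter_bounds[of l] by (auto simp: phase_def)
  then show "((0, Some (encode_letter l)), (1, E # map enc (tokens S l))) \<in> rules"
    "((1, Some (encode_letter l)), (1, map enc (tokens S l))) \<in> rules"
    unfolding One_nat_def rule_0 rule_1 using choices_letter[OF assms] by fastforce+
qed

abbreviation reach (infix "\<leadsto>" 50) where "c \<leadsto> d \<equiv> (queue_step rules)\<^sup>*\<^sup>* c d"

lemma reach_step: "((q, Some a), (q', \<beta>)) \<in> rules \<Longrightarrow> (q', w @ \<beta>) \<leadsto> d \<Longrightarrow> (q, a # w) \<leadsto> d"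
  using queue_step.intros[of q "a # w" q' \<beta> rules] by (auto intro: converse_rtranclp_into_rtranclp)

lemma reach_copy:
  assumes "\<And>t. t \<in> set u \<Longrightarrow> ((q, Some (enc t)), (q, [enc t])) \<in> rules" "(q, v @ map enc u) \<leadsto> d"
  shows "(q, map enc u @ v) \<leadsto> d"
  using assms
proof (induction u arbitrary: v)
  case (Cons t u)
  then show ?case using reach_step[of q "enc t" q "[enc t]"] by simp
qed simp

lemma reach_cancel:
  assumes "trivial_tokens s" "set s \<subseteq> Tk"
  shows "(3, map enc s @ [E]) \<leadsto> (6, [])"
  using assms
proof (induction "length s" arbitrary: s rule: less_induct)
  case less
  show ?case
  proof (cases "s = []")
    case True
    then show ?thesis using reach_step[of 3 E 6 "[]" "[]"] by (simp add: rule_3)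
  next
    case False
    obtain u t m v w where s: "s = u @ t # m @ v # w" and t: "fst v = fst t" "snd v = inv_letter (snd t)" "\<forall>x \<in> set m. fst x \<noteq> fst t"
      using trivial_tokens_decompose[OF less.prems(1) False] by blast
    have sub: "set u \<subseteq> Tk" "t \<in> Tk" "set m \<subseteq> Tk" "v \<in> Tk" "set w \<subseteq> Tk" using s less.prems(2) by auto
    have "trivial_tokens (u @ m @ w)" using less.prems(1) trivial_tokens_cancel[OF t] s by simp
    with less.hyps[of "u @ m @ w"] s sub have 0: "(3, map enc (u @ m @ w) @ [E]) \<leadsto> (6, [])" by simp
    have 5: "(5, map enc w @ E # map enc (u @ m)) \<leadsto> (6, [])"
      by (rule reach_copy) (use sub 0 in \<open>auto simp: rule_5 intro!: reach_step[of 5 E 3 "[E]"]\<close>)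
    have 7: "(7 + to_nat t, map enc m @ enc v # map enc w @ E # map enc u) \<leadsto> (6, [])"
      by (rule reach_copy) (use sub t 5 in \<open>auto simp: rule_7 simp del: add_numeral_left
          intro!: reach_step[of "7 + to_nat t" "enc v" 5 "[]"]\<close>)
    have 4: "(4, map enc u' @ enc t # map enc (m @ v # w) @ E # map enc u1) \<leadsto> (6, [])" if "u = u1 @ u'" for u1 u'
      by (rule reach_copy) (use sub 7 that in \<open>auto simp: rule_4 intro!: reach_step[of 4 "enc t" "7 + to_nat t" "[]"]\<close>)
    show ?thesis
    proof (cases u)
      case Nil
      then show ?thesis using s sub 7 by (auto simp: rule_3 intro!: reach_step[of 3 "enc t" "7 + to_nat t" "[]"])
    next
      case (Cons x u')
      then show ?thesis using s sub 4[of "[x]" u'] by (auto simp: rule_3 intro!: reach_step[of 3 "enc x" 4 "[enc x]"])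
    qed
  qed
qed

lemma reach_zeros:
  assumes "zs \<in> words_over hs" "length zs \<le> n" "(2, E # map enc (s @ concat (map (tokens hs) zs))) \<leadsto> d" "q = 2 \<or> q = 1"
  shows "(q, replicate n 0 @ E # map enc s) \<leadsto> d \<or> n = 0"
  using assms
proof (induction n arbitrary: q zs s)
  case (Suc n)
  obtain r zs' where r: "r \<in> choices 0" "r @ concat (map (tokens hs) zs') = concat (map (tokens hs) zs)"
    "zs' \<in> words_over hs" "length zs' \<le> n"
  proof (cases "length zs \<le> n")
    case True
    then show thesis using that[of "[]" zs] Suc.prems by (simp add: choices_def)
  next
    case False
    then obtain l zs' where "zs = l # zs'" using Suc.prems by (cases zs) auto
    then show thesis using that[of "tokens hs l" zs'] Suc.prems by (auto simp: choices_def words_over_def)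
  qed
  have "((q, Some 0), (2, map enc r)) \<in> rules" using r(1) Suc.prems(4) by (auto simp: rule_1 rule_2 phase_def)
  moreover have "(2, (replicate n 0 @ E # map enc s) @ map enc r) \<leadsto> d"
  proof (cases "n = 0")
    case True
    then show ?thesis using r Suc.prems(3) by simp
  next
    case False
    then show ?thesis using Suc.IH[OF r(3,4), of "s @ r" 2] r(2) Suc.prems(3) by simp
  qed
  ultimately show ?case using reach_step[of q 0 2 "map enc r"] by simp
qed simp

lemma reach_letters:
  assumes "ls \<in> words_over S" "(1, x @ E # map enc (s @ concat (map (tokens S) ls))) \<leadsto> d"
  shows "(1, map encode_letter ls @ x @ E # map enc s) \<leadsto> d"
  using assms
proof (induction ls arbitrary: s)
  case (Cons l ls)
  have l: "l \<in> {..<length S} \<times> UNIV" and ls: "ls \<in> words_over S" using Cons.prems(1) by (auto simp: words_over_def)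
  from reach_step[OF letter_rules(2)[OF l], of "map encode_letter ls @ x @ E # map enc s"] Cons.IH[OF ls, of "s @ tokens S l"] Cons.prems(2)
  show ?case by simp
qed simp

lemma reach_accept:
  assumes "y \<in> L"
  shows "\<exists>w. (0, y) \<leadsto> (6, w)"
proof -
  obtain w n zs where y: "y = encode_instance w n" "w \<in> words_over S" "zs \<in> words_over hs" "length zs \<le> n"
    and tr: "trivial_tokens (concat (map (tokens S) w) @ concat (map (tokens hs) zs))"
    using assms L_iff by blast
  define s where "s = concat (map (tokens S) w) @ concat (map (tokens hs) zs)"
  have "set s \<subseteq> Tk"
    using y(2,3) tokens_Tk[OF S] tokens_Tk[OF hs] by (fastforce simp: s_def words_over_def)
  then have 3: "(3, map enc s @ [E]) \<leadsto> (6, [])" using reach_cancel tr s_def by blast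
  have E: "(q, E # map enc s) \<leadsto> (6, [])" if "q = 1 \<or> q = 2" for q
    by (rule reach_step[of q E 3 "[E]"]) (use that 3 in \<open>auto simp: rule_1 rule_2\<close>)
  have z: "(q, replicate n 0 @ E # map enc r) \<leadsto> (6, [])" if "q = 1 \<or> q = 2" "s = r @ concat (map (tokens hs) zs')"
    "zs' \<in> words_over hs" "length zs' \<le> n" for q r zs' n
  proof (cases "n = 0")
    case True
    then show ?thesis using that E[of q] by simp
  next
    case False
    then show ?thesis using reach_zeros[OF that(3,4), of r "(6, [])" q] E[of 2] that(1,2) by auto
  qed
  show ?thesis
  proof (cases w)
    case (Cons l w')
    have l: "l \<in> {..<length S} \<times> UNIV" and w': "w' \<in> words_over S" using y(2) Cons by (auto simp: words_over_def)
    note r = letter_rules(1)[OF l]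
    have "(1, map encode_letter w' @ replicate n 0 @ E # map enc (tokens S l)) \<leadsto> (6, [])"
      by (rule reach_letters[OF w']) (use y z[of 1 "concat (map (tokens S) w)" zs n] Cons in \<open>simp add: s_def\<close>)
    then show ?thesis using reach_step[OF r, of "map encode_letter w' @ replicate n 0" "(6, [])"] y(1) Cons by (auto simp: encode_instance_def)
  next
    case Nil
    show ?thesis
    proof (cases n)
      case 0
      then have "queue_step rules (0, y) (6, tl y @ [])" using y(1) Nil
        by (intro queue_step.intros) (simp add: encode_instance_def rule_0)
      then show ?thesis by blast
    next
      case (Suc n')
      obtain r zs' where r: "r \<in> choices 0" "r @ concat (map (tokens hs) zs') = concat (map (tokens hs) zs)"
        "zs' \<in> words_over hs" "length zs' \<le> n'"
      proof (cases "length zs \<le> n'")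
        case True
        then show thesis using that[of "[]" zs] y by (simp add: choices_def)
      next
        case False
        then obtain l zs' where "zs = l # zs'" using y Suc by (cases zs) auto
        then show thesis using that[of "tokens hs l" zs'] y Suc by (auto simp: choices_def words_over_def)
      qed
      have "((0, Some 0), (2, E # map enc r)) \<in> rules" using r(1) by (auto simp: rule_0 phase_def)
      from reach_step[OF this, of "replicate n' 0" "(6, [])"] z[of 2 r zs' n'] r y(1) Nil Suc show ?thesis
        by (auto simp: encode_instance_def s_def)
    qed
  qed
qed

lemma BGWP_in_NP: "in_NP (BGWP_alphabet S) L"
proof (rule in_NP_queueI[of _ _ rules 6 0 "2 + (K + 2)\<^sup>2" 2])
  have E: "E \<notin> set x" if "x \<in> lists (BGWP_alphabet S)" for x
    using that by (auto simp: BGWP_alphabet_def E_def)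
  show "finite (BGWP_alphabet S)" by (simp add: BGWP_alphabet_def)
  show "finite rules" by (rule finite_rules)
  show "L \<subseteq> lists (BGWP_alphabet S)"
    using encode_letter_bounds(2) by (fastforce simp: BGWP_def BGWP_alphabet_def encode_instance_def words_over_def)
  show "((6, a), r) \<notin> rules" for a r by (rule rule_6)
  show "m \<le> (2 + (K + 2)\<^sup>2) * (length x + 1) ^ 2" if "x \<in> lists (BGWP_alphabet S)" "(queue_step rules ^^ m) (0, x) d" for x m d
    using conf_run[OF that(2) E[OF that(1)]] conf_bound[of x] by linarith
  show "x \<in> L \<longleftrightarrow> (\<exists>w. (0, x) \<leadsto> (6, w))" if x: "x \<in> lists (BGWP_alphabet S)" for x
  proof
    assume "\<exists>w. (0, x) \<leadsto> (6, w)"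
    then obtain w m where "(queue_step rules ^^ m) (0, x) (6, w)" by (meson rtranclp_imp_relpowp)
    from conf_run[OF this E[OF x]] obtain \<Phi> where "conf x (6, w) \<Phi>" by blast
    then show "x \<in> L" by cases auto
  qed (rule reach_accept)
qed

end

lemma red_action_on:
  assumes "\<And>x s. P s \<Longrightarrow> P (act x s)" "\<And>x s. P s \<Longrightarrow> act x (act (inv_letter x) s) = s" "P s"
  shows "foldr act (red w) s = foldr act w s"
proof -
  have P: "P (foldr act v s)" for v using assms(1,3) by (induction v) auto
  show ?thesis
  proof (induction w)
    case (Cons x w)
    have "foldr act (push_letter x v) s = act x (foldr act v s)" for v
      using assms(2)[OF P] by (cases v) (auto simp: inverse_letters_iff)
    with Cons show ?case by (simp add: red_Cons)
  qed simp
qed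

lemma red_map:
  assumes "inj f"
  shows "red (map (apfst f) w) = map (apfst f) (red w)"
proof (induction w)
  case (Cons x w)
  have "push_letter (apfst f x) (map (apfst f) v) = map (apfst f) (push_letter x v)" for v
    using assms by (cases v) (auto simp: inverse_letters_def inj_eq apfst_def)
  with Cons show ?case by (simp add: red_Cons)
qed simp

lemma red_positive: "(\<And>x. x \<in> set w \<Longrightarrow> snd x) \<Longrightarrow> red w = w"
proof (induction w)
  case (Cons x w)
  then have "red w = w" by simp
  with Cons.prems show ?case by (cases w) (auto simp: red_Cons inverse_letters_def)
qed simp

section \<open>Embedding free groups of countable rank into \<open>F2\<close>\<close>

definition free_embed_letter :: "'a :: countable \<times> bool \<Rightarrow> nat gword" where
  "free_embed_letter z = replicate (to_nat (fst z)) (0, True) @ (1, snd z) # replicate (to_nat (fst z)) (0, False)"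

definition free_embed :: "('a :: countable) gword \<Rightarrow> nat gword" where
  "free_embed w = concat (map free_embed_letter w)"

lemma free_embed_simps [simp]: "free_embed [] = []" "free_embed (x # w) = free_embed_letter x @ free_embed w" "free_embed (u @ v) = free_embed u @ free_embed v"
  by (simp_all add: free_embed_def)

lemma winv_free_embed_letter: "winv (free_embed_letter z) = free_embed_letter (inv_letter z)"
  by (simp add: free_embed_letter_def winv_def inv_letter_def)

lemma winv_free_embed: "winv (free_embed w) = free_embed (winv w)"
  by (induction w) (auto simp: winv_free_embed_letter)

lemma free_embed_letters: "set (free_embed w) \<subseteq> {0, 1} \<times> UNIV"
  by (auto simp: free_embed_def free_embed_letter_def)

text \<open>The height is the exponent sum of the letter 0; a letter 1 at height \<open>h\<close> decodes to the letter \<open>h\<close>.\<close>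

fun decode_step :: "nat \<times> bool \<Rightarrow> int \<times> int gword \<Rightarrow> int \<times> int gword" where
  "decode_step (x, b) (h, w) = (if x = 0 then (if b then h - 1 else h + 1, w) else (h, push_letter (h, b) w))"

lemma red_free_embed_iff: "red (free_embed u) = red (free_embed v) \<longleftrightarrow> red u = red v"
proof
  have decode: "foldr decode_step (free_embed w) (0, []) = (0, red (map (apfst (int \<circ> to_nat)) w))" for w :: "'a gword"
  proof (induction w)
    case (Cons z w)
    note foldr_replicate [simp del]
    have up: "foldr decode_step (replicate n (0, False)) (h, W) = (h + int n, W)" for n h W
      by (induction n) auto
    have down: "foldr decode_step (replicate n (0, True)) (h, W) = (h - int n, W)" for n h W
      by (induction n) auto
    show ?case using Cons by (simp add: free_embed_letter_def up down red_Cons apfst_def map_prod_def split_beta)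
  qed simp
  have act: "foldr decode_step (red w) (0, []) = foldr decode_step w (0, [])" for w
  proof (rule red_action_on[where P = "\<lambda>s. reduced (snd s)"])
    fix x :: "nat \<times> bool" and s :: "int \<times> int gword"
    assume s: "reduced (snd s)"
    then show "reduced (snd (decode_step x s))" by (cases x; cases s) (auto simp: reduced_push_letter)
    show "decode_step x (decode_step (inv_letter x) s) = s"
      using s push_letter_inverse[of "snd s" "(fst s, snd x)" "(fst s, \<not> snd x)"]
      by (cases x; cases s) (auto simp: inverse_letters_def)
  qed simp
  assume "red (free_embed u) = red (free_embed v)"
  then have "foldr decode_step (free_embed u) (0, []) = foldr decode_step (free_embed v) (0, [])" using act by metis
  then have "red (map (apfst (int \<circ> to_nat)) u) = red (map (apfst (int \<circ> to_nat)) v)" unfolding decode by simp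
  moreover have "inj (int \<circ> (to_nat :: 'a \<Rightarrow> nat))" by (auto intro: inj_compose inj_of_nat)
  moreover from this have "inj (apfst (int \<circ> (to_nat :: 'a \<Rightarrow> nat)) :: 'a \<times> bool \<Rightarrow> _)"
    by (auto simp: inj_def apfst_def)
  ultimately show "red u = red v" by (simp add: red_map inj_map_eq_map)
next
  have push: "red (free_embed (push_letter x w)) = red (free_embed (x # w))" for x and w :: "'a gword"
  proof (cases w)
    case (Cons y ys)
    show ?thesis
    proof (cases "inverse_letters x y")
      case True
      then have "red (free_embed (x # w)) = red (free_embed_letter x @ winv (free_embed_letter x) @ free_embed ys)"
        by (simp add: Cons inverse_letters_iff winv_free_embed_letter)
      then show ?thesis using True Cons by (simp add: red_winv_right)
    qed (simp add: Cons)
  qed simp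
  have r: "red (free_embed (red w)) = red (free_embed w)" for w :: "'a gword"
  proof (induction w)
    case (Cons x w)
    have "red (free_embed (red (x # w))) = red (free_embed_letter x @ free_embed (red w))" by (simp add: red_Cons push)
    also have "\<dots> = red (free_embed (x # w))" using Cons by (simp add: red_left_cancel)
    finally show ?case .
  qed simp
  assume "red u = red v"
  then show "red (free_embed u) = red (free_embed v)" using r by metis
qed

section \<open>Iterated transductions as bounded products\<close>

inductive sweep :: "('s \<times> 'a \<times> 'a \<times> 's) set \<Rightarrow> 's \<Rightarrow> 'a list \<Rightarrow> 'a list \<Rightarrow> 's \<Rightarrow> bool" for R where
  sweep_Nil: "sweep R p [] [] p"
| sweep_Cons: "(p, x, y, q) \<in> R \<Longrightarrow> sweep R q xs ys r \<Longrightarrow> sweep R p (x # xs) (y # ys) r"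

datatype ('s, 'a) symbol = Row 'a | State 's | Mark

instance symbol :: (countable, countable) countable
  by countable_datatype

datatype ('s, 'a) gen = Odd 's 'a 'a 's | Turn_Odd 's | Even 'a | Turn_Even

definition signed :: "('g \<Rightarrow> 'b gword) \<Rightarrow> 'g gword \<Rightarrow> 'b gword" where
  "signed G u = concat (map (\<lambda>(g, b). if b then G g else winv (G g)) u)"

lemma signed_simps [simp]: "signed G [] = []" "signed G ((g, b) # u) = (if b then G g else winv (G g)) @ signed G u"
  "signed G (u @ v) = signed G u @ signed G v"
  by (simp_all add: signed_def)

fun count_step :: "(int \<Rightarrow> int \<Rightarrow> int) \<Rightarrow> (int \<Rightarrow> int) \<Rightarrow> ('s, 'a) symbol \<times> bool \<Rightarrow> int \<times> int \<times> int \<Rightarrow> int \<times> int \<times> int" where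
  "count_step l m (Row x, b) (h, s, J) = (h, s, if b then J + l h s else J - l h s)"
| "count_step l m (State p, b) (h, s, J) = (h, if b then s + 1 else s - 1, J)"
| "count_step l m (Mark, b) (h, s, J) = (if b then (h + 1, s, J + m s) else (h - 1, s, J - m s))"

lemma count_step_inverse: "count_step l m x (count_step l m (inv_letter x) s) = s"
proof -
  obtain y b where "x = (y, b)" by (cases x)
  then show ?thesis by (cases y; cases b; cases s) auto
qed

locale transducer =
  fixes R :: "('s :: countable \<times> 'a :: countable \<times> 'a \<times> 's) set" and p0 :: 's and F :: "'s set" and out :: 'a
  assumes finite_R: "finite R" and finite_F: "finite F"
begin

abbreviation rows :: "bool \<Rightarrow> 'a list \<Rightarrow> ('s, 'a) symbol gword" where
  "rows b v \<equiv> map (\<lambda>x. (Row x, b)) v"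

lemma winv_rows: "winv (rows b v) = rows (\<not> b) (rev v)"
  by (induction v) auto

definition transduce :: "'a list \<Rightarrow> 'a list \<Rightarrow> bool" where
  "transduce v w \<longleftrightarrow> (\<exists>p \<in> F. sweep R p0 v w p)"

fun left :: "('s, 'a) gen \<Rightarrow> ('s, 'a) symbol gword" where
  "left (Odd p x y q) = [(State p, False), (Row x, False), (State q, True)]"
| "left (Turn_Odd p) = [(State p, False), (Mark, True)]"
| "left (Even x) = [(Row x, True)]"
| "left Turn_Even = [(State p0, True)]"

fun right :: "('s, 'a) gen \<Rightarrow> ('s, 'a) symbol gword" where
  "right (Odd p x y q) = [(Row y, True)]"
| "right (Turn_Odd p) = [(State p0, True)]"
| "right (Even x) = [(State p0, False), (Row x, False), (State p0, True)]"
| "right Turn_Even = [(State p0, False), (Mark, True)]"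

definition gens :: "('s, 'a) gen set" where
  "gens = (\<lambda>(p, x, y, q). Odd p x y q) ` R \<union> Turn_Odd ` F \<union> (\<lambda>(p, x, y, q). Even y) ` R \<union> {Turn_Even}"

definition left_target :: "nat \<Rightarrow> 'a list \<Rightarrow> nat \<Rightarrow> ('s, 'a) symbol gword" where
  "left_target k v m = (State p0, False) # rows False v @ replicate k (Mark, True) @ rows True (replicate m out) @ [(State p0, True)]"

definition right_target :: "nat \<Rightarrow> ('s, 'a) symbol gword" where
  "right_target k = replicate k (Mark, True)"

inductive blocks :: "nat \<Rightarrow> ('s, 'a) gen gword \<Rightarrow> bool" where
  blocks_0: "blocks 0 []"
| blocks_Suc: "blocks k u \<Longrightarrow>
    blocks (Suc k) (map (\<lambda>(p, x, y, q). (Odd p x y q, True)) rs @ (Turn_Odd p, True) # map (\<lambda>x. (Even x, True)) es @ (Turn_Even, True) # u)"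

subsection \<open>Counting forces the shape of a short product\<close>

text \<open>With \<open>x\<close> and \<open>y\<close> the net numbers of odd and even turns after a position, the weights are chosen such
  that a generator contributes at most 1, and 1 only if it is used positively and at its proper time.\<close>

definition left_weight :: "nat \<Rightarrow> int \<Rightarrow> int \<Rightarrow> int" where
  "left_weight k h s = (if s = 1 then - 2 * max 0 (min h (int k)) else 0)"

definition right_weight :: "nat \<Rightarrow> int \<Rightarrow> int \<Rightarrow> int" where
  "right_weight k h s = (if s = 0 then (if h \<le> 0 then 0 else if h \<le> int k then 1 - 2 * h else - 2 * int k) else 0)"

abbreviation left_count :: "nat \<Rightarrow> ('s, 'a) symbol gword \<Rightarrow> int \<times> int \<times> int" where
  "left_count k w \<equiv> foldr (count_step (left_weight k) (\<lambda>s. of_bool (s = 1))) w (0, 0, 0)"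

abbreviation right_count :: "nat \<Rightarrow> ('s, 'a) symbol gword \<Rightarrow> int \<times> int \<times> int" where
  "right_count k w \<equiv> foldr (count_step (right_weight k) (\<lambda>s. of_bool (s = 0))) w (0, 0, 0)"

fun timely :: "int \<Rightarrow> int \<Rightarrow> ('s, 'a) gen \<times> bool \<Rightarrow> bool" where
  "timely x y (Odd p a b q, c) \<longleftrightarrow> c \<and> x = y \<and> x \<ge> 1"
| "timely x y (Turn_Odd p, c) \<longleftrightarrow> c \<and> y = x + 1"
| "timely x y (Even a, c) \<longleftrightarrow> c \<and> y = x + 1"
| "timely x y (Turn_Even, c) \<longleftrightarrow> c \<and> x = y"

fun advance :: "int \<Rightarrow> int \<Rightarrow> ('s, 'a) gen \<times> bool \<Rightarrow> int \<times> int" where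
  "advance x y (Turn_Odd p, c) = (if c then x + 1 else x - 1, y)"
| "advance x y (Turn_Even, c) = (x, if c then y + 1 else y - 1)"
| "advance x y _ = (x, y)"

lemma count_gen:
  assumes "left_count k (signed left u) = (x, y - x, J1)" "right_count k (signed right u) = (y, x - y, J2)"
  shows "\<exists>x' y' J1' J2'. advance x y g = (x', y') \<and> left_count k (signed left (g # u)) = (x', y' - x', J1') \<and>
    right_count k (signed right (g # u)) = (y', x' - y', J2') \<and> J1' + J2' \<le> J1 + J2 + 1 \<and>
    (J1' + J2' = J1 + J2 + 1 \<longrightarrow> timely x y g)"
proof -
  obtain g' c where g: "g = (g', c)" by (cases g)
  show ?thesis
    using assms unfolding g
    by (cases g'; cases c) (auto simp: left_weight_def right_weight_def)
qed

lemma blocks_of_count: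
  "\<exists>x y J1 J2. left_count k (signed left u) = (x, y - x, J1) \<and> right_count k (signed right u) = (y, x - y, J2) \<and>
     J1 + J2 \<le> int (length u) \<and>
     (J1 + J2 = int (length u) \<longrightarrow>
        (\<exists>j. x = int j \<and> (y = x \<and> blocks j u \<or>
           y = x + 1 \<and> (\<exists>es v. u = map (\<lambda>x. (Even x, True)) es @ (Turn_Even, True) # v \<and> blocks j v))))"
proof (induction u)
  case Nil
  show ?case by (auto intro: blocks_0)
next
  case (Cons g u)
  then obtain x y J1 J2 where
    c: "left_count k (signed left u) = (x, y - x, J1)" "right_count k (signed right u) = (y, x - y, J2)"
    and le: "J1 + J2 \<le> int (length u)"
    and shape: "J1 + J2 = int (length u) \<Longrightarrow> \<exists>j. x = int j \<and> (y = x \<and> blocks j u \<or>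
           y = x + 1 \<and> (\<exists>es v. u = map (\<lambda>x. (Even x, True)) es @ (Turn_Even, True) # v \<and> blocks j v))"
    by blast
  obtain x' y' J1' J2' where
    c': "advance x y g = (x', y')" "left_count k (signed left (g # u)) = (x', y' - x', J1')"
      "right_count k (signed right (g # u)) = (y', x' - y', J2')"
    and le': "J1' + J2' \<le> J1 + J2 + 1" and timely: "J1' + J2' = J1 + J2 + 1 \<Longrightarrow> timely x y g"
    using count_gen[OF c, of g] by blast
  have "\<exists>j. x' = int j \<and> (y' = x' \<and> blocks j (g # u) \<or>
           y' = x' + 1 \<and> (\<exists>es v. g # u = map (\<lambda>x. (Even x, True)) es @ (Turn_Even, True) # v \<and> blocks j v))"
    if "J1' + J2' = int (length (g # u))"
  proof -
    have eq: "J1 + J2 = int (length u)" "J1' + J2' = J1 + J2 + 1" using that le le' by simp_all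
    from shape[OF eq(1)] obtain j where j: "x = int j" "y = x \<and> blocks j u \<or>
           y = x + 1 \<and> (\<exists>es v. u = map (\<lambda>x. (Even x, True)) es @ (Turn_Even, True) # v \<and> blocks j v)" by blast
    have t: "timely x y g" by (rule timely[OF eq(2)])
    obtain g' b where g: "g = (g', b)" by (cases g)
    from j(2) show ?thesis
    proof
      assume b: "y = x \<and> blocks j u"
      show ?thesis
      proof (cases g')
        case (Odd p a a' q)
        then obtain i where "j = Suc i" using t g j(1) by (cases j) auto
        with b obtain v rs p' es where v: "blocks i v"
          "u = map (\<lambda>(p, x, y, q). (Odd p x y q, True)) rs @ (Turn_Odd p', True) # map (\<lambda>x. (Even x, True)) es @ (Turn_Even, True) # v"
          by (auto elim: blocks.cases)
        then have "blocks j (g # u)"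
          using blocks_Suc[OF v(1), of "(p, a, a', q) # rs" p' es] t g Odd \<open>j = Suc i\<close> by simp
        then show ?thesis using c'(1) g Odd j(1) b by auto
      next
        case Turn_Even
        then have "g # u = map (\<lambda>x. (Even x, True)) [] @ (Turn_Even, True) # u" "x' = int j" "y' = x' + 1" "blocks j u"
          using t c'(1) g j(1) b by auto
        then show ?thesis by blast
      qed (use t g b in auto)
    next
      assume b: "y = x + 1 \<and> (\<exists>es v. u = map (\<lambda>x. (Even x, True)) es @ (Turn_Even, True) # v \<and> blocks j v)"
      then obtain es v where v: "u = map (\<lambda>x. (Even x, True)) es @ (Turn_Even, True) # v" "blocks j v" by blast
      show ?thesis
      proof (cases g')
        case (Even a)
        then have "g # u = map (\<lambda>x. (Even x, True)) (a # es) @ (Turn_Even, True) # v" using t g v(1) by simp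
        moreover have "x' = int j" "y' = x' + 1" using t c'(1) g j(1) b Even by auto
        ultimately show ?thesis using v(2) by blast
      next
        case (Turn_Odd p)
        then have "blocks (Suc j) (g # u)" using blocks_Suc[OF v(2), of "[]" p es] t g v(1) by simp
        then show ?thesis using t c'(1) g j(1) b Turn_Odd by (intro exI[of _ "Suc j"]) auto
      qed (use t g b in auto)
    qed
  qed
  then show ?case using c' le le' by (intro exI[of _ x'] exI[of _ y'] exI[of _ J1'] exI[of _ J2']) auto
qed

lemma blocks_of_product:
  assumes "red (signed left u) = red (left_target k v m)" "red (signed right u) = red (right_target k)"
    and "length u \<le> 2 * k * (length v + 1)"
  shows "blocks k u"
proof -
  note foldr_replicate [simp del]
  have rowsum: "foldr (count_step l w) (rows b v) (h, s, J) = (h, s, if b then J + int (length v) * l h s else J - int (length v) * l h s)"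
    for l w b h s J and v :: "'a list"
    by (induction v) (auto simp: algebra_simps)
  have marks: "foldr (count_step l w) (replicate n (Mark, True)) (h, s, J) = (h + int n, s, J + int n * w s)" for l w n h s J
    by (induction n) (auto simp: algebra_simps)
  have L: "left_count k (signed left u) = (int k, 0, int k + 2 * int k * int (length v))"
    using red_action_eq[of "count_step (left_weight k) (\<lambda>s. of_bool (s = 1))", OF count_step_inverse assms(1)]
    by (simp add: left_target_def rowsum marks left_weight_def algebra_simps del: map_replicate)
  have Rt: "right_count k (signed right u) = (int k, 0, int k)"
    using red_action_eq[of "count_step (right_weight k) (\<lambda>s. of_bool (s = 0))", OF count_step_inverse assms(2)]
    by (simp add: right_target_def marks)
  from blocks_of_count[of k u] L Rt have le: "2 * int k + 2 * int k * int (length v) \<le> int (length u)"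
    and shape: "2 * int k + 2 * int k * int (length v) = int (length u) \<Longrightarrow> \<exists>j. int k = int j \<and> blocks j u"
    by auto
  have "int (length u) \<le> int (2 * k * (length v + 1))" using assms(3) by (simp only: of_nat_le_iff)
  then have "2 * int k + 2 * int k * int (length v) = int (length u)" using le by (simp add: algebra_simps)
  from shape[OF this] show ?thesis by auto
qed

subsection \<open>Products of the right shape are iterated transductions\<close>

lemma odd_chain_sound:
  assumes "set rs \<subseteq> R"
    "red (signed left (map (\<lambda>(p, x, y, q). (Odd p x y q, True)) rs) @ [(State p, False)]) = red ((State q, False) # rows False v)"
  shows "sweep R q v (map (\<lambda>(p, x, y, q). y) rs) p"
  using assms
proof (induction rs arbitrary: q v)
  case Nil
  have "v = []"
  proof (rule ccontr)
    assume "v \<noteq> []"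
    then obtain a v' where v: "v = a # v'" by (cases v) auto
    have "red ([(State q, False)] @ (Row a, False) # rows False v') \<noteq> red [(State p, False)]"
      by (rule red_separator_neq[where Z = "(\<lambda>x. (Row x, False)) ` UNIV"]) (auto simp: inv_letter_def)
    then show False using Nil v by simp
  qed
  then show ?case using Nil by (auto simp: red_Cons intro: sweep_Nil)
next
  case (Cons r rs)
  obtain p1 x y p2 where r: "r = (p1, x, y, p2)" by (cases r)
  let ?rest = "signed left (map (\<lambda>(p, x, y, q). (Odd p x y q, True)) rs) @ [(State p, False)]"
  have neg: "inv_letter z \<notin> (\<lambda>x. (Row x, False)) ` UNIV" if "z \<in> set ?rest" for z
    using that by (induction rs) (auto simp: inv_letter_def)
  have w: "red ([(State p1, False)] @ (Row x, False) # ((State p2, True) # ?rest)) = red ((State q, False) # rows False v)"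
    using Cons.prems(2) by (simp add: r)
  show ?case
  proof (cases v)
    case Nil
    have "red ([(State p1, False)] @ (Row x, False) # ((State p2, True) # ?rest)) \<noteq> red [(State q, False)]"
      by (rule red_separator_neq[where Z = "(\<lambda>x. (Row x, False)) ` UNIV"]) (use neg in \<open>auto simp: inv_letter_def\<close>)
    then show ?thesis using w Nil by simp
  next
    case (Cons a v')
    have w': "red ([(State p1, False)] @ (Row x, False) # ((State p2, True) # ?rest)) =
       red ([(State q, False)] @ (Row a, False) # rows False v')" using w Cons by simp
    have "red [(State p1 :: ('s, 'a) symbol, False)] = red [(State q, False)] \<and> (Row x :: ('s, 'a) symbol, False) = (Row a, False) \<and>
       red ((State p2, True) # ?rest) = red (rows False v')"
    proof (rule red_separator_eq[where Z = "(\<lambda>x. (Row x, False)) ` UNIV"])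
      show "red ([(State p1, False)] @ (Row x, False) # ((State p2, True) # ?rest)) =
        red ([(State q, False)] @ (Row a, False) # rows False v')" by (rule w')
    qed (use neg in \<open>auto simp: inv_letter_def\<close>)
    then have eq: "p1 = q" "x = a" "red ([(State p2, True)] @ ?rest) = red (rows False v')" by (auto simp: red_Cons)
    from eq(3) have "red ?rest = red ((State p2, False) # rows False v')" unfolding red_append_eq_iff by simp
    with Cons.IH[of p2 v'] Cons.prems(1) show ?thesis using Cons eq r by (auto intro: sweep_Cons)
  qed
qed

lemma odd_chain_complete:
  assumes "sweep R q v w p"
  shows "\<exists>rs. set rs \<subseteq> R \<and> w = map (\<lambda>(p, x, y, q). y) rs \<and> length rs = length v \<and>
    red (signed left (map (\<lambda>(p, x, y, q). (Odd p x y q, True)) rs) @ [(State p, False)]) = red ((State q, False) # rows False v)"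
  using assms
proof induction
  case (sweep_Nil p)
  show ?case by (intro exI[of _ "[]"]) auto
next
  case (sweep_Cons p x y q xs ys r)
  then obtain rs where rs: "set rs \<subseteq> R" "ys = map (\<lambda>(p, x, y, q). y) rs" "length rs = length xs"
    "red (signed left (map (\<lambda>(p, x, y, q). (Odd p x y q, True)) rs) @ [(State r, False)]) = red ((State q, False) # rows False xs)"
    by blast
  have "red ([(State p, False), (Row x, False), (State q, True)] @ (signed left (map (\<lambda>(p, x, y, q). (Odd p x y q, True)) rs) @ [(State r, False)])) =
    red ([(State p, False), (Row x, False), (State q, True)] @ ((State q, False) # rows False xs))"
    unfolding red_left_cancel by (rule rs(4))
  also have "\<dots> = red ([(State p, False), (Row x, False)] @ rows False xs)"
    using red_cancel[of "[(State p, False), (Row x, False)]" "(State q, True)" "rows False xs"] by simp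
  finally show ?case using rs sweep_Cons.hyps(1)
    by (intro exI[of _ "(p, x, y, q) # rs"]) auto
qed

lemma signed_odd_right: "signed right (map (\<lambda>(p, x, y, q). (Odd p x y q, True)) rs) = rows True (map (\<lambda>(p, x, y, q). y) rs)"
  by (induction rs) auto

lemma signed_even_left: "signed left (map (\<lambda>x. (Even x, True)) es) = rows True es"
  by (induction es) auto

lemma signed_even_right: "red (signed right (map (\<lambda>x. (Even x, True)) es) @ (State p0, False) # w) = red ((State p0, False) # rows False es @ w)"
proof (induction es)
  case (Cons e es)
  have "red ([(State p0, False), (Row e, False), (State p0, True)] @ (signed right (map (\<lambda>x. (Even x, True)) es) @ (State p0, False) # w)) =
    red ([(State p0, False), (Row e, False), (State p0, True)] @ (State p0, False) # rows False es @ w)"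
    unfolding red_left_cancel by (rule Cons)
  also have "\<dots> = red ((State p0, False) # rows False (e # es) @ w)"
    using red_cancel[of "[(State p0, False), (Row e, False)]" "(State p0, True)" "rows False es @ w"] by simp
  finally show ?case by simp
qed simp

lemma blocks_marks_positive:
  "blocks k u \<Longrightarrow> (Mark, False) \<notin> set (signed left u) \<and> (Mark, False) \<notin> set (signed right u)"
proof (induction rule: blocks.induct)
  case (blocks_Suc k u rs p es)
  have "(Mark, False) \<notin> set (signed left (map (\<lambda>(p, x, y, q). (Odd p x y q, True)) rs))" by (induction rs) auto
  moreover have "(Mark, False) \<notin> set (signed right (map (\<lambda>x. (Even x, True)) es))" by (induction es) auto
  ultimately show ?case using blocks_Suc by (auto simp: signed_odd_right signed_even_left)
qed simp

lemma rows_eq_iff: "red (rows True v) = red (rows True w) \<longleftrightarrow> v = w"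
proof -
  have "inj (\<lambda>x :: 'a. (Row x :: ('s, 'a) symbol, True))" by (auto simp: inj_def)
  moreover have "red (rows True v) = rows True v" for v by (rule red_positive) auto
  ultimately show ?thesis by (simp add: inj_map_eq_map)
qed

lemma rows_cancel: "red (rows False v @ rows True w) = [] \<longleftrightarrow> w = rev v"
proof -
  have "red (rows False v @ rows True w) = red [] \<longleftrightarrow> red (rows True w) = red (rows True (rev v))"
    unfolding red_append_eq_iff by (simp add: winv_rows)
  then show ?thesis by (simp add: rows_eq_iff)
qed

lemma rows_cancel': "red (rows True v @ rows False w) = [] \<longleftrightarrow> w = rev v"
proof -
  have "red (rows True v @ rows False w) = [] \<longleftrightarrow> red (rows True v @ rows False w) = red (rows True (rev w) @ rows False w)"
    using red_winv_right[of "rows True (rev w)" "[]"] by (simp add: winv_rows)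
  also have "\<dots> \<longleftrightarrow> red (rows True v) = red (rows True (rev w))" by (rule red_right_cancel)
  also have "\<dots> \<longleftrightarrow> v = rev w" by (rule rows_eq_iff)
  finally show ?thesis by auto
qed

lemma no_marks:
  "(Mark, b) \<notin> set (signed left (map (\<lambda>(p, x, y, q). (Odd p x y q, True)) rs))"
  "(Mark, b) \<notin> set (signed right (map (\<lambda>x. (Even x, True)) es))"
  by (induction rs, auto) (induction es, auto)

lemma blocks_sound:
  assumes "blocks k u" "set u \<subseteq> gens \<times> UNIV" "red (signed left u) = red (left_target k v m)"
    "red (signed right u) = red (right_target k)"
  shows "(transduce ^^ k) v (replicate m out)"
  using assms
proof (induction arbitrary: v rule: blocks.induct)
  case blocks_0
  have "red ([(State p0, False)] @ ((rows False v @ rows True (replicate m out)) @ [(State p0, True)])) = red []"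
    using blocks_0(2) by (simp add: left_target_def)
  then have "red ((rows False v @ rows True (replicate m out)) @ [(State p0, True)]) = red ([] @ [(State p0, True)])"
    unfolding red_append_eq_iff[of "[(State p0, False)]"] by simp
  then have "red (rows False v @ rows True (replicate m out)) = []" unfolding red_right_cancel by simp
  then have "replicate m out = rev v" unfolding rows_cancel .
  then have "v = replicate m out" by (metis rev_rev_ident rev_replicate)
  then show ?case by simp
next
  case (blocks_Suc k u rs p es)
  let ?Os = "map (\<lambda>(p, x, y, q). (Odd p x y q, True)) rs" and ?Es = "map (\<lambda>x. (Even x, True)) es"
  let ?ys = "map (\<lambda>(p, x, y, q). y) rs"
  note pos = blocks_marks_positive[OF blocks_Suc.hyps]
  have sep: "red a = red a' \<and> red b = red b'"
    if "red (a @ (Mark, True) # b) = red (a' @ (Mark, True) # b')"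
      "\<And>c. (Mark, c) \<notin> set a \<union> set a'" and F: "(Mark, False) \<notin> set b \<union> set b'" for a a' b b' :: "('s, 'a) symbol gword"
  proof -
    have nm: "(Mark, c) \<in> set b \<Longrightarrow> c" "(Mark, c) \<in> set b' \<Longrightarrow> c" for c using F by (cases c; auto)+
    have "red a = red a' \<and> (Mark :: ('s, 'a) symbol, True) = (Mark, True) \<and> red b = red b'"
    proof (rule red_separator_eq[where Z = "{(Mark, True)}"])
      show "red (a @ (Mark, True) # b) = red (a' @ (Mark, True) # b')" by (rule that(1))
    qed (use that(2) in \<open>auto simp: inv_letter_def dest: nm\<close>)
    then show ?thesis by blast
  qed
  have "red ((signed left ?Os @ [(State p, False)]) @ (Mark, True) # (rows True es @ (State p0, True) # signed left u)) =
    red (((State p0, False) # rows False v) @ (Mark, True) # (replicate k (Mark, True) @ rows True (replicate m out) @ [(State p0, True)]))"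
    using blocks_Suc.prems(2) by (simp add: left_target_def signed_even_left)
  from sep[OF this] have l: "red (signed left ?Os @ [(State p, False)]) = red ((State p0, False) # rows False v)"
    "red (rows True es @ (State p0, True) # signed left u) = red (replicate k (Mark, True) @ rows True (replicate m out) @ [(State p0, True)])"
    using no_marks pos by auto
  have "red ((rows True ?ys @ (State p0, True) # signed right ?Es @ [(State p0, False)]) @ (Mark, True) # signed right u) =
    red ([] @ (Mark, True) # replicate k (Mark, True))"
    using blocks_Suc.prems(3) by (simp add: right_target_def signed_odd_right)
  from sep[OF this] have r: "red (rows True ?ys @ (State p0, True) # signed right ?Es @ [(State p0, False)]) = []"
    "red (signed right u) = red (right_target k)"
    using no_marks pos by (auto simp: right_target_def)
  have g: "set rs \<subseteq> R" "p \<in> F" "set u \<subseteq> gens \<times> UNIV"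
    using blocks_Suc.prems(1) by (auto simp: gens_def)
  have sw: "sweep R p0 v ?ys p" by (rule odd_chain_sound[OF g(1) l(1)])
  have "red ([(State p0, True)] @ signed right ?Es @ [(State p0, False)]) = red ([(State p0, True)] @ (State p0, False) # rows False es)"
    unfolding red_left_cancel using signed_even_right[of es "[]"] by simp
  also have "\<dots> = red (rows False es)"
    using red_cancel[of "[]" "(State p0, True)" "rows False es"] by simp
  finally have "red (rows True ?ys @ rows False es) = []"
    using r(1) red_cong[OF refl[of "red (rows True ?ys)"], of "[(State p0, True)] @ signed right ?Es @ [(State p0, False)]" "rows False es"] by simp
  then have es: "es = rev ?ys" unfolding rows_cancel' .
  have "red ((rows True es @ [(State p0, True)]) @ signed left u) = red (replicate k (Mark, True) @ rows True (replicate m out) @ [(State p0, True)])"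
    using l(2) by simp
  then have "red (signed left u) = red (left_target k ?ys m)"
    unfolding red_append_eq_iff by (simp add: winv_rows es left_target_def)
  from blocks_Suc.IH[OF g(3) this r(2)] have "(transduce ^^ k) ?ys (replicate m out)" .
  moreover have "transduce v ?ys" using sw g(2) by (auto simp: transduce_def)
  ultimately show ?case by (rule relpowp_Suc_I2[rotated])
qed

lemma sweep_length: "sweep R' p v w q \<Longrightarrow> length w = length v"
  by (induction rule: sweep.induct) auto

lemma iterated_transduction_complete:
  assumes "(transduce ^^ k) v (replicate m out)"
  shows "\<exists>u. set u \<subseteq> gens \<times> UNIV \<and> length u = 2 * k * (length v + 1) \<and> red (signed left u) = red (left_target k v m) \<and>
    red (signed right u) = red (right_target k)"
  using assms
proof (induction k arbitrary: v)
  case 0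
  then have "v = replicate m out" by simp
  then have X: "red (rows False v @ rows True (replicate m out)) = red []" using rows_cancel[of v "replicate m out"] by simp
  have "red ([(State p0, False)] @ ((rows False v @ rows True (replicate m out)) @ [(State p0, True)])) =
     red ([(State p0, False)] @ ([] @ [(State p0, True)]))"
    unfolding red_left_cancel red_right_cancel by (rule X)
  also have "\<dots> = []" by (simp add: red_Cons inverse_letters_def)
  finally show ?case by (intro exI[of _ "[]"]) (simp add: left_target_def right_target_def)
next
  case (Suc k)
  from Suc.prems obtain w where w: "transduce v w" "(transduce ^^ k) w (replicate m out)"
    by (rule relpowp_Suc_E2)
  from w(1) obtain p where p: "p \<in> F" "sweep R p0 v w p" by (auto simp: transduce_def)
  obtain rs where rs: "set rs \<subseteq> R" "w = map (\<lambda>(p, x, y, q). y) rs" "length rs = length v"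
    "red (signed left (map (\<lambda>(p, x, y, q). (Odd p x y q, True)) rs) @ [(State p, False)]) = red ((State p0, False) # rows False v)"
    using odd_chain_complete[OF p(2)] by blast
  from Suc.IH[OF w(2)] obtain u where u: "set u \<subseteq> gens \<times> UNIV" "length u = 2 * k * (length w + 1)"
    "red (signed left u) = red (left_target k w m)" "red (signed right u) = red (right_target k)" by blast
  let ?Os = "map (\<lambda>(p, x, y, q). (Odd p x y q, True)) rs" and ?Es = "map (\<lambda>x. (Even x, True)) (rev w)"
  define U where "U = ?Os @ (Turn_Odd p, True) # ?Es @ (Turn_Even, True) # u"
  have "Even y \<in> gens" if "(p, x, y, q) \<in> R" for p x y q
  proof -
    have "(Even y :: ('s, 'a) gen) \<in> (\<lambda>(p, x, y, q). Even y) ` R" by (rule rev_image_eqI[OF that]) simp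
    then show ?thesis unfolding gens_def by blast
  qed
  then have "set ?Es \<subseteq> gens \<times> UNIV" using rs(1,2) by fastforce
  moreover have "Odd p x y q \<in> gens" if "(p, x, y, q) \<in> R" for p x y q
  proof -
    have "Odd p x y q \<in> (\<lambda>(p, x, y, q). Odd p x y q) ` R" by (rule rev_image_eqI[OF that]) simp
    then show ?thesis unfolding gens_def by blast
  qed
  then have "set ?Os \<subseteq> gens \<times> UNIV" using rs(1) by fastforce
  moreover have "Turn_Odd p \<in> gens" "Turn_Even \<in> gens" using p(1) by (simp_all add: gens_def)
  ultimately have "set U \<subseteq> gens \<times> UNIV" using u(1) by (simp add: U_def)
  moreover have "length U = 2 * Suc k * (length v + 1)"
    using rs(2,3) u(2) by (simp add: U_def algebra_simps)
  moreover have "red (signed left U) = red (left_target (Suc k) v m)"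
  proof -
    have "red (rows True (rev w) @ (State p0, True) # signed left u) =
        red ((rows True (rev w) @ [(State p0, True)]) @ left_target k w m)"
      using u(3) red_left_cancel[of "rows True (rev w) @ [(State p0, True)]" "signed left u" "left_target k w m"] by simp
    also have "\<dots> = red ((rows True (rev w) @ [(State p0, True)]) @ winv (rows True (rev w) @ [(State p0, True)]) @
        (replicate k (Mark, True) @ rows True (replicate m out) @ [(State p0, True)]))"
      by (simp add: left_target_def winv_rows)
    also have "\<dots> = red (replicate k (Mark, True) @ rows True (replicate m out) @ [(State p0, True)])"
      by (rule red_winv_right)
    finally have 1: "red ((Mark, True) # rows True (rev w) @ (State p0, True) # signed left u) =
      red ((Mark, True) # replicate k (Mark, True) @ rows True (replicate m out) @ [(State p0, True)])"
      using red_left_cancel[of "[(Mark, True)]" "rows True (rev w) @ (State p0, True) # signed left u"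
        "replicate k (Mark, True) @ rows True (replicate m out) @ [(State p0, True)]"] by simp
    have "red ((signed left ?Os @ [(State p, False)]) @ ((Mark, True) # rows True (rev w) @ (State p0, True) # signed left u)) =
      red (((State p0, False) # rows False v) @ ((Mark, True) # replicate k (Mark, True) @ rows True (replicate m out) @ [(State p0, True)]))"
      by (rule red_cong[OF rs(4) 1])
    then show ?thesis by (simp add: U_def signed_even_left left_target_def)
  qed
  moreover have "red (signed right U) = red (right_target (Suc k))"
  proof -
    let ?t = "(Mark, True) # replicate k (Mark, True)"
    have m: "red ((Mark, True) # signed right u) = red ?t"
      using u(4) red_left_cancel[of "[(Mark, True)]" "signed right u" "replicate k (Mark, True)"] by (simp add: right_target_def)
    have "red (signed right ?Es @ (State p0, False) # (Mark, True) # signed right u) =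
      red (((State p0, False) # rows False (rev w)) @ ((Mark, True) # signed right u))"
      using signed_even_right[of "rev w" "(Mark, True) # signed right u"] by simp
    also have "\<dots> = red (((State p0, False) # rows False (rev w)) @ ?t)"
      unfolding red_left_cancel by (rule m)
    finally have "red ((rows True w @ [(State p0, True)]) @ (signed right ?Es @ (State p0, False) # (Mark, True) # signed right u)) =
       red ((rows True w @ [(State p0, True)]) @ (((State p0, False) # rows False (rev w)) @ ?t))"
      unfolding red_left_cancel .
    also have "\<dots> = red (rows True w @ winv (rows True w) @ ?t)"
      using red_cancel[of "rows True w" "(State p0, True)" "rows False (rev w) @ ?t"] by (simp add: winv_rows)
    also have "\<dots> = red ?t" by (rule red_winv_right)
    finally show ?thesis by (simp add: U_def signed_odd_right rs(2)[symmetric] right_target_def)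
  qed
  ultimately show ?case by blast
qed

definition gen_list :: "('s, 'a) gen list" where
  "gen_list = (SOME gs. set gs = gens)"

lemma set_gen_list: "set gen_list = gens"
proof -
  have "finite gens" using finite_R finite_F by (simp add: gens_def)
  then show ?thesis unfolding gen_list_def by (metis (mono_tags, lifting) finite_list someI_ex)
qed

definition subgroup_gens :: "(nat gword \<times> nat gword) list" where
  "subgroup_gens = map (\<lambda>g. (red (free_embed (left g)), red (free_embed (right g)))) gen_list"

lemma subgroup_gens_carrier: "set subgroup_gens \<subseteq> carrier (F2 \<times>\<times> F2)"
  using red_in_F2[OF free_embed_letters] by (auto simp: subgroup_gens_def DirProd_def)

lemma word_value_subgroup_gens:
  assumes "u \<in> words_over subgroup_gens"
  shows "word_value (F2 \<times>\<times> F2) subgroup_gens u =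
    (red (free_embed (signed left (map (apfst ((!) gen_list)) u))), red (free_embed (signed right (map (apfst ((!) gen_list)) u))))"
proof -
  have e: "red (flat_word (map (\<lambda>g. red (free_embed (G g))) gen_list) u) = red (free_embed (signed G (map (apfst ((!) gen_list)) u)))"
    for G :: "('s, 'a) gen \<Rightarrow> ('s, 'a) symbol gword"
    using assms
  proof (induction u)
    case (Cons l u)
    then have l: "fst l < length gen_list" and u: "u \<in> words_over subgroup_gens"
      by (auto simp: words_over_def subgroup_gens_def)
    have "red (letter_word (map (\<lambda>g. red (free_embed (G g))) gen_list) l) =
       red (free_embed (if snd l then G (gen_list ! fst l) else winv (G (gen_list ! fst l))))"
      using l by (auto simp: letter_word_def winv_free_embed[symmetric] intro: red_winv_cong)
    from red_cong[OF this Cons.IH[OF u]] show ?case by (cases l) simp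
  qed simp
  show ?thesis
    unfolding word_value_F2[OF subgroup_gens_carrier assms]
    using e[of left] e[of right] by (simp add: subgroup_gens_def comp_def)
qed

theorem bounded_product_iff:
  "bounded_product (F2 \<times>\<times> F2) subgroup_gens
     (red (free_embed (left_target k v (length v))), red (free_embed (right_target k))) (2 * k * (length v + 1)) \<longleftrightarrow>
   (transduce ^^ k) v (replicate (length v) out)"
proof
  assume "bounded_product (F2 \<times>\<times> F2) subgroup_gens
     (red (free_embed (left_target k v (length v))), red (free_embed (right_target k))) (2 * k * (length v + 1))"
  then obtain u where u: "u \<in> words_over subgroup_gens" "length u \<le> 2 * k * (length v + 1)"
    "(red (free_embed (left_target k v (length v))), red (free_embed (right_target k))) = word_value (F2 \<times>\<times> F2) subgroup_gens u"
    by (auto simp: bounded_product_def)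
  define U where "U = map (apfst ((!) gen_list)) u"
  have "red (signed left U) = red (left_target k v (length v))" "red (signed right U) = red (right_target k)"
    using u(3) unfolding word_value_subgroup_gens[OF u(1)] U_def[symmetric] by (auto simp: red_free_embed_iff)
  moreover from this have "blocks k U" by (rule blocks_of_product) (use u(2) in \<open>simp add: U_def\<close>)
  moreover have "set U \<subseteq> gens \<times> UNIV"
    using u(1) by (fastforce simp: U_def words_over_def subgroup_gens_def set_gen_list[symmetric])
  ultimately show "(transduce ^^ k) v (replicate (length v) out)" by (blast intro: blocks_sound)
next
  assume "(transduce ^^ k) v (replicate (length v) out)"
  from iterated_transduction_complete[OF this] obtain U where U: "set U \<subseteq> gens \<times> UNIV" "length U = 2 * k * (length v + 1)"
    "red (signed left U) = red (left_target k v (length v))" "red (signed right U) = red (right_target k)" by blast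
  have "\<exists>u. u \<in> words_over subgroup_gens \<and> U = map (apfst ((!) gen_list)) u"
    using U(1)
  proof (induction U)
    case (Cons g U)
    then obtain u where u: "u \<in> words_over subgroup_gens" "U = map (apfst ((!) gen_list)) u" by auto
    obtain i where "i < length gen_list" "gen_list ! i = fst g"
      using Cons.prems set_gen_list by (metis in_set_conv_nth list.set_intros(1) mem_Times_iff subset_iff)
    then show ?case using u
      by (intro exI[of _ "(i, snd g) # u"]) (auto simp: words_over_def subgroup_gens_def apfst_def)
  qed (simp add: words_over_def)
  then obtain u where u: "u \<in> words_over subgroup_gens" "U = map (apfst ((!) gen_list)) u" by blast
  then show "bounded_product (F2 \<times>\<times> F2) subgroup_gens
     (red (free_embed (left_target k v (length v))), red (free_embed (right_target k))) (2 * k * (length v + 1))"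
    unfolding bounded_product_def using U word_value_subgroup_gens[OF u(1)]
    by (intro bexI[OF _ u(1)]) (auto simp: red_free_embed_iff)
qed

end

section \<open>A universal transducer\<close>

text \<open>A row consists of the cells of a ternary string, at most one of them marked by a cursor, followed by a
  table of rules \<open>u \<rightarrow> v\<close> with \<open>length u = length v\<close>, stored as lists of pairs and separated by \<open>End\<close> letters.
  An application of a rule takes one sweep that sets a cursor on a cell and one on the first pair of a rule,
  one sweep per pair that replaces a letter and advances both cursors, and one that removes the cursors.\<close>

datatype uletter = Cell nat bool | Pair nat nat bool | End bool | Out

datatype ustate = Scan | Choose | Begin | Copy | Replace nat nat | Find nat nat | Shift | Finish | Erase

instance uletter :: countable by countable_datatype
instance ustate :: countable by countable_datatype

fun ternary :: "uletter \<Rightarrow> bool" where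
  "ternary (Cell x b) \<longleftrightarrow> x < 3"
| "ternary (Pair u v b) \<longleftrightarrow> u < 3 \<and> v < 3"
| "ternary (End b) \<longleftrightarrow> True"
| "ternary Out \<longleftrightarrow> False"

fun marked :: "uletter \<Rightarrow> bool" where
  "marked (Cell x b) \<longleftrightarrow> b"
| "marked (Pair u v b) \<longleftrightarrow> b"
| "marked (End b) \<longleftrightarrow> b"
| "marked Out \<longleftrightarrow> True"

fun is_cell :: "uletter \<Rightarrow> bool" where
  "is_cell (Cell x b) \<longleftrightarrow> True"
| "is_cell _ \<longleftrightarrow> False"

inductive ustep :: "ustate \<Rightarrow> uletter \<Rightarrow> uletter \<Rightarrow> ustate \<Rightarrow> bool" where
  "x < 3 \<Longrightarrow> ustep Scan (Cell x False) (Cell x False) Scan"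
| "x < 3 \<Longrightarrow> ustep Scan (Cell x False) (Cell x True) Choose"
| "ternary z \<Longrightarrow> \<not> marked z \<Longrightarrow> ustep Choose z z Choose"
| "ustep Choose (End False) (End False) Begin"
| "u < 3 \<Longrightarrow> v < 3 \<Longrightarrow> ustep Begin (Pair u v False) (Pair u v True) Copy"
| "ternary z \<Longrightarrow> \<not> marked z \<Longrightarrow> ustep Copy z z Copy"
| "u < 3 \<Longrightarrow> v < 3 \<Longrightarrow> ustep Scan (Cell u True) (Cell v False) (Replace u v)"
| "u < 3 \<Longrightarrow> v < 3 \<Longrightarrow> x < 3 \<Longrightarrow> ustep (Replace u v) (Cell x False) (Cell x True) (Find u v)"
| "u < 3 \<Longrightarrow> v < 3 \<Longrightarrow> ternary z \<Longrightarrow> \<not> marked z \<Longrightarrow> ustep (Find u v) z z (Find u v)"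
| "u < 3 \<Longrightarrow> v < 3 \<Longrightarrow> ustep (Find u v) (Pair u v True) (Pair u v False) Shift"
| "u < 3 \<Longrightarrow> v < 3 \<Longrightarrow> ustep Shift (Pair u v False) (Pair u v True) Copy"
| "ustep Shift (End False) (End True) Copy"
| "x < 3 \<Longrightarrow> ustep Scan (Cell x True) (Cell x False) Finish"
| "ternary z \<Longrightarrow> \<not> marked z \<Longrightarrow> ustep Finish z z Finish"
| "ustep Finish (End True) (End False) Copy"
| "ternary z \<Longrightarrow> ustep Scan z Out Erase"
| "ternary z \<Longrightarrow> ustep Erase z Out Erase"

definition universal_rules :: "(ustate \<times> uletter \<times> uletter \<times> ustate) set" where
  "universal_rules = {(p, x, y, q). ustep p x y q}"

lemma finite_universal_rules: "finite universal_rules"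
proof -
  define A where "A = insert Out ((\<lambda>(x, b). Cell x b) ` ({..<3} \<times> UNIV) \<union> (\<lambda>(u, v, b). Pair u v b) ` ({..<3} \<times> {..<3} \<times> UNIV) \<union> End ` UNIV)"
  define Q where "Q = {Scan, Choose, Begin, Copy, Shift, Finish, Erase} \<union> (\<lambda>(u, v). Replace u v) ` ({..<3} \<times> {..<3}) \<union> (\<lambda>(u, v). Find u v) ` ({..<3} \<times> {..<3})"
  have A: "ternary z \<Longrightarrow> z \<in> A" "Out \<in> A" for z by (cases z; force simp: A_def)+
  have Q: "u < 3 \<Longrightarrow> v < 3 \<Longrightarrow> Replace u v \<in> Q \<and> Find u v \<in> Q" "{Scan, Choose, Begin, Copy, Shift, Finish, Erase} \<subseteq> Q" for u v
    by (force simp: Q_def)+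
  have "p \<in> Q \<and> q \<in> Q \<and> ternary x \<and> (ternary y \<or> y = Out)" if "ustep p x y q" for p x y q
    using that by cases (use Q in auto)
  then have "universal_rules \<subseteq> Q \<times> A \<times> A \<times> Q"
    unfolding universal_rules_def using A by blast
  moreover have "finite A" "finite Q" by (simp_all add: A_def Q_def)
  ultimately show ?thesis by (meson finite_SigmaI finite_subset)
qed

abbreviation usweep :: "ustate \<Rightarrow> uletter list \<Rightarrow> uletter list \<Rightarrow> ustate \<Rightarrow> bool" where
  "usweep \<equiv> sweep universal_rules"

interpretation universal: transducer universal_rules Scan "{Copy, Erase}" Out
  by unfold_locales (simp_all add: finite_universal_rules)

lemma usweep_Nil_iff: "usweep p [] w q \<longleftrightarrow> w = [] \<and> p = q"
  by (subst sweep.simps) auto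

lemma usweep_Cons_iff: "usweep p (x # xs) w q \<longleftrightarrow> (\<exists>y ys r. w = y # ys \<and> ustep p x y r \<and> usweep r xs ys q)"
  by (subst sweep.simps) (auto simp: universal_rules_def)

lemma usweep_append: "usweep p xs ys q \<Longrightarrow> usweep q xs' ys' r \<Longrightarrow> usweep p (xs @ xs') (ys @ ys') r"
  by (induction rule: sweep.induct) (auto intro: sweep.intros)

inductive_simps ustep_simps:
  "ustep Scan (Cell x b) y q" "ustep Scan (Pair u v b) y q" "ustep Scan (End b) y q"
  "ustep Choose z y q" "ustep Begin z y q" "ustep Copy z y q" "ustep (Replace u v) z y q"
  "ustep (Find u v) z y q" "ustep Shift z y q" "ustep Finish z y q" "ustep Erase z y q"

abbreviation cells :: "nat list \<Rightarrow> uletter list" where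
  "cells c \<equiv> map (\<lambda>x. Cell x False) c"

fun entry :: "bool \<Rightarrow> (nat \<times> nat) option \<Rightarrow> uletter" where
  "entry b None = End b"
| "entry b (Some (u, v)) = Pair u v b"

abbreviation table :: "(nat \<times> nat) option list \<Rightarrow> uletter list" where
  "table T \<equiv> map (entry False) T"

definition plain_row :: "nat list \<Rightarrow> (nat \<times> nat) option list \<Rightarrow> uletter list" where
  "plain_row c T = cells c @ table T"

definition cursor_row :: "nat list \<Rightarrow> nat \<Rightarrow> nat list \<Rightarrow> (nat \<times> nat) option list \<Rightarrow> (nat \<times> nat) option \<Rightarrow> (nat \<times> nat) option list \<Rightarrow> uletter list" where
  "cursor_row l x r T1 e T2 = cells l @ Cell x True # cells r @ table T1 @ entry True e # table T2"

lemma entry_simps [simp]: "\<not> marked (entry False e)" "marked (entry True e)" "entry b e = entry c f \<longleftrightarrow> b = c \<and> e = f"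
    "entry b e \<noteq> Cell x d" "Cell x d \<noteq> entry b e" "entry b e \<noteq> Out"
    "entry b e = End d \<longleftrightarrow> e = None \<and> b = d" "End d = entry b e \<longleftrightarrow> e = None \<and> b = d"
    "entry b e = Pair u v d \<longleftrightarrow> e = Some (u, v) \<and> b = d" "Pair u v d = entry b e \<longleftrightarrow> e = Some (u, v) \<and> b = d"
  by (cases e; cases f; auto)+

lemma usweep_Copy: "\<forall>z \<in> set xs. \<not> marked z \<Longrightarrow> usweep Copy xs w q \<longleftrightarrow> (\<forall>z \<in> set xs. ternary z) \<and> w = xs \<and> q = Copy"
  by (induction xs arbitrary: w) (auto simp: usweep_Nil_iff usweep_Cons_iff ustep_simps)

lemma usweep_Choose:
  assumes "usweep Choose (cells r @ table T) w q" "q \<in> {Copy, Erase}"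
  obtains T1 e T2 where "T = T1 @ None # Some e # T2" "w = cells r @ table (T1 @ [None]) @ entry True (Some e) # table T2"
proof -
  have tab: "\<exists>T1 e T2. T = T1 @ None # Some e # T2 \<and> w = table (T1 @ [None]) @ entry True (Some e) # table T2"
    if "usweep Choose (table T) w q" for w T
    using that
  proof (induction T arbitrary: w)
    case Nil
    then show ?case using assms(2) by (auto simp: usweep_Nil_iff)
  next
    case (Cons f T)
    from Cons.prems obtain y ys p where w: "w = y # ys" "ustep Choose (entry False f) y p" "usweep p (table T) ys q"
      by (auto simp: usweep_Cons_iff)
    from w(2) consider "y = entry False f" "p = Choose" | "f = None" "y = End False" "p = Begin"
      by (auto simp: ustep_simps)
    then show ?case
    proof cases
      case 1
      from Cons.IH[OF w(3)[unfolded 1]] obtain T1 e T2 where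
        "T = T1 @ None # Some e # T2" "ys = table (T1 @ [None]) @ entry True (Some e) # table T2" by blast
      then show ?thesis using w 1 by (intro exI[of _ "f # T1"] exI[of _ e] exI[of _ T2]) simp
    next
      case 2
      show ?thesis
      proof (cases T)
        case Nil
        then show ?thesis using w(3) 2 assms(2) by (auto simp: usweep_Nil_iff)
      next
        case (Cons g T')
        with w(3) 2 obtain y' ys' p' where w': "ys = y' # ys'" "ustep Begin (entry False g) y' p'" "usweep p' (table T') ys' q"
          by (auto simp: usweep_Cons_iff)
        from w'(2) obtain u v where g: "g = Some (u, v)" "y' = Pair u v True" "p' = Copy" by (auto simp: ustep_simps)
        have "ys' = table T'" using w'(3) g(3) by (simp add: usweep_Copy)
        then show ?thesis using w w' 2 g Cons by (intro exI[of _ "[]"] exI[of _ "(u, v)"] exI[of _ T']) simp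
      qed
    qed
  qed
  have "\<exists>w'. w = cells r @ w' \<and> usweep Choose (table T) w' q"
    using assms(1) by (induction r arbitrary: w) (auto simp: usweep_Cons_iff ustep_simps)
  then obtain w' where w': "w = cells r @ w'" "usweep Choose (table T) w' q" by blast
  from tab[OF w'(2)] obtain T1 e T2 where
    "T = T1 @ None # Some e # T2" "w' = table (T1 @ [None]) @ entry True (Some e) # table T2" by blast
  then show thesis using that[of T1 e T2] w'(1) by simp
qed

lemma usweep_Find:
  assumes "usweep (Find u v) (cells r @ table T1 @ entry True e # table T2) w q" "q \<in> {Copy, Erase}"
  obtains e' T2' where "e = Some (u, v)" "T2 = e' # T2'" "w = cells r @ table (T1 @ [e]) @ entry True e' # table T2'"
proof -
  have "\<exists>w'. w = cells r @ w' \<and> usweep (Find u v) (table T1 @ entry True e # table T2) w' q"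
    using assms(1) by (induction r arbitrary: w) (auto simp: usweep_Cons_iff ustep_simps)
  then obtain w' where w': "w = cells r @ w'" "usweep (Find u v) (table T1 @ entry True e # table T2) w' q" by blast
  have "\<exists>w''. w' = table T1 @ w'' \<and> usweep (Find u v) (entry True e # table T2) w'' q"
    using w'(2) by (induction T1 arbitrary: w') (auto simp: usweep_Cons_iff ustep_simps)
  then obtain w'' where w'': "w' = table T1 @ w''" "usweep (Find u v) (entry True e # table T2) w'' q" by blast
  then obtain w3 where 3: "e = Some (u, v)" "w'' = entry False e # w3" "usweep Shift (table T2) w3 q"
    by (auto simp: usweep_Cons_iff ustep_simps)
  then obtain e' T2' where T2: "T2 = e' # T2'" using assms(2) by (cases T2) (auto simp: usweep_Nil_iff)
  with 3(3) obtain w4 where "w3 = entry True e' # w4" "usweep Copy (table T2') w4 q"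
    by (auto simp: usweep_Cons_iff ustep_simps)
  then show thesis using that[OF 3(1) T2] w' w'' 3 by (simp add: usweep_Copy)
qed

lemma usweep_Finish:
  assumes "usweep Finish (cells r @ table T1 @ entry True e # table T2) w q" "q \<in> {Copy, Erase}"
  shows "e = None \<and> w = cells r @ table (T1 @ e # T2)"
proof -
  have "\<exists>w'. w = cells r @ w' \<and> usweep Finish (table T1 @ entry True e # table T2) w' q"
    using assms(1) by (induction r arbitrary: w) (auto simp: usweep_Cons_iff ustep_simps)
  then obtain w' where w': "w = cells r @ w'" "usweep Finish (table T1 @ entry True e # table T2) w' q" by blast
  have "\<exists>w''. w' = table T1 @ w'' \<and> usweep Finish (entry True e # table T2) w'' q"
    using w'(2) by (induction T1 arbitrary: w') (auto simp: usweep_Cons_iff ustep_simps)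
  then obtain w'' where w'': "w' = table T1 @ w''" "usweep Finish (entry True e # table T2) w'' q" by blast
  then obtain w3 where 3: "e = None" "w'' = entry False e # w3" "usweep Copy (table T2) w3 q"
    by (auto simp: usweep_Cons_iff ustep_simps)
  then show ?thesis using w' w'' by (simp add: usweep_Copy)
qed

lemma usweep_Scan_cells:
  assumes "usweep Scan (cells c @ X) w q" "Out \<notin> set w"
  shows "(\<exists>w'. w = cells c @ w' \<and> usweep Scan X w' q) \<or>
    (\<exists>l x r w'. c = l @ x # r \<and> w = cells l @ Cell x True # w' \<and> usweep Choose (cells r @ X) w' q)"
  using assms
proof (induction c arbitrary: w)
  case (Cons x c)
  then obtain y ys p where w: "w = y # ys" "ustep Scan (Cell x False) y p" "usweep p (cells c @ X) ys q"
    by (auto simp: usweep_Cons_iff)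
  from w(2) consider "y = Cell x False" "p = Scan" | "y = Cell x True" "p = Choose" | "y = Out"
    by (auto simp: ustep_simps)
  then show ?case
  proof cases
    case 1
    with Cons.IH[of ys] Cons.prems(2) w have "(\<exists>w'. ys = cells c @ w' \<and> usweep Scan X w' q) \<or>
      (\<exists>l x r w'. c = l @ x # r \<and> ys = cells l @ Cell x True # w' \<and> usweep Choose (cells r @ X) w' q)" by simp
    then show ?thesis
    proof (elim disjE exE conjE)
      fix l z r w' assume "c = l @ z # r" "ys = cells l @ Cell z True # w'" "usweep Choose (cells r @ X) w' q"
      then show ?thesis using w 1
        by (intro disjI2 exI[of _ "x # l"] exI[of _ z] exI[of _ r] exI[of _ w']) simp
    qed (use w 1 in auto)
  next
    case 2
    then show ?thesis using w by (intro disjI2 exI[of _ "[]"] exI[of _ x] exI[of _ c] exI[of _ ys]) simp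
  qed (use Cons.prems w in auto)
qed simp

lemma transduce_plain:
  assumes "universal.transduce (plain_row c T) w" "Out \<notin> set w" "c \<noteq> []"
  obtains l x r T1 e T2 where "c = l @ x # r" "T = T1 @ None # Some e # T2" "w = cursor_row l x r (T1 @ [None]) (Some e) T2"
proof -
  obtain q where q: "q \<in> {Copy, Erase}" "usweep Scan (cells c @ table T) w q"
    using assms(1) unfolding universal.transduce_def plain_row_def by blast
  from usweep_Scan_cells[OF q(2) assms(2)] show thesis
  proof (elim disjE exE conjE)
    fix w' assume w': "w = cells c @ w'" "usweep Scan (table T) w' q"
    show thesis
    proof (cases T)
      case Nil
      then show thesis using w'(2) q(1) by (auto simp: usweep_Nil_iff)
    next
      case (Cons f T')
      then have "Out \<in> set w'" using w'(2) by (cases f) (auto simp: usweep_Cons_iff ustep_simps)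
      then show thesis using assms(2) w'(1) by simp
    qed
  next
    fix l x r w' assume 1: "c = l @ x # r" "w = cells l @ Cell x True # w'" "usweep Choose (cells r @ table T) w' q"
    from usweep_Choose[OF 1(3) q(1)] show thesis
      using that[OF 1(1)] 1(2) by (metis cursor_row_def)
  qed
qed

lemma transduce_cursor:
  assumes "universal.transduce (cursor_row l x r T1 e T2) w" "Out \<notin> set w"
  shows "(\<exists>v x' r' e' T2'. e = Some (x, v) \<and> r = x' # r' \<and> T2 = e' # T2' \<and> w = cursor_row (l @ [v]) x' r' (T1 @ [e]) e' T2') \<or>
    (e = None \<and> w = plain_row (l @ x # r) (T1 @ e # T2))"
proof -
  let ?X = "cells r @ table T1 @ entry True e # table T2"
  obtain q where q: "q \<in> {Copy, Erase}" "usweep Scan (cells l @ Cell x True # ?X) w q"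
    using assms(1) unfolding universal.transduce_def cursor_row_def by blast
  from usweep_Scan_cells[OF q(2) assms(2)] show ?thesis
  proof (elim disjE exE conjE)
    fix w' assume w': "w = cells l @ w'" "usweep Scan (Cell x True # ?X) w' q"
    then obtain y ys p where ys: "w' = y # ys" "ustep Scan (Cell x True) y p" "usweep p ?X ys q"
      by (auto simp: usweep_Cons_iff)
    from ys(2) consider v where "y = Cell v False" "p = Replace x v" | "y = Cell x False" "p = Finish" | "y = Out"
      by (auto simp: ustep_simps)
    then show ?thesis
    proof cases
      case (1 v)
      show ?thesis
      proof (cases r)
        case Nil
        have "\<not> usweep (Replace x v) (table T1 @ entry True e # table T2) ys q"
          by (cases T1) (auto simp: usweep_Cons_iff ustep_simps)
        then show ?thesis using ys(3) 1 Nil by simp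
      next
        case (Cons x' r')
        with ys(3) 1 obtain zs where zs: "ys = Cell x' True # zs" "usweep (Find x v) (cells r' @ table T1 @ entry True e # table T2) zs q"
          by (auto simp: usweep_Cons_iff ustep_simps)
        from usweep_Find[OF zs(2) q(1)] obtain e' T2' where "e = Some (x, v)" "T2 = e' # T2'"
          "zs = cells r' @ table (T1 @ [e]) @ entry True e' # table T2'" by metis
        then show ?thesis using Cons zs ys w' 1
          by (intro disjI1 exI[of _ v] exI[of _ x'] exI[of _ r'] exI[of _ e'] exI[of _ T2']) (simp add: cursor_row_def)
      qed
    next
      case 2
      with usweep_Finish[of r T1 e T2 ys q] ys q(1) have "e = None" "ys = cells r @ table (T1 @ e # T2)" by auto
      then show ?thesis using ys w' 2 by (simp add: plain_row_def)
    next
      case 3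
      then show ?thesis using assms(2) w' ys by simp
    qed
  next
    fix l' x' r' w' assume "usweep Choose (cells r' @ Cell x True # ?X) w' q"
    then have "\<exists>w. usweep Choose (Cell x True # ?X) w q"
      by (induction r' arbitrary: w') (auto simp: usweep_Cons_iff ustep_simps)
    then show ?thesis by (auto simp: usweep_Cons_iff ustep_simps)
  qed
qed

lemma no_transduce_Out: "universal.transduce v w \<Longrightarrow> Out \<notin> set v"
proof -
  have "usweep p v w q \<Longrightarrow> Out \<notin> set v" for p q
  proof (induction rule: sweep.induct)
    case (sweep_Cons p x y q xs ys r)
    then show ?case by (auto simp: universal_rules_def elim: ustep.cases)
  qed simp
  then show "universal.transduce v w \<Longrightarrow> Out \<notin> set v" unfolding universal.transduce_def by blast
qed

lemma transduce_erase:
  assumes "universal.transduce v w" "v \<noteq> []"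
  shows "universal.transduce v (replicate (length v) Out)"
proof -
  have t: "usweep p v w q \<Longrightarrow> \<forall>z \<in> set v. ternary z" for p q
    by (induction rule: sweep.induct) (auto simp: universal_rules_def elim: ustep.cases)
  then have t: "\<forall>z \<in> set v. ternary z" using assms(1) unfolding universal.transduce_def by blast
  have e: "\<forall>z \<in> set v. ternary z \<Longrightarrow> usweep Erase v (replicate (length v) Out) Erase" for v
    by (induction v) (auto simp: usweep_Nil_iff usweep_Cons_iff ustep_simps)
  obtain z v' where v: "v = z # v'" using assms(2) by (cases v) auto
  have "ustep Scan z Out Erase" using t v by (auto intro: ustep.intros)
  then have "usweep Scan v (replicate (length v) Out) Erase" using e[of v'] t v by (auto simp: usweep_Cons_iff)
  then show ?thesis unfolding universal.transduce_def by blast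
qed

lemma usweep_keep:
  assumes "\<forall>z \<in> set xs. ternary z \<and> \<not> marked z" "\<And>z. ternary z \<Longrightarrow> \<not> marked z \<Longrightarrow> ustep p z z p"
  shows "usweep p xs xs p"
  using assms(1)
proof (induction xs)
  case (Cons z xs)
  then have "(p, z, z, p) \<in> universal_rules" using assms(2) by (simp add: universal_rules_def)
  then show ?case using Cons by (intro sweep_Cons) auto
qed (rule sweep_Nil)

lemma usweep_keep_Scan: "set l \<subseteq> {..<3} \<Longrightarrow> usweep Scan (cells l) (cells l) Scan"
  by (induction l) (auto simp: usweep_Nil_iff usweep_Cons_iff ustep_simps)

definition ternary_table :: "(nat \<times> nat) option list \<Rightarrow> bool" where
  "ternary_table T \<longleftrightarrow> (\<forall>e \<in> set T. ternary (entry False e))"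

lemma keep_table: "ternary_table T \<Longrightarrow> (\<And>z. ternary z \<Longrightarrow> \<not> marked z \<Longrightarrow> ustep p z z p) \<Longrightarrow> usweep p (table T) (table T) p"
  by (rule usweep_keep) (auto simp: ternary_table_def)

lemma keep_cells: "set r \<subseteq> {..<3} \<Longrightarrow> (\<And>z. ternary z \<Longrightarrow> \<not> marked z \<Longrightarrow> ustep p z z p) \<Longrightarrow> usweep p (cells r) (cells r) p"
  by (rule usweep_keep) auto

lemma transduce_start:
  assumes "set (l @ x # r) \<subseteq> {..<3}" "ternary_table (T1 @ None # Some e # T2)"
  shows "universal.transduce (plain_row (l @ x # r) (T1 @ None # Some e # T2)) (cursor_row l x r (T1 @ [None]) (Some e) T2)"
proof -
  obtain u v where e: "e = (u, v)" by (cases e)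
  have 1: "usweep Scan [Cell x False] [Cell x True] Choose"
    using assms by (auto simp: usweep_Nil_iff usweep_Cons_iff ustep_simps)
  have 2: "usweep Choose [End False, Pair u v False] [End False, Pair u v True] Copy"
    using assms(2) e by (auto simp: usweep_Nil_iff usweep_Cons_iff ustep_simps ternary_table_def)
  have "usweep Scan (cells l @ [Cell x False] @ cells r @ table T1 @ [End False, Pair u v False] @ table T2)
     (cells l @ [Cell x True] @ cells r @ table T1 @ [End False, Pair u v True] @ table T2) Copy"
    using assms
    by (intro usweep_append[OF usweep_keep_Scan] usweep_append[OF 1] usweep_append[OF keep_cells]
        usweep_append[OF keep_table] usweep_append[OF 2] keep_table)
      (auto simp: ternary_table_def intro: ustep.intros)
  then show ?thesis unfolding universal.transduce_def by (auto simp: plain_row_def cursor_row_def e)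
qed

lemma transduce_advance:
  assumes "set (l @ x # x' # r) \<subseteq> {..<3}" "ternary_table (T1 @ Some (x, v) # e' # T2)"
  shows "universal.transduce (cursor_row l x (x' # r) T1 (Some (x, v)) (e' # T2)) (cursor_row (l @ [v]) x' r (T1 @ [Some (x, v)]) e' T2)"
proof -
  have 1: "usweep Scan [Cell x True, Cell x' False] [Cell v False, Cell x' True] (Find x v)"
    using assms by (auto simp: usweep_Nil_iff usweep_Cons_iff ustep_simps ternary_table_def)
  have 2: "usweep (Find x v) [Pair x v True, entry False e'] [Pair x v False, entry True e'] Copy"
    using assms by (cases e') (auto simp: usweep_Nil_iff usweep_Cons_iff ustep_simps ternary_table_def)
  have "usweep Scan (cells l @ [Cell x True, Cell x' False] @ cells r @ table T1 @ [Pair x v True, entry False e'] @ table T2)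
     (cells l @ [Cell v False, Cell x' True] @ cells r @ table T1 @ [Pair x v False, entry True e'] @ table T2) Copy"
    using assms
    by (intro usweep_append[OF usweep_keep_Scan] usweep_append[OF 1] usweep_append[OF keep_cells]
        usweep_append[OF keep_table] usweep_append[OF 2] keep_table)
      (auto simp: ternary_table_def intro: ustep.intros)
  then show ?thesis unfolding universal.transduce_def by (auto simp: cursor_row_def)
qed

lemma transduce_finish:
  assumes "set (l @ x # r) \<subseteq> {..<3}" "ternary_table (T1 @ None # T2)"
  shows "universal.transduce (cursor_row l x r T1 None T2) (plain_row (l @ x # r) (T1 @ None # T2))"
proof -
  have 1: "usweep Scan [Cell x True] [Cell x False] Finish"
    using assms by (auto simp: usweep_Nil_iff usweep_Cons_iff ustep_simps)
  have 2: "usweep Finish [End True] [End False] Copy"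
    by (auto simp: usweep_Nil_iff usweep_Cons_iff ustep_simps)
  have "usweep Scan (cells l @ [Cell x True] @ cells r @ table T1 @ [End True] @ table T2)
     (cells l @ [Cell x False] @ cells r @ table T1 @ [End False] @ table T2) Copy"
    using assms
    by (intro usweep_append[OF usweep_keep_Scan] usweep_append[OF 1] usweep_append[OF keep_cells]
        usweep_append[OF keep_table] usweep_append[OF 2] keep_table)
      (auto simp: ternary_table_def intro: ustep.intros)
  then show ?thesis unfolding universal.transduce_def by (auto simp: plain_row_def cursor_row_def)
qed

section \<open>Rewriting by the universal transducer\<close>

definition rewrite :: "('a list \<times> 'a list) set \<Rightarrow> 'a list \<Rightarrow> 'a list \<Rightarrow> bool" where
  "rewrite P w w' \<longleftrightarrow> (\<exists>u v l r. (u, v) \<in> P \<and> w = l @ u @ r \<and> w' = l @ v @ r)"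

definition rule_table :: "(nat list \<times> nat list) list \<Rightarrow> (nat \<times> nat) option list" where
  "rule_table P = None # concat (map (\<lambda>(u, v). map Some (zip u v) @ [None]) P)"

locale rule_list =
  fixes P :: "(nat list \<times> nat list) list" and m :: nat
  assumes P: "(u, v) \<in> set P \<Longrightarrow> u \<noteq> [] \<and> length u = length v \<and> length u \<le> m \<and> set u \<subseteq> {..<3} \<and> set v \<subseteq> {..<3}"
begin

lemma rule_table_split:
  assumes "rule_table P = T1 @ None # Some e # T2"
  obtains u v Q where "(u, v) \<in> set P" "Some e # T2 = map Some (zip u v) @ None # Q"
proof -
  have "\<exists>(u, v) \<in> set P'. \<exists>Q. Some e # T2 = map Some (zip u v) @ None # Q"
    if "None # concat (map (\<lambda>(u, v). map Some (zip u v) @ [None]) P') = T1 @ None # Some e # T2" "set P' \<subseteq> set P" for P' T1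
    using that
  proof (induction P' arbitrary: T1)
    case Nil
    then show ?case by (cases T1) auto
  next
    case (Cons p P')
    obtain u v where p: "p = (u, v)" by (cases p)
    have uv: "u \<noteq> []" "length u = length v" using P Cons.prems(2) p by auto
    show ?case
    proof (cases T1)
      case Nil
      then have "Some e # T2 = map Some (zip u v) @ None # concat (map (\<lambda>(u, v). map Some (zip u v) @ [None]) P')"
        using Cons.prems(1) p uv by simp
      then show ?thesis using p by (intro bexI[of _ p]) auto
    next
      case (Cons f T1')
      then have eq: "map Some (zip u v) @ None # concat (map (\<lambda>(u, v). map Some (zip u v) @ [None]) P') = T1' @ None # Some e # T2"
        using Cons.prems(1) p by simp
      have split: "\<exists>T1''. None # Y = T1'' @ None # X"
        if "map Some z @ None # Y = T' @ None # X" for z :: "(nat \<times> nat) list" and X Y T'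
        using that
      proof (induction z arbitrary: T')
        case Nil
        then show ?case by (cases T') (auto intro: exI[of _ "[]"] exI[of _ "None # tl T'"])
      next
        case (Cons a z)
        then show ?case by (cases T') auto
      qed
      obtain T1'' where "None # concat (map (\<lambda>(u, v). map Some (zip u v) @ [None]) P') = T1'' @ None # Some e # T2"
        using split[OF eq] by blast
      from Cons.IH[OF this] Cons.prems(2) show ?thesis by auto
    qed
  qed
  then show thesis using assms that unfolding rule_table_def by blast
qed

abbreviation "T \<equiv> rule_table P"

abbreviation "step \<equiv> rewrite (set P)"

lemma rewrite_length: "(step ^^ i) c d \<Longrightarrow> length d = length c"
proof (induction i arbitrary: d)
  case (Suc i)
  then obtain b where "(step ^^ i) c b" "step b d" by auto
  then show ?case using Suc.IH P by (fastforce simp: rewrite_def)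
qed simp

inductive progress :: "nat list \<Rightarrow> nat \<Rightarrow> nat \<Rightarrow> uletter list \<Rightarrow> bool" for c0 where
  at_rest: "(step ^^ i) c0 c \<Longrightarrow> j \<le> i * (m + 2) \<Longrightarrow> progress c0 i j (plain_row c T)"
| in_rule: "(step ^^ i) c0 (l @ us @ x # r) \<Longrightarrow> (us @ us', vs @ vs') \<in> set P \<Longrightarrow> length us = length vs \<Longrightarrow>
    T1 @ e # T2 = T \<Longrightarrow> e # T2 = map Some (zip us' vs') @ None # Q \<Longrightarrow> j \<le> i * (m + 2) + 1 + length us \<Longrightarrow>
    progress c0 i j (cursor_row (l @ vs) x r T1 e T2)"

lemma progress_step:
  assumes "progress c0 i j v" "universal.transduce v w" "Out \<notin> set w" "c0 \<noteq> []"
  shows "\<exists>i'. progress c0 i' (Suc j) w"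
  using assms(1)
proof cases
  case (at_rest c)
  have "c \<noteq> []" using rewrite_length[OF at_rest(2)] assms(4) by auto
  from transduce_plain[OF assms(2)[unfolded at_rest(1)] assms(3) this] obtain l x r T1 e T2 where
    c: "c = l @ x # r" and T: "T = T1 @ None # Some e # T2" and w: "w = cursor_row l x r (T1 @ [None]) (Some e) T2" .
  from rule_table_split[OF T] obtain u u' Q where u: "(u, u') \<in> set P" "Some e # T2 = map Some (zip u u') @ None # Q" .
  have "progress c0 i (Suc j) (cursor_row (l @ []) x r (T1 @ [None]) (Some e) T2)"
    by (rule in_rule[of i c0 l "[]" x r u "[]" u' "T1 @ [None]" "Some e" T2 Q]) (use at_rest c T u in simp_all)
  then show ?thesis using w by auto
next
  case (in_rule l us x r us' vs vs' T1 e T2 Q)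
  have len: "length us' = length vs'" "length us \<le> m" using P[OF in_rule(3)] in_rule(4) by simp_all
  from transduce_cursor[OF assms(2)[unfolded in_rule(1)] assms(3)] show ?thesis
  proof (elim disjE exE conjE)
    fix v' x' r' e' T2'
    assume 1: "e = Some (x, v')" "r = x' # r'" "T2 = e' # T2'" "w = cursor_row ((l @ vs) @ [v']) x' r' (T1 @ [e]) e' T2'"
    obtain us'' vs'' where us: "us' = x # us''" "vs' = v' # vs''"
      using in_rule(6) 1(1) len(1) by (cases us'; cases vs') auto
    have "progress c0 i (Suc j) (cursor_row (l @ vs @ [v']) x' r' (T1 @ [e]) e' T2')"
      by (rule progress.in_rule[of i c0 l "us @ [x]" x' r' us'' "vs @ [v']" vs'' "T1 @ [e]" e' T2' Q])
        (use in_rule 1 us in simp_all)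
    then show ?thesis using 1(4) by auto
  next
    assume 1: "e = None" "w = plain_row ((l @ vs) @ x # r) (T1 @ e # T2)"
    then have us: "us' = []" "vs' = []" using in_rule(6) len(1) by (cases us'; cases vs'; auto)+
    have "step (l @ us @ x # r) (l @ vs @ x # r)"
      using in_rule(3) us unfolding rewrite_def
      by (intro exI[of _ us] exI[of _ vs] exI[of _ l] exI[of _ "x # r"]) simp
    then have "(step ^^ Suc i) c0 (l @ vs @ x # r)" using in_rule(2) by auto
    moreover have "Suc j \<le> Suc i * (m + 2)" using in_rule(7) len(2) by simp
    ultimately have "progress c0 (Suc i) (Suc j) (plain_row (l @ vs @ x # r) T)" by (rule at_rest)
    then show ?thesis using 1 in_rule(5) by auto
  qed
qed

lemma rewrite_of_transduce:
  assumes "(universal.transduce ^^ k) (plain_row c0 T) (replicate N Out)" "c0 \<noteq> []"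
  shows "\<exists>i c. (step ^^ i) c0 c \<and> k \<le> (i + 1) * (m + 2)"
proof (cases k)
  case 0
  show ?thesis by (intro exI[of _ 0] exI[of _ c0]) (simp add: 0)
next
  case (Suc j)
  have run: "\<exists>i. progress c0 i j v" if "(universal.transduce ^^ j) (plain_row c0 T) v" "Out \<notin> set v" for j v
    using that
  proof (induction j arbitrary: v)
    case 0
    then show ?case by (auto intro!: exI[of _ 0] at_rest)
  next
    case (Suc j)
    then obtain u where u: "(universal.transduce ^^ j) (plain_row c0 T) u" "universal.transduce u v" by auto
    from Suc.IH[OF u(1) no_transduce_Out[OF u(2)]] obtain i where "progress c0 i j u" by blast
    from progress_step[OF this u(2) Suc.prems(2) assms(2)] show ?case .
  qed
  from assms(1) Suc obtain v where v: "(universal.transduce ^^ j) (plain_row c0 T) v" "universal.transduce v (replicate N Out)" by auto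
  from run[OF v(1) no_transduce_Out[OF v(2)]] obtain i where "progress c0 i j v" by blast
  then show ?thesis
  proof cases
    case (at_rest c)
    then show ?thesis using Suc by (intro exI[of _ i] exI[of _ c]) simp
  next
    case (in_rule l us x r us' vs vs' T1 e T2 Q)
    have "length us \<le> m" using P[OF in_rule(3)] by simp
    then show ?thesis using Suc in_rule(2,7) by (intro exI[of _ i] exI[of _ "l @ us @ x # r"]) simp
  qed
qed

lemma ternary_rule_table: "ternary_table T"
proof -
  have "ternary (entry False e)" if e: "e \<in> set T" for e
  proof (cases e)
    case (Some p)
    then obtain u v where uv: "(u, v) \<in> set P" "p \<in> set (zip u v)" using e by (auto simp: rule_table_def)
    then show ?thesis using P[OF uv(1)] Some by (cases p) (auto dest: set_zip_leftD set_zip_rightD)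
  qed simp
  then show ?thesis by (simp add: ternary_table_def)
qed

lemma rule_table_member:
  assumes "(u, v) \<in> set P"
  obtains A B where "T = A @ None # map Some (zip u v) @ None # B"
proof -
  obtain P1 P2 where p: "P = P1 @ (u, v) # P2" using assms by (auto dest: split_list)
  have "\<exists>A. None # concat (map (\<lambda>(u, v). map Some (zip u v) @ [None]) P1) = A @ [None]"
    by (induction P1 rule: rev_induct) auto
  then obtain A where "None # concat (map (\<lambda>(u, v). map Some (zip u v) @ [None]) P1) = A @ [None]" by blast
  then have "T = (A @ [None]) @ map Some (zip u v) @ None # concat (map (\<lambda>(u, v). map Some (zip u v) @ [None]) P2)"
    by (simp add: rule_table_def p)
  then show thesis using that by simp
qed

lemma transduce_advances:
  assumes "length us = length vs" "set (l @ us @ x # r) \<subseteq> {..<3}" "set vs \<subseteq> {..<3}"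
    "ternary_table (T1 @ map Some (zip us vs) @ None # B)"
  shows "(universal.transduce ^^ length us)
    (cursor_row l (hd (us @ [x])) (tl (us @ x # r)) T1 (hd (map Some (zip us vs) @ [None])) (tl (map Some (zip us vs) @ None # B)))
    (cursor_row (l @ vs) x r (T1 @ map Some (zip us vs)) None B)"
  using assms
proof (induction us vs arbitrary: l T1 rule: list_induct2)
  case (Cons a us b vs)
  obtain y ys where y: "us @ x # r = y # ys" "hd (us @ [x]) = y" "ys = tl (us @ x # r)" by (cases us) auto
  obtain e E where e: "map Some (zip us vs) @ None # B = e # E" "hd (map Some (zip us vs) @ [None]) = e"
    "E = tl (map Some (zip us vs) @ None # B)" by (cases "zip us vs") auto
  have "universal.transduce (cursor_row l a (y # ys) T1 (Some (a, b)) (e # E)) (cursor_row (l @ [b]) y ys (T1 @ [Some (a, b)]) e E)"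
    by (rule transduce_advance) (use Cons.prems y(1) e(1) in \<open>auto simp: ternary_table_def\<close>)
  moreover have "(universal.transduce ^^ length us) (cursor_row (l @ [b]) y ys (T1 @ [Some (a, b)]) e E)
     (cursor_row ((l @ [b]) @ vs) x r ((T1 @ [Some (a, b)]) @ map Some (zip us vs)) None B)"
    unfolding y(2)[symmetric] y(3) e(2)[symmetric] e(3)
    by (rule Cons.IH) (use Cons.prems in \<open>auto simp: ternary_table_def\<close>)
  ultimately have "(universal.transduce ^^ Suc (length us)) (cursor_row l a (y # ys) T1 (Some (a, b)) (e # E))
     (cursor_row ((l @ [b]) @ vs) x r ((T1 @ [Some (a, b)]) @ map Some (zip us vs)) None B)"
    by (rule relpowp_Suc_I2)
  then show ?case by (simp add: y(1) e(1) del: relpowp.simps)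
qed simp

lemma transduce_rule:
  assumes "(u, v) \<in> set P" "set (l @ u @ x # r) \<subseteq> {..<3}"
  shows "(universal.transduce ^^ (length u + 2)) (plain_row (l @ u @ x # r) T) (plain_row (l @ v @ x # r) T)"
proof -
  note uv = P[OF assms(1)]
  obtain A B where T: "T = A @ None # map Some (zip u v) @ None # B" using rule_table_member[OF assms(1)] .
  obtain y us where u: "u = y # us" using uv by (cases u) auto
  obtain b vs where v: "v = b # vs" using uv u by (cases v) auto
  have "universal.transduce (plain_row (l @ y # (us @ x # r)) (A @ None # Some (y, b) # (map Some (zip us vs) @ None # B)))
    (cursor_row l y (us @ x # r) (A @ [None]) (Some (y, b)) (map Some (zip us vs) @ None # B))"
    by (rule transduce_start) (use assms(2) ternary_rule_table T u v in auto)
  then have 1: "universal.transduce (plain_row (l @ u @ x # r) T)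
    (cursor_row l y (us @ x # r) (A @ [None]) (Some (y, b)) (map Some (zip us vs) @ None # B))"
    by (simp add: T u v)
  have 2: "(universal.transduce ^^ length u) (cursor_row l y (us @ x # r) (A @ [None]) (Some (y, b)) (map Some (zip us vs) @ None # B))
    (cursor_row (l @ v) x r ((A @ [None]) @ map Some (zip u v)) None B)"
    using transduce_advances[of u v l x r "A @ [None]" B] uv assms(2) ternary_rule_table T
    by (simp add: u v del: relpowp.simps)
  have "universal.transduce (cursor_row (l @ v) x r ((A @ [None]) @ map Some (zip u v)) None B)
    (plain_row ((l @ v) @ x # r) (((A @ [None]) @ map Some (zip u v)) @ None # B))"
    by (rule transduce_finish) (use assms(2) uv ternary_rule_table T in \<open>auto\<close>)
  then have 3: "universal.transduce (cursor_row (l @ v) x r ((A @ [None]) @ map Some (zip u v)) None B) (plain_row (l @ v @ x # r) T)"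
    by (simp add: T)
  from relpowp_Suc_I[OF relpowp_Suc_I2[of "universal.transduce", OF 1 2] 3] show ?thesis by simp
qed

definition inner_step :: "nat list \<Rightarrow> nat list \<Rightarrow> bool" where
  "inner_step w w' \<longleftrightarrow> (\<exists>u v l x r. (u, v) \<in> set P \<and> w = l @ u @ x # r \<and> w' = l @ v @ x # r)"

lemma transduce_inner_steps:
  assumes "(inner_step ^^ i) c d" "set c \<subseteq> {..<3}"
  shows "set d \<subseteq> {..<3} \<and> (\<exists>n \<ge> 2 * i. (universal.transduce ^^ n) (plain_row c T) (plain_row d T))"
  using assms(1)
proof (induction i arbitrary: d)
  case 0
  then show ?case using assms(2) by (auto intro!: exI[of _ 0])
next
  case (Suc i)
  then obtain b where b: "(inner_step ^^ i) c b" "inner_step b d" by auto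
  from Suc.IH[OF b(1)] obtain n where n: "set b \<subseteq> {..<3}" "n \<ge> 2 * i" "(universal.transduce ^^ n) (plain_row c T) (plain_row b T)" by blast
  from b(2) obtain u v l x r where uv: "(u, v) \<in> set P" "b = l @ u @ x # r" "d = l @ v @ x # r" by (auto simp: inner_step_def)
  have "(universal.transduce ^^ (length u + 2)) (plain_row b T) (plain_row d T)"
    using transduce_rule[OF uv(1)] n(1) uv(2,3) by blast
  with n(3) have "(universal.transduce ^^ (n + (length u + 2))) (plain_row c T) (plain_row d T)"
    unfolding relpowp_add by blast
  moreover have "set d \<subseteq> {..<3}" using n(1) uv P[OF uv(1)] by auto
  ultimately show ?case using n(2) by (intro conjI exI[of _ "n + (length u + 2)"]) auto
qed

lemma transduce_length: "(universal.transduce ^^ i) v w \<Longrightarrow> length w = length v"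
proof (induction i arbitrary: w)
  case (Suc i)
  then obtain u where u: "(universal.transduce ^^ i) v u" "universal.transduce u w" by auto
  then show ?case using Suc.IH[OF u(1)] by (auto simp: universal.transduce_def dest: universal.sweep_length)
qed simp

lemma transduce_of_rewrite:
  assumes "(inner_step ^^ k) c d" "set c \<subseteq> {..<3}" "c \<noteq> []" "k > 0"
  shows "(universal.transduce ^^ k) (plain_row c T) (replicate (length (plain_row c T)) Out)"
proof -
  obtain n where n: "n \<ge> 2 * k" "(universal.transduce ^^ n) (plain_row c T) (plain_row d T)"
    using transduce_inner_steps[OF assms(1,2)] by blast
  have "n = (k - 1) + Suc (n - k)" using n(1) assms(4) by simp
  with n(2) have "(universal.transduce ^^ ((k - 1) + Suc (n - k))) (plain_row c T) (plain_row d T)" by metis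
  then obtain v where v: "(universal.transduce ^^ (k - 1)) (plain_row c T) v" "(universal.transduce ^^ Suc (n - k)) v (plain_row d T)"
    unfolding relpowp_add by blast
  from v(2) obtain w where w: "universal.transduce v w" by (rule relpowp_Suc_E2)
  have len: "length v = length (plain_row c T)" by (rule transduce_length[OF v(1)])
  moreover have "plain_row c T \<noteq> []" using assms(3) by (simp add: plain_row_def)
  ultimately have "v \<noteq> []" by (metis length_0_conv)
  from relpowp_Suc_I[OF v(1) transduce_erase[OF w this]] show ?thesis
    using assms(4) len by simp
qed

end

section \<open>Block codes\<close>

definition code :: "nat \<Rightarrow> nat \<Rightarrow> nat list" where
  "code c s = 2 # replicate s 1 @ replicate (c - 1 - s) 0"

definition encode :: "nat \<Rightarrow> nat list \<Rightarrow> nat list" where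
  "encode c w = concat (map (code c) w)"

lemma encode_simps [simp]: "encode c [] = []" "encode c (s # w) = code c s @ encode c w" "encode c (u @ v) = encode c u @ encode c v"
  by (simp_all add: encode_def)

lemma length_code: "s < c \<Longrightarrow> length (code c s) = c"
  by (simp add: code_def)

lemma set_encode: "set (encode c w) \<subseteq> {..<3}"
  by (auto simp: encode_def code_def)

lemma length_encode: "set w \<subseteq> {..<c} \<Longrightarrow> length (encode c w) = c * length w"
  by (induction w) (auto simp: length_code)

lemma code_inj: "code c s = code c s' \<Longrightarrow> s < c \<Longrightarrow> s' < c \<Longrightarrow> s = s'"
proof -
  assume "code c s = code c s'" "s < c" "s' < c"
  then have "sum_list (code c s) = sum_list (code c s')" by simp
  then show "s = s'" by (simp add: code_def sum_list_replicate)
qed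

lemma encode_prefix:
  assumes "encode c w = encode c u @ r" "set w \<subseteq> {..<c}" "set u \<subseteq> {..<c}"
  shows "\<exists>w'. w = u @ w' \<and> r = encode c w'"
  using assms
proof (induction u arbitrary: w)
  case (Cons s u)
  have "encode c w \<noteq> []" using Cons.prems(1) by (auto simp: code_def)
  then obtain s' w1 where w: "w = s' # w1" by (cases w) auto
  have "code c s' = code c s \<and> encode c w1 = encode c u @ r"
    using Cons.prems w length_code[of s c] length_code[of s' c] by (auto simp: append_eq_append_conv)
  then show ?case using Cons.IH[of w1] Cons.prems code_inj[of c s' s] w by auto
qed auto

lemma encode_infix:
  assumes "encode c w = l @ encode c u @ r" "set w \<subseteq> {..<c}" "set u \<subseteq> {..<c}" "u \<noteq> []"
  shows "\<exists>wl wr. w = wl @ u @ wr \<and> l = encode c wl \<and> r = encode c wr"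
  using assms(1,2)
proof (induction w arbitrary: l)
  case Nil
  then show ?case using assms(4) by (cases u) (auto simp: code_def)
next
  case (Cons s w)
  show ?case
  proof (cases "l = []")
    case True
    then obtain w' where "s # w = u @ w'" "r = encode c w'" using encode_prefix[of c "s # w" u r] Cons.prems assms(3) by auto
    then show ?thesis using True by (intro exI[of _ "[]"] exI[of _ w']) simp
  next
    case False
    have s: "length (code c s) = c" using Cons.prems(2) by (simp add: length_code)
    have "c \<le> length l"
    proof (rule ccontr)
      assume "\<not> c \<le> length l"
      then have lt: "length l < c" by simp
      obtain z zs where u: "u = z # zs" using assms(4) by (cases u) auto
      have "(l @ encode c u @ r) ! length l = 2" by (simp add: u code_def nth_append)
      moreover have "encode c (s # w) ! length l = code c s ! length l" using lt s by (simp add: nth_append)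
      moreover have "code c s ! length l \<in> set (replicate s 1 @ replicate (c - 1 - s) 0)"
      proof -
        obtain n where n: "length l = Suc n" using False by (cases "length l") auto
        have "code c s ! length l = (replicate s 1 @ replicate (c - 1 - s) 0) ! n" unfolding code_def n by simp
        moreover have "n < length (replicate s (1 :: nat) @ replicate (c - 1 - s) 0)" using lt s n by (simp add: code_def)
        ultimately show ?thesis by (metis nth_mem)
      qed
      ultimately show False using Cons.prems(1) by auto
    qed
    then obtain l' where l: "l = code c s @ l'" "encode c w = l' @ encode c u @ r"
    proof -
      have "code c s @ encode c w = take c l @ (drop c l @ encode c u @ r)"
        using Cons.prems(1) by (simp flip: append_assoc)
      moreover have "length (code c s) = length (take c l)" using s \<open>c \<le> length l\<close> by simp
      ultimately have "code c s = take c l" "encode c w = drop c l @ encode c u @ r" by simp_all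
      then show thesis using that[of "drop c l"] by simp
    qed
    from Cons.IH[OF l(2)] Cons.prems(2) obtain wl wr where "w = wl @ u @ wr" "l' = encode c wl" "r = encode c wr" by auto
    then show ?thesis using l(1) by (intro exI[of _ "s # wl"] exI[of _ wr]) simp
  qed
qed

lemma rewrite_encode:
  assumes "rewrite (map_prod (encode c) (encode c) ` P) (encode c w) z" "set w \<subseteq> {..<c}"
    and "\<And>u v. (u, v) \<in> P \<Longrightarrow> u \<noteq> [] \<and> set u \<subseteq> {..<c} \<and> set v \<subseteq> {..<c}"
  shows "\<exists>w'. z = encode c w' \<and> rewrite P w w' \<and> set w' \<subseteq> {..<c}"
proof -
  obtain u v l r where uv: "(u, v) \<in> P" "encode c w = l @ encode c u @ r" "z = l @ encode c v @ r"
    using assms(1) by (auto simp: rewrite_def)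
  obtain wl wr where w: "w = wl @ u @ wr" "l = encode c wl" "r = encode c wr"
    using encode_infix[OF uv(2) assms(2)] assms(3)[OF uv(1)] by blast
  then show ?thesis using uv assms(2) assms(3)[OF uv(1)]
    by (intro exI[of _ "wl @ v @ wr"]) (auto simp: rewrite_def)
qed

section \<open>Turing machines as rewriting systems\<close>

type_synonym tm_symbol = "cell + nat"

definition machine_rules :: "turing_machine \<Rightarrow> cell set \<Rightarrow> (tm_symbol list \<times> tm_symbol list) set" where
  "machine_rules M A =
     (\<Union>((q, a), (q', b, mv)) \<in> instructions M. case mv of
        Move_Right \<Rightarrow> {([Inr q, Inl a], [Inl b, Inr q'])}
      | Stay \<Rightarrow> {([Inr q, Inl a], [Inr q', Inl b])}
      | Move_Left \<Rightarrow> (\<lambda>c. ([Inl c, Inr q, Inl a], [Inr q', Inl c, Inl b])) ` A) \<union>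
     (\<lambda>a. ([Inr (accept_state M), Inl a], [Inr (accept_state M), Inl a])) ` {a \<in> A. \<forall>r. ((accept_state M, a), r) \<notin> instructions M}"

lemma finite_machine_rules: "finite (instructions M) \<Longrightarrow> finite A \<Longrightarrow> finite (machine_rules M A)"
  unfolding machine_rules_def by (auto split: move.splits)

lemma machine_rulesI:
  "((q, a), (q', b, Move_Right)) \<in> instructions M \<Longrightarrow> ([Inr q, Inl a], [Inl b, Inr q']) \<in> machine_rules M A"
  "((q, a), (q', b, Stay)) \<in> instructions M \<Longrightarrow> ([Inr q, Inl a], [Inr q', Inl b]) \<in> machine_rules M A"
  "((q, a), (q', b, Move_Left)) \<in> instructions M \<Longrightarrow> c \<in> A \<Longrightarrow> ([Inl c, Inr q, Inl a], [Inr q', Inl c, Inl b]) \<in> machine_rules M A"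
  "a \<in> A \<Longrightarrow> (\<And>r. ((accept_state M, a), r) \<notin> instructions M) \<Longrightarrow>
     ([Inr (accept_state M), Inl a], [Inr (accept_state M), Inl a]) \<in> machine_rules M A"
  unfolding machine_rules_def
  by ((rule UnI1, erule UN_I, simp; fail), (rule UnI1, erule UN_I, simp; fail), (rule UnI1, erule UN_I, simp; fail), simp)

lemma machine_rulesE:
  assumes "(u, v) \<in> machine_rules M A"
  obtains (right) q a q' b where "((q, a), (q', b, Move_Right)) \<in> instructions M" "u = [Inr q, Inl a]" "v = [Inl b, Inr q']"
  | (stay) q a q' b where "((q, a), (q', b, Stay)) \<in> instructions M" "u = [Inr q, Inl a]" "v = [Inr q', Inl b]"
  | (left) q a q' b c where "((q, a), (q', b, Move_Left)) \<in> instructions M" "u = [Inl c, Inr q, Inl a]" "v = [Inr q', Inl c, Inl b]" "c \<in> A"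
  | (accept) a where "\<And>r. ((accept_state M, a), r) \<notin> instructions M" "u = [Inr (accept_state M), Inl a]" "v = [Inr (accept_state M), Inl a]" "a \<in> A"
proof -
  from assms[unfolded machine_rules_def] show thesis
  proof (elim UnE UN_E, goal_cases)
    case (1 i)
    obtain q a q' b mv where "i = ((q, a), (q', b, mv))" by (metis surj_pair)
    then show ?case using 1 right stay left by (cases mv) auto
  next
    case 2
    then show ?case using accept by blast
  qed
qed

definition config_word :: "cell list \<Rightarrow> nat \<Rightarrow> cell list \<Rightarrow> tm_symbol list" where
  "config_word xs q ys = map Inl xs @ Inr q # map Inl ys"

definition agrees :: "cell list \<Rightarrow> cell list \<Rightarrow> int \<Rightarrow> (int \<Rightarrow> cell) \<Rightarrow> bool" where
  "agrees xs ys h t \<longleftrightarrow> (\<forall>i < length xs. xs ! i = t (h - int (length xs) + int i)) \<and> (\<forall>i < length ys. ys ! i = t (h + int i))"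

lemma agrees_head: "agrees xs (a # ys) h t \<Longrightarrow> t h = a"
  by (force simp: agrees_def)

lemma agrees_stay: "agrees xs (a # ys) h t \<Longrightarrow> agrees xs (b # ys) h (t(h := b))"
  by (auto simp: agrees_def nth_Cons')

lemma agrees_right: "agrees xs (a # ys) h t \<Longrightarrow> agrees (xs @ [b]) ys (h + 1) (t(h := b))"
  unfolding agrees_def
proof (elim conjE, intro conjI allI impI)
  fix i assume a: "\<forall>i<length xs. xs ! i = t (h - int (length xs) + int i)" "i < length (xs @ [b])"
  then show "(xs @ [b]) ! i = (t(h := b)) (h + 1 - int (length (xs @ [b])) + int i)"
    by (cases "i = length xs") (auto simp: nth_append)
next
  fix i assume y: "\<forall>i<length (a # ys). (a # ys) ! i = t (h + int i)" and i: "i < length ys"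
  have "(a # ys) ! Suc i = t (h + int (Suc i))" using y[rule_format, of "Suc i"] i by simp
  then show "ys ! i = (t(h := b)) (h + 1 + int i)" by (simp add: algebra_simps)
qed

lemma agrees_left: "agrees (xs @ [c]) (a # ys) h t \<Longrightarrow> agrees xs (c # b # ys) (h - 1) (t(h := b))"
  unfolding agrees_def
proof (elim conjE, intro conjI allI impI)
  fix i assume "\<forall>i<length (xs @ [c]). (xs @ [c]) ! i = t (h - int (length (xs @ [c])) + int i)" "i < length xs"
  then have "(xs @ [c]) ! i = t (h - int (length (xs @ [c])) + int i)" by simp
  then show "xs ! i = (t(h := b)) (h - 1 - int (length xs) + int i)"
    using \<open>i < length xs\<close> by (simp add: nth_append algebra_simps)
next
  fix i assume x: "\<forall>i<length (xs @ [c]). (xs @ [c]) ! i = t (h - int (length (xs @ [c])) + int i)"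
    and y: "\<forall>i<length (a # ys). (a # ys) ! i = t (h + int i)" and i: "i < length (c # b # ys)"
  have c: "c = t (h - 1)" using x[rule_format, of "length xs"] by simp
  consider "i = 0" | "i = 1" | j where "i = Suc (Suc j)" by (cases i; cases "i - 1") auto
  then show "(c # b # ys) ! i = (t(h := b)) (h - 1 + int i)"
  proof cases
    case (3 j)
    have "(a # ys) ! Suc j = t (h + int (Suc j))" using y[rule_format, of "Suc j"] i 3 by simp
    then show ?thesis using 3 by (simp add: algebra_simps)
  qed (use c in auto)
qed

lemma config_word_infix:
  assumes "config_word xs q ys = l @ Inr p # z"
  shows "l = map Inl xs \<and> p = q \<and> z = map Inl ys"
proof -
  have no: "map Inl ys \<noteq> k @ Inr p # z" for k :: "tm_symbol list"
    by (auto dest!: arg_cong[where f = set])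
  show ?thesis
    using assms no unfolding config_word_def
    by (induction xs arbitrary: l) (auto simp: Cons_eq_append_conv append_eq_Cons_conv)
qed

definition represents :: "tm_symbol list \<Rightarrow> config \<Rightarrow> bool" where
  "represents w c \<longleftrightarrow> (case c of (q, h, t) \<Rightarrow> \<exists>xs ys. w = config_word xs q ys \<and> agrees xs ys h t)"

lemma representsI: "agrees xs ys h t \<Longrightarrow> w = config_word xs q ys \<Longrightarrow> represents w (q, h, t)"
  unfolding represents_def by auto

lemma rewrite_sound:
  assumes "represents w c" "rewrite (machine_rules M A) w w'"
  shows "(\<exists>d. tm_step M c d \<and> represents w' d) \<or> (fst c = accept_state M \<and> halted M c)"
proof -
  obtain q h t where c: "c = (q, h, t)" by (cases c)
  obtain xs ys where w: "w = config_word xs q ys" "agrees xs ys h t" using assms(1) c by (auto simp: represents_def)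
  obtain u v l r where uv: "(u, v) \<in> machine_rules M A" "w = l @ u @ r" "w' = l @ v @ r"
    using assms(2) by (auto simp: rewrite_def)
  from uv(1) show ?thesis
  proof (cases rule: machine_rulesE)
    case (right p a q' b)
    then have "config_word xs q ys = l @ Inr p # (Inl a # r)" using uv w by simp
    from config_word_infix[OF this] obtain ys' where e: "l = map Inl xs" "p = q" "ys = a # ys'" "r = map Inl ys'"
      by (cases ys) auto
    have "t h = a" using agrees_head w(2) e(3) by blast
    then have "tm_step M c (q', h + 1, t(h := b))" using right(1) e(2) by (auto simp: c tm_step_iff intro!: exI[of _ Move_Right])
    moreover have "represents w' (q', h + 1, t(h := b))"
      by (rule representsI[OF agrees_right[of xs a ys' h t b]]) (use w(2) e uv(3) right in \<open>auto simp: config_word_def\<close>)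
    ultimately show ?thesis by blast
  next
    case (stay p a q' b)
    then have "config_word xs q ys = l @ Inr p # (Inl a # r)" using uv w by simp
    from config_word_infix[OF this] obtain ys' where e: "l = map Inl xs" "p = q" "ys = a # ys'" "r = map Inl ys'"
      by (cases ys) auto
    have "t h = a" using agrees_head w(2) e(3) by blast
    then have "tm_step M c (q', h, t(h := b))" using stay(1) e(2) by (auto simp: c tm_step_iff intro!: exI[of _ Stay])
    moreover have "represents w' (q', h, t(h := b))"
      by (rule representsI[OF agrees_stay[of xs a ys' h t b]]) (use w(2) e uv(3) stay in \<open>auto simp: config_word_def\<close>)
    ultimately show ?thesis by blast
  next
    case (left p a q' b d)
    then have "config_word xs q ys = (l @ [Inl d]) @ Inr p # (Inl a # r)" using uv w by simp
    from config_word_infix[OF this] obtain xs' ys' where e: "xs = xs' @ [d]" "l = map Inl xs'" "p = q" "ys = a # ys'" "r = map Inl ys'"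
      by (cases ys; cases xs rule: rev_cases) auto
    have "t h = a" using agrees_head w(2) e(4) by blast
    then have "tm_step M c (q', h - 1, t(h := b))" using left(1) e(3) by (auto simp: c tm_step_iff intro!: exI[of _ Move_Left])
    moreover have "represents w' (q', h - 1, t(h := b))"
      by (rule representsI[OF agrees_left[of xs' d a ys' h t b]]) (use w(2) e uv(3) left in \<open>auto simp: config_word_def\<close>)
    ultimately show ?thesis by blast
  next
    case (accept a)
    then have "config_word xs q ys = l @ Inr (accept_state M) # (Inl a # r)" using uv w by simp
    from config_word_infix[OF this] obtain ys' where e: "accept_state M = q" "ys = a # ys'" by (cases ys) auto
    have "t h = a" using agrees_head w(2) e(2) by blast
    then show ?thesis using accept(1) e(1) by (auto simp: c halted_def tm_step_iff)
  qed
qed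

lemma rewrites_sound:
  assumes "(rewrite (machine_rules M A) ^^ i) w w'" "represents w c"
  shows "(\<exists>d. (tm_step M ^^ i) c d) \<or> (\<exists>d. (tm_step M)\<^sup>*\<^sup>* c d \<and> fst d = accept_state M \<and> halted M d)"
  using assms
proof (induction i arbitrary: w c)
  case (Suc i)
  obtain v where v: "rewrite (machine_rules M A) w v" "(rewrite (machine_rules M A) ^^ i) v w'"
    using Suc.prems(1) by (rule relpowp_Suc_E2)
  from rewrite_sound[OF Suc.prems(2) v(1)] show ?case
  proof (elim disjE exE conjE)
    fix d assume d: "tm_step M c d" "represents v d"
    from Suc.IH[OF v(2) d(2)] show ?thesis
    proof (elim disjE exE conjE)
      fix e assume "(tm_step M ^^ i) d e"
      with d(1) have "(tm_step M ^^ Suc i) c e" by (rule relpowp_Suc_I2)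
      then show ?thesis by blast
    next
      fix e assume "(tm_step M)\<^sup>*\<^sup>* d e" "fst e = accept_state M" "halted M e"
      then show ?thesis using converse_rtranclp_into_rtranclp[of "tm_step M", OF d(1)] by blast
    qed
  qed blast
qed auto

definition inner_rewrite :: "('a list \<times> 'a list) set \<Rightarrow> 'a list \<Rightarrow> 'a list \<Rightarrow> bool" where
  "inner_rewrite P w w' \<longleftrightarrow> (\<exists>u v l x r. (u, v) \<in> P \<and> w = l @ u @ x # r \<and> w' = l @ v @ x # r)"

lemma inner_rewriteI: "(u, v) \<in> P \<Longrightarrow> w = l @ u @ x # r \<Longrightarrow> w' = l @ v @ x # r \<Longrightarrow> inner_rewrite P w w'"
  unfolding inner_rewrite_def by blast

lemma step_complete:
  assumes "tm_step M (q, h, t) (q', h', t')" "agrees xs ys h t" "xs \<noteq> []" "length ys \<ge> 2" "set (xs @ ys) \<subseteq> A"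
    and A: "\<forall>i \<in> instructions M. fst (snd (snd i)) \<in> A"
  shows "\<exists>xs' ys'. inner_rewrite (machine_rules M A) (config_word xs q ys) (config_word xs' q' ys') \<and> agrees xs' ys' h' t' \<and>
    length xs \<le> length xs' + 1 \<and> length ys \<le> length ys' + 1 \<and> set (xs' @ ys') \<subseteq> A"
proof -
  obtain b m where i: "((q, t h), (q', b, m)) \<in> instructions M" and d: "h' = h + offset m" "t' = t(h := b)"
    using assms(1) by (auto simp: tm_step_iff)
  obtain a y ys' where ys: "ys = a # y # ys'" using assms(4) by (cases ys rule: list.exhaust; cases "tl ys") auto
  have a: "t h = a" using agrees_head assms(2) ys by blast
  have bA: "b \<in> A" using bspec[OF A i] by simp
  show ?thesis
  proof (cases m)
    case Move_Right
    show ?thesis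
    proof (intro exI conjI)
      show "inner_rewrite (machine_rules M A) (config_word xs q ys) (config_word (xs @ [b]) q' (y # ys'))"
        by (rule inner_rewriteI[OF machine_rulesI(1)[of q a q' b M], of _ "map Inl xs" "Inl y" "map Inl ys'"])
          (use i a Move_Right ys in \<open>auto simp: config_word_def\<close>)
      show "agrees (xs @ [b]) (y # ys') h' t'" using agrees_right[of xs a "y # ys'" h t b] assms(2) ys d Move_Right by simp
    qed (use assms(5) bA ys in auto)
  next
    case Stay
    show ?thesis
    proof (intro exI conjI)
      show "inner_rewrite (machine_rules M A) (config_word xs q ys) (config_word xs q' (b # y # ys'))"
        by (rule inner_rewriteI[OF machine_rulesI(2)[of q a q' b M], of _ "map Inl xs" "Inl y" "map Inl ys'"])
          (use i a Stay ys in \<open>auto simp: config_word_def\<close>)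
      show "agrees xs (b # y # ys') h' t'" using agrees_stay[of xs a "y # ys'" h t b] assms(2) ys d Stay by simp
    qed (use assms(5) bA ys in auto)
  next
    case Move_Left
    obtain xs' c where xs: "xs = xs' @ [c]" using assms(3) by (cases xs rule: rev_cases) auto
    show ?thesis
    proof (intro exI conjI)
      show "inner_rewrite (machine_rules M A) (config_word xs q ys) (config_word xs' q' (c # b # y # ys'))"
        by (rule inner_rewriteI[OF machine_rulesI(3)[of q a q' b M c A], of _ "map Inl xs'" "Inl y" "map Inl ys'"])
          (use i a Move_Left ys xs assms(5) in \<open>auto simp: config_word_def\<close>)
      show "agrees xs' (c # b # y # ys') h' t'" using agrees_left[of xs' c a "y # ys'" h t b] assms(2) ys xs d Move_Left by simp
    qed (use assms(5) bA ys xs in auto)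
  qed
qed

lemma steps_complete:
  assumes "(tm_step M ^^ i) (q, h, t) (q', h', t')" "agrees xs ys h t" "length xs \<ge> i + 2" "length ys \<ge> i + 2" "set (xs @ ys) \<subseteq> A"
    and A: "\<forall>i \<in> instructions M. fst (snd (snd i)) \<in> A"
  shows "\<exists>xs' ys'. (inner_rewrite (machine_rules M A) ^^ i) (config_word xs q ys) (config_word xs' q' ys') \<and> agrees xs' ys' h' t' \<and>
    length ys' \<ge> 2 \<and> set (xs' @ ys') \<subseteq> A"
  using assms(1-5)
proof (induction i arbitrary: q h t xs ys)
  case 0
  then show ?case by (intro exI[of _ xs] exI[of _ ys]) auto
next
  case (Suc i)
  obtain d where d: "tm_step M (q, h, t) d" "(tm_step M ^^ i) d (q', h', t')" using Suc.prems(1) by (rule relpowp_Suc_E2)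
  obtain p g s where ds: "d = (p, g, s)" by (cases d)
  have "xs \<noteq> []" "length ys \<ge> 2" using Suc.prems(3,4) by auto
  from step_complete[OF d(1)[unfolded ds] Suc.prems(2) this Suc.prems(5) A] obtain xs' ys' where
    1: "inner_rewrite (machine_rules M A) (config_word xs q ys) (config_word xs' p ys')" "agrees xs' ys' g s"
    "length xs \<le> length xs' + 1" "length ys \<le> length ys' + 1" "set (xs' @ ys') \<subseteq> A" by blast
  have "length xs' \<ge> i + 2" "length ys' \<ge> i + 2" using 1(3,4) Suc.prems(3,4) by auto
  from Suc.IH[OF d(2)[unfolded ds] 1(2) this 1(5)] 1(1) show ?case by (blast intro: relpowp_Suc_I2)
qed

definition rule_index :: "turing_machine \<Rightarrow> cell set \<Rightarrow> nat" where
  "rule_index M A = Suc (Max (insert (to_nat (Inr (start_state M) :: tm_symbol))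
     (to_nat ` (Inl ` A \<union> (\<Union>(u, v) \<in> machine_rules M A. set u \<union> set v)))))"

locale simulated_tm =
  fixes M :: turing_machine and A :: "cell set"
  assumes finite_M: "finite (instructions M)" and finite_A: "finite A" and blank: "None \<in> A"
    and written: "\<forall>i \<in> instructions M. fst (snd (snd i)) \<in> A"
begin

abbreviation "c \<equiv> rule_index M A"

definition coded_word :: "tm_symbol list \<Rightarrow> nat list" where
  "coded_word w = encode c (map to_nat w)"

definition coded_rules :: "(nat list \<times> nat list) list" where
  "coded_rules = (SOME P. set P = map_prod coded_word coded_word ` machine_rules M A)"

lemma set_coded_rules: "set coded_rules = map_prod coded_word coded_word ` machine_rules M A"
  unfolding coded_rules_def
  by (rule someI_ex, rule finite_list) (simp add: finite_machine_rules finite_M finite_A)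

lemma index_less: "x \<in> Inl ` A \<or> (\<exists>u v. (u, v) \<in> machine_rules M A \<and> x \<in> set u \<union> set v) \<or> x = Inr (start_state M) \<Longrightarrow> to_nat x < c"
proof -
  have fin: "finite (insert (to_nat (Inr (start_state M) :: tm_symbol))
     (to_nat ` (Inl ` A \<union> (\<Union>(u, v) \<in> machine_rules M A. set u \<union> set v))))"
    using finite_machine_rules[OF finite_M finite_A] finite_A by auto
  assume "x \<in> Inl ` A \<or> (\<exists>u v. (u, v) \<in> machine_rules M A \<and> x \<in> set u \<union> set v) \<or> x = Inr (start_state M)"
  then have "to_nat x \<in> insert (to_nat (Inr (start_state M) :: tm_symbol))
     (to_nat ` (Inl ` A \<union> (\<Union>(u, v) \<in> machine_rules M A. set u \<union> set v)))" by blast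
  then show ?thesis unfolding rule_index_def using Max_ge[OF fin] by (simp add: less_Suc_eq_le)
qed

lemma rule_letters: "(u, v) \<in> machine_rules M A \<Longrightarrow> set (map to_nat u) \<subseteq> {..<c} \<and> set (map to_nat v) \<subseteq> {..<c}"
proof -
  assume r: "(u, v) \<in> machine_rules M A"
  have "to_nat x < c" if "x \<in> set u \<union> set v" for x
    by (rule index_less) (use r that in blast)
  then show ?thesis by auto
qed

sublocale rule_list coded_rules "3 * c"
proof
  fix u v assume "(u, v) \<in> set coded_rules"
  then obtain u' v' where uv: "(u', v') \<in> machine_rules M A" "u = coded_word u'" "v = coded_word v'"
    by (auto simp: set_coded_rules)
  have "u' \<noteq> [] \<and> length u' = length v' \<and> length u' \<le> 3"
    using uv(1) by (cases rule: machine_rulesE) auto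
  moreover have "length u = c * length u'" "length v = c * length v'"
    using length_encode rule_letters[OF uv(1)] uv(2,3) by (auto simp: coded_word_def)
  moreover have "c > 0" by (simp add: rule_index_def)
  ultimately show "u \<noteq> [] \<and> length u = length v \<and> length u \<le> 3 * c \<and> set u \<subseteq> {..<3} \<and> set v \<subseteq> {..<3}"
    using set_encode uv(2,3) by (auto simp: coded_word_def)
qed

definition start_word :: "nat \<Rightarrow> nat list \<Rightarrow> tm_symbol list" where
  "start_word W x = config_word (replicate W None) (start_state M) (map Some x @ replicate W None)"

lemma start_agrees: "agrees (replicate W None) (map Some x @ replicate W None) 0 (tape_of x)"
  by (auto simp: agrees_def tape_of_def nth_append)

lemma start_represents: "represents (start_word W x) (initial_config M x)"
  using start_agrees by (auto simp: represents_def initial_config_def start_word_def)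

lemma start_letters: "Some ` set x \<subseteq> A \<Longrightarrow> set (map to_nat (start_word W x)) \<subseteq> {..<c}"
proof -
  assume x: "Some ` set x \<subseteq> A"
  have "to_nat y < c" if y: "y \<in> set (start_word W x)" for y
  proof (rule index_less)
    show "y \<in> Inl ` A \<or> (\<exists>u v. (u, v) \<in> machine_rules M A \<and> y \<in> set u \<union> set v) \<or> y = Inr (start_state M)"
      using y x blank by (auto simp: start_word_def config_word_def split: if_splits)
  qed
  then show ?thesis by auto
qed
lemma steps_decode:
  assumes "(step ^^ i) (coded_word w) z" "set (map to_nat w) \<subseteq> {..<c}"
  shows "\<exists>w'. (rewrite (machine_rules M A) ^^ i) w w'"
proof -
  have "\<exists>w'. z = coded_word w' \<and> (rewrite (machine_rules M A) ^^ i) w w' \<and> set (map to_nat w') \<subseteq> {..<c}"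
    using assms(1)
  proof (induction i arbitrary: z)
    case 0
    then show ?case using assms(2) by auto
  next
    case (Suc i)
    then obtain y where y: "(step ^^ i) (coded_word w) y" "step y z" by auto
    from Suc.IH[OF y(1)] obtain w1 where w1: "y = coded_word w1" "(rewrite (machine_rules M A) ^^ i) w w1" "set (map to_nat w1) \<subseteq> {..<c}"
      by blast
    have "rewrite (map_prod (encode c) (encode c) ` (map_prod (map to_nat) (map to_nat) ` machine_rules M A)) (encode c (map to_nat w1)) z"
      using y(2) w1(1) by (simp add: set_coded_rules coded_word_def image_image map_prod_def split_beta)
    from rewrite_encode[OF this w1(3)] obtain w2 where
      w2: "z = encode c w2" "rewrite (map_prod (map to_nat) (map to_nat) ` machine_rules M A) (map to_nat w1) w2" "set w2 \<subseteq> {..<c}"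
      using rule_letters by (fastforce elim: machine_rulesE)
    from w2(2) obtain u v l r where uv: "(u, v) \<in> machine_rules M A" "map to_nat w1 = l @ map to_nat u @ r" "w2 = l @ map to_nat v @ r"
      by (auto simp: rewrite_def)
    obtain l' u' r' where lr: "w1 = l' @ u' @ r'" "l = map to_nat l'" "map to_nat u' = map to_nat u" "r = map to_nat r'"
    proof -
      obtain l' s' where 1: "w1 = l' @ s'" "map to_nat l' = l" "map to_nat s' = map to_nat u @ r"
        using iffD1[OF map_eq_append_conv uv(2)] by (elim exE conjE) simp
      obtain u' r' where "s' = u' @ r'" "map to_nat u' = map to_nat u" "map to_nat r' = r"
        using iffD1[OF map_eq_append_conv 1(3)] by (elim exE conjE) simp
      then show thesis using that[of l' u' r'] 1(1,2) by simp
    qed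
    have "u' = u" using lr(3) by (simp add: inj_map_eq_map)
    then have "rewrite (machine_rules M A) w1 (l' @ v @ r')" using uv(1) lr(1) by (auto simp: rewrite_def)
    moreover have "z = coded_word (l' @ v @ r')" using w2(1) uv(3) lr by (simp add: coded_word_def)
    moreover have "set (map to_nat (l' @ v @ r')) \<subseteq> {..<c}" using w2(3) uv(3) lr by simp
    ultimately show ?case using w1(2) by (intro exI[of _ "l' @ v @ r'"]) auto
  qed
  then show ?thesis by blast
qed

lemma steps_encode: "(inner_rewrite (machine_rules M A) ^^ i) w w' \<Longrightarrow> (inner_step ^^ i) (coded_word w) (coded_word w')"
proof (induction i arbitrary: w')
  case (Suc i)
  then obtain y where y: "(inner_rewrite (machine_rules M A) ^^ i) w y" "inner_rewrite (machine_rules M A) y w'" by auto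
  from y(2) obtain u v l x r where uv: "(u, v) \<in> machine_rules M A" "y = l @ u @ x # r" "w' = l @ v @ x # r"
    by (auto simp: inner_rewrite_def)
  obtain z zs where z: "code c (to_nat x) = z # zs" by (auto simp: code_def)
  have "(coded_word u, coded_word v) \<in> set coded_rules" using uv(1) by (force simp: set_coded_rules)
  then have "inner_step (coded_word y) (coded_word w')"
    unfolding inner_step_def using uv(2,3) z
    by (intro exI[of _ "coded_word u"] exI[of _ "coded_word v"] exI[of _ "coded_word l"] exI[of _ z] exI[of _ "zs @ coded_word r"])
      (simp add: coded_word_def)
  then show ?case using Suc.IH[OF y(1)] by auto
qed simp

lemma accepting_steps_forever:
  assumes "agrees xs ys h t" "length ys \<ge> 2" "set ys \<subseteq> A" "halted M (accept_state M, h, t)"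
  shows "(inner_rewrite (machine_rules M A) ^^ i) (config_word xs (accept_state M) ys) (config_word xs (accept_state M) ys)"
proof -
  obtain a y ys' where ys: "ys = a # y # ys'" using assms(2) by (cases ys rule: list.exhaust; cases "tl ys") auto
  have "t h = a" using agrees_head assms(1) ys by blast
  then have "\<And>r. ((accept_state M, a), r) \<notin> instructions M"
    using assms(4) by (auto simp: halted_def tm_step_iff)
  then have "inner_rewrite (machine_rules M A) (config_word xs (accept_state M) ys) (config_word xs (accept_state M) ys)"
    by (intro inner_rewriteI[OF machine_rulesI(4)[of a A M], of _ "map Inl xs" "Inl y" "map Inl ys'"])
      (use assms(3) ys in \<open>auto simp: config_word_def\<close>)
  then show ?thesis by (induction i) auto
qed

theorem universal_simulation:
  assumes x: "Some ` set x \<subseteq> A" and bound: "\<And>n d. (tm_step M ^^ n) (initial_config M x) d \<Longrightarrow> n \<le> B"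
    and W: "W \<ge> B + 2" and k: "k \<ge> (B + 2) * (3 * c + 2)"
  defines "row \<equiv> plain_row (coded_word (start_word W x)) (rule_table coded_rules)"
  shows "(universal.transduce ^^ k) row (replicate (length row) Out) \<longleftrightarrow> accepts M x"
proof -
  have ne: "coded_word (start_word W x) \<noteq> []"
    by (cases W) (simp_all add: coded_word_def start_word_def config_word_def code_def)
  show ?thesis
  proof
    assume "(universal.transduce ^^ k) row (replicate (length row) Out)"
    then obtain i z where i: "(step ^^ i) (coded_word (start_word W x)) z" "k \<le> (i + 1) * (3 * c + 2)"
      unfolding row_def using rewrite_of_transduce[OF _ ne] by blast
    have "(B + 2) * (3 * c + 2) \<le> (i + 1) * (3 * c + 2)" using i(2) k by linarith
    then have "B + 2 \<le> i + 1" by (simp only: mult_le_cancel2)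
    then have "i > B" by simp
    obtain w' where "(rewrite (machine_rules M A) ^^ i) (start_word W x) w'"
      using steps_decode[OF i(1) start_letters[OF x]] by blast
    from rewrites_sound[OF this start_represents] show "accepts M x"
    proof (elim disjE exE conjE)
      fix d assume "(tm_step M ^^ i) (initial_config M x) d"
      then show ?thesis using bound \<open>i > B\<close> by fastforce
    next
      fix d assume "(tm_step M)\<^sup>*\<^sup>* (initial_config M x) d" "fst d = accept_state M" "halted M d"
      then show ?thesis unfolding accepts_def by (metis prod.exhaust_sel)
    qed
  next
    assume "accepts M x"
    then obtain h t n where n: "(tm_step M ^^ n) (initial_config M x) (accept_state M, h, t)" "halted M (accept_state M, h, t)"
      unfolding accepts_def by (metis rtranclp_imp_relpowp)
    have nB: "n \<le> B" using bound[OF n(1)] .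
    have "set (replicate W None @ (map Some x @ replicate W None)) \<subseteq> A" using x blank by auto
    from steps_complete[OF n(1)[unfolded initial_config_def] start_agrees[of W x] _ _ this written] nB W
    obtain xs ys where 1: "(inner_rewrite (machine_rules M A) ^^ n) (start_word W x) (config_word xs (accept_state M) ys)"
      "agrees xs ys h t" "length ys \<ge> 2" "set (xs @ ys) \<subseteq> A" unfolding start_word_def by auto
    have "B + 2 \<le> k" using k by (simp add: algebra_simps)
    have "(inner_rewrite (machine_rules M A) ^^ (k - n)) (config_word xs (accept_state M) ys) (config_word xs (accept_state M) ys)"
      by (rule accepting_steps_forever[OF 1(2,3) _ n(2)]) (use 1(4) in simp)
    with 1(1) have "(inner_rewrite (machine_rules M A) ^^ (n + (k - n))) (start_word W x) (config_word xs (accept_state M) ys)"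
      unfolding relpowp_add by blast
    moreover have "n + (k - n) = k" using nB \<open>B + 2 \<le> k\<close> by simp
    ultimately have "(inner_step ^^ k) (coded_word (start_word W x)) (coded_word (config_word xs (accept_state M) ys))"
      using steps_encode by metis
    moreover have "set (coded_word (start_word W x)) \<subseteq> {..<3}"
      unfolding coded_word_def by (rule set_encode)
    moreover have "k > 0" using \<open>B + 2 \<le> k\<close> by simp
    ultimately show "(universal.transduce ^^ k) row (replicate (length row) Out)"
      unfolding row_def by (intro transduce_of_rewrite[OF _ _ ne])
  qed
qed

end

section \<open>The reduction\<close>

lemma queue_computable_cong: "queue_computable X f \<Longrightarrow> (\<And>x. x \<in> X \<Longrightarrow> f x = g x) \<Longrightarrow> queue_computable X g"
  unfolding queue_computable_def by (elim exE conjE, intro exI conjI; (assumption | simp))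

lemma computable_affine:
  assumes "queue_computable X g" "\<And>x. x \<in> X \<Longrightarrow> set (g x) \<subseteq> \<Gamma>" "finite \<Gamma>"
  shows "queue_computable X (\<lambda>x. pre @ concat (map h (g x)) @ post)"
  by (rule queue_computable_comp[OF assms(1) queue_computable_affine[OF assms(3)]]) (use assms(2) in auto)

lemma computable_partition:
  assumes "queue_computable X g" "\<And>x. x \<in> X \<Longrightarrow> set (g x) \<subseteq> \<Gamma>" "finite \<Gamma>"
  shows "queue_computable X (\<lambda>x. filter (\<lambda>a. a \<notin> B) (g x) @ filter (\<lambda>a. a \<in> B) (g x))"
  by (rule queue_computable_comp[OF assms(1) queue_computable_partition[OF assms(3)]]) (use assms(2) in auto)

lemma computable_fill:
  assumes "queue_computable X (\<lambda>x. replicate (n x) c @ d # s x)" "\<And>x. x \<in> X \<Longrightarrow> set (s x) \<subseteq> \<Gamma>" "finite \<Gamma>"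
    "c \<notin> \<Gamma>" "d \<notin> \<Gamma>" "c \<noteq> d" "set t \<subseteq> \<Gamma>" "b \<notin> set t"
  shows "queue_computable X (\<lambda>x. fill b t (n x) (s x))"
proof -
  have "queue_computable X (\<lambda>x. fill b t (length (takeWhile (\<lambda>a. a = c) (replicate (n x) c @ d # s x)))
      (tl (dropWhile (\<lambda>a. a = c) (replicate (n x) c @ d # s x))))"
    by (rule queue_computable_comp[OF assms(1) queue_computable_fill[OF assms(3-8)]]) (use assms(2) in auto)
  then show ?thesis
    by (rule queue_computable_cong) (use assms(6) in \<open>simp add: takeWhile_append dropWhile_append\<close>)
qed

text \<open>Letters of the intermediate words: numbers from 10 on are data, smaller ones are auxiliary.\<close>

lemma square_computable:
  fixes g :: "nat list \<Rightarrow> nat list"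
  assumes "queue_computable X g" "finite \<Sigma>" "\<Sigma> \<subseteq> {10..}"
    and g: "\<And>x. x \<in> X \<Longrightarrow> set (g x) \<subseteq> insert 3 \<Sigma>" "\<And>x. x \<in> X \<Longrightarrow> length (filter (\<lambda>a. a = 3) (g x)) = j x"
  shows "queue_computable X (\<lambda>x. concat (map (\<lambda>a. if a = 3 then replicate (j x) 3 else [a]) (g x)))"
proof -
  define h1 where "h1 a = (if a = 3 then [0, 2] else [a :: nat])" for a
  define h2 where "h2 a = (if a = 3 then 2 else a :: nat)" for a
  define h4 where "h4 a = (if a = 2 then [] else [a :: nat])" for a
  have "queue_computable X (\<lambda>x. [1] @ concat (map h1 (g x)) @ [])"
    by (rule computable_affine[OF assms(1) g(1)]) (use assms(2) in auto)
  then have "queue_computable X (\<lambda>x. filter (\<lambda>a. a \<notin> - {0}) ([1] @ concat (map h1 (g x)) @ []) @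
      filter (\<lambda>a. a \<in> - {0}) ([1] @ concat (map h1 (g x)) @ []))"
    by (rule computable_partition[where \<Gamma> = "{0, 1, 2} \<union> \<Sigma>"]) (use g(1) assms(2) in \<open>auto simp: h1_def split: if_splits\<close>)
  note A = this
  have B: "filter (\<lambda>a. a \<notin> - {0}) ([1] @ concat (map h1 (g x)) @ []) = replicate (j x) 0 \<and>
      filter (\<lambda>a. a \<in> - {0}) ([1] @ concat (map h1 (g x)) @ []) = 1 # map h2 (g x)" if "x \<in> X" for x
  proof -
    have "filter (\<lambda>a. a = 0) (concat (map h1 y)) = replicate (length (filter (\<lambda>a. a = 3) y)) 0 \<and>
        filter (\<lambda>a. a \<noteq> 0) (concat (map h1 y)) = map h2 y" if "set y \<subseteq> insert 3 \<Sigma>" for y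
      using that assms(3) by (induction y) (auto simp: h1_def h2_def)
    from this[OF g(1)[OF that]] show ?thesis using g(2)[OF that] by simp
  qed
  have "queue_computable X (\<lambda>x. replicate (j x) 0 @ 1 # map h2 (g x))"
    by (rule queue_computable_cong[OF A]) (use B in simp)
  then have "queue_computable X (\<lambda>x. fill 2 [3] (j x) (map h2 (g x)))"
    by (rule computable_fill[where \<Gamma> = "{2, 3} \<union> \<Sigma>"]) (use g(1) assms(2,3) in \<open>auto simp: h2_def\<close>)
  note C = this
  have sf: "set (fill 2 [3] n (map h2 (g x))) \<subseteq> {2, 3} \<union> \<Sigma>" if "x \<in> X" for n x
    using g(1)[OF that] by (auto simp: fill_def h2_def split: if_splits)
  have D: "queue_computable X (\<lambda>x. [] @ concat (map h4 (fill 2 [3] (j x) (map h2 (g x)))) @ [])"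
    by (rule computable_affine[OF C sf]) (use assms(2) in auto)
  have "concat (map h4 (fill 2 [3] n (map h2 y))) = concat (map (\<lambda>a. if a = 3 then replicate n 3 else [a]) y)"
    if "set y \<subseteq> insert 3 \<Sigma>" for n y
  proof -
    have r: "concat (replicate n [3]) = replicate n (3 :: nat)" by (induction n) auto
    have h: "concat (map h4 (replicate n 3)) = replicate n 3" by (induction n) (auto simp: h4_def)
    show ?thesis using that assms(3) by (induction y) (auto simp: fill_def h2_def h4_def r h)
  qed
  note this[OF g(1)]
  then show ?thesis by (intro queue_computable_cong[OF D]) simp
qed

lemma power_computable:
  assumes "finite \<Sigma>"
  shows "\<exists>g. queue_computable (lists \<Sigma>) g \<and> (\<forall>x \<in> lists \<Sigma>. set (g x) \<subseteq> insert 3 ((+) 10 ` \<Sigma>) \<and>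
    filter (\<lambda>a. a \<noteq> 3) (g x) = map ((+) 10) x \<and> length (filter (\<lambda>a. a = 3) (g x)) = (2 * (length x + 1)) ^ (2 ^ r))"
proof (induction r)
  case 0
  define h where "h a = [10 + a, 3, 3]" for a :: nat
  have "queue_computable (lists \<Sigma>) (\<lambda>x. [] @ concat (map h x) @ [3, 3])"
    by (rule queue_computable_affine[OF assms])
  moreover have "filter (\<lambda>a. a \<noteq> 3) (concat (map h x)) = map ((+) 10) x \<and> length (filter (\<lambda>a. a = 3) (concat (map h x))) = 2 * length x" for x
    by (induction x) (auto simp: h_def)
  moreover have "set (concat (map h x)) \<subseteq> insert 3 ((+) 10 ` \<Sigma>)" if "x \<in> lists \<Sigma>" for x
    using that by (auto simp: h_def)
  ultimately show ?case by (intro exI[of _ "\<lambda>x. [] @ concat (map h x) @ [3, 3]"]) simp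
next
  case (Suc r)
  then obtain g where g: "queue_computable (lists \<Sigma>) g" "\<And>x. x \<in> lists \<Sigma> \<Longrightarrow> set (g x) \<subseteq> insert 3 ((+) 10 ` \<Sigma>)"
    "\<And>x. x \<in> lists \<Sigma> \<Longrightarrow> filter (\<lambda>a. a \<noteq> 3) (g x) = map ((+) 10) x"
    "\<And>x. x \<in> lists \<Sigma> \<Longrightarrow> length (filter (\<lambda>a. a = 3) (g x)) = (2 * (length x + 1)) ^ (2 ^ r)" by blast
  define j where "j x = (2 * (length x + 1)) ^ (2 ^ r)" for x :: "nat list"
  let ?f = "\<lambda>x. concat (map (\<lambda>a. if a = 3 then replicate (j x) 3 else [a]) (g x))"
  have "queue_computable (lists \<Sigma>) ?f"
    by (rule square_computable[OF g(1) _ _ g(2)]) (use assms g(4) in \<open>auto simp: j_def\<close>)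
  have s: "set (concat (map (\<lambda>a. if a = 3 then replicate n 3 else [a]) y)) \<subseteq> insert 3 A" if "set y \<subseteq> insert 3 A" for n y and A :: "nat set"
    using that by auto
  have f: "filter (\<lambda>a. a \<noteq> 3) (concat (map (\<lambda>a. if a = 3 then replicate n 3 else [a]) y)) = filter (\<lambda>a. a \<noteq> 3) y \<and>
      length (filter (\<lambda>a. a = 3) (concat (map (\<lambda>a. if a = 3 then replicate n 3 else [a]) y))) = n * length (filter (\<lambda>a. a = 3) y)" for n and y :: "nat list"
    by (induction y) auto
  have j: "j x * j x = (2 * (length x + 1)) ^ (2 ^ Suc r)" for x
    by (simp add: j_def power_add[symmetric] mult_2)
  show ?case
  proof (intro exI[of _ ?f] conjI ballI)
    show "queue_computable (lists \<Sigma>) ?f" by fact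
    fix x assume x: "x \<in> lists \<Sigma>"
    show "set (?f x) \<subseteq> insert 3 ((+) 10 ` \<Sigma>)" by (rule s[OF g(2)[OF x]])
    show "filter (\<lambda>a. a \<noteq> 3) (?f x) = map ((+) 10) x" by (rule trans[OF conjunct1[OF f] g(3)[OF x]])
    have "length (filter (\<lambda>a. a = 3) (?f x)) = j x * j x"
      by (rule trans[OF conjunct2[OF f]]) (simp only: g(4)[OF x] j_def)
    then show "length (filter (\<lambda>a. a = 3) (?f x)) = (2 * (length x + 1)) ^ (2 ^ Suc r)" unfolding j .
  qed
qed

lemma padded_computable:
  assumes "finite \<Sigma>"
  shows "queue_computable (lists \<Sigma>) (\<lambda>x. pre @ concat (replicate ((2 * (length x + 1)) ^ (2 ^ r)) u) @ mid @ concat (map h x) @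
     concat (replicate ((2 * (length x + 1)) ^ (2 ^ r)) v) @ post)"
proof -
  obtain g where g: "queue_computable (lists \<Sigma>) g" "\<And>x. x \<in> lists \<Sigma> \<Longrightarrow> set (g x) \<subseteq> insert 3 ((+) 10 ` \<Sigma>)"
    "\<And>x. x \<in> lists \<Sigma> \<Longrightarrow> filter (\<lambda>a. a \<noteq> 3) (g x) = map ((+) 10) x"
    "\<And>x. x \<in> lists \<Sigma> \<Longrightarrow> length (filter (\<lambda>a. a = 3) (g x)) = (2 * (length x + 1)) ^ (2 ^ r)"
    using power_computable[OF assms, of r] by blast
  define j where "j x = (2 * (length x + 1)) ^ (2 ^ r)" for x :: "nat list"
  define h1 where "h1 a = (if a = 3 then [4, 5] else [a :: nat])" for a
  define g1 where "g1 x = [6] @ concat (map h1 (g x)) @ []" for x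
  define \<Gamma> where "\<Gamma> = {4, 5, 6} \<union> (+) 10 ` \<Sigma>"
  have fin: "finite \<Gamma>" using assms by (simp add: \<Gamma>_def)
  have 1: "queue_computable (lists \<Sigma>) g1"
    unfolding g1_def by (rule computable_affine[OF g(1,2)]) (use assms in auto)
  have s1: "set (g1 x) \<subseteq> \<Gamma>" if "x \<in> lists \<Sigma>" for x
    using g(2)[OF that] by (auto simp: g1_def h1_def \<Gamma>_def)
  define g2 where "g2 x = filter (\<lambda>a. a \<notin> - {4}) (g1 x) @ filter (\<lambda>a. a \<in> - {4}) (g1 x)" for x
  have 2: "queue_computable (lists \<Sigma>) g2"
    unfolding g2_def by (rule computable_partition[OF 1 s1 fin])
  have s2: "set (g2 x) \<subseteq> \<Gamma>" if "x \<in> lists \<Sigma>" for x using s1[OF that] by (auto simp: g2_def)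
  define g3 where "g3 x = filter (\<lambda>a. a \<notin> {5}) (g2 x) @ filter (\<lambda>a. a \<in> {5}) (g2 x)" for x
  have 3: "queue_computable (lists \<Sigma>) g3"
    unfolding g3_def by (rule computable_partition[OF 2 s2 fin])
  have s3: "set (g3 x) \<subseteq> \<Gamma>" if "x \<in> lists \<Sigma>" for x using s2[OF that] by (auto simp: g3_def)
  have e3: "g3 x = replicate (j x) 4 @ 6 # map ((+) 10) x @ replicate (j x) 5" if "x \<in> lists \<Sigma>" for x
  proof -
    have f: "filter (\<lambda>a. a = 4) (concat (map h1 y)) = replicate (length (filter (\<lambda>a. a = 3) y)) 4 \<and>
        filter (\<lambda>a. a \<noteq> 4 \<and> a \<noteq> 5) (concat (map h1 y)) = filter (\<lambda>a. a \<noteq> 3) y \<and>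
        filter (\<lambda>a. a = 5) (concat (map h1 y)) = replicate (length (filter (\<lambda>a. a = 3) y)) 5"
      if "set y \<subseteq> insert 3 ((+) 10 ` \<Sigma>)" for y
      using that by (induction y) (auto simp: h1_def)
    have q: "filter (\<lambda>a. a \<notin> {5}) (filter (\<lambda>a. a \<notin> - {4}) w) = filter (\<lambda>a. a = 4) w"
      "filter (\<lambda>a. a \<notin> {5}) (filter (\<lambda>a. a \<in> - {4}) w) = filter (\<lambda>a. a \<noteq> 4 \<and> a \<noteq> 5) w"
      "filter (\<lambda>a. a \<in> {5}) (filter (\<lambda>a. a \<notin> - {4}) w) = []"
      "filter (\<lambda>a. a \<in> {5}) (filter (\<lambda>a. a \<in> - {4}) w) = filter (\<lambda>a. a = 5) w" for w :: "nat list"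
      by (induction w) simp_all
    show ?thesis
      unfolding g3_def g2_def filter_append q using f[OF g(2)[OF that]] g(3,4)[OF that] by (simp add: g1_def j_def)
  qed
  define h4 where "h4 a = (if a = 4 then u else if a = 5 then v else if a = 6 then mid else h (a - 10))" for a
  have "queue_computable (lists \<Sigma>) (\<lambda>x. pre @ concat (map h4 (g3 x)) @ post)"
    by (rule computable_affine[OF 3 s3 fin])
  note P = this
  have "concat (map h4 (replicate n 4)) = concat (replicate n u)" for n by (induction n) (simp_all add: h4_def)
  moreover have "concat (map h4 (replicate n 5)) = concat (replicate n v)" for n by (induction n) (simp_all add: h4_def)
  moreover have "concat (map h4 (map ((+) 10) x)) = concat (map h x)" for x by (induction x) (simp_all add: h4_def)
  ultimately show ?thesis
    by (intro queue_computable_cong[OF P]) (simp add: e3 j_def h4_def)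
qed

lemma instance_computable:
  fixes g :: "nat list \<Rightarrow> nat list"
  assumes "queue_computable X g" "finite \<Sigma>" "\<Sigma> \<subseteq> {10..}" and g: "\<And>x. x \<in> X \<Longrightarrow> set (g x) \<subseteq> \<Sigma>"
  shows "queue_computable X (\<lambda>x. pre @ concat (map h (g x)) @ concat (replicate (length (g x)) u) @ concat (replicate (length (g x)) v) @
     mid @ replicate (2 * length (g x) * (length (g x) + 1)) (0 :: nat))"
proof -
  define N where "N x = length (g x)" for x
  define h1 where "h1 a = [0, a, 2 :: nat]" for a
  define h2 where "h2 a = [a, 2 :: nat]" for a
  have "queue_computable X (\<lambda>x. [1] @ concat (map h1 (g x)) @ [])"
    by (rule computable_affine[OF assms(1) g assms(2)])
  then have "queue_computable X (\<lambda>x. filter (\<lambda>a. a \<notin> - {0}) ([1] @ concat (map h1 (g x)) @ []) @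
      filter (\<lambda>a. a \<in> - {0}) ([1] @ concat (map h1 (g x)) @ []))"
    by (rule computable_partition[where \<Gamma> = "{0, 1, 2} \<union> \<Sigma>"]) (use g assms(2) in \<open>auto simp: h1_def\<close>)
  note A = this
  have B: "filter (\<lambda>a. a \<notin> - {0}) ([1] @ concat (map h1 (g x)) @ []) = replicate (N x) 0 \<and>
      filter (\<lambda>a. a \<in> - {0}) ([1] @ concat (map h1 (g x)) @ []) = 1 # concat (map h2 (g x))" if "x \<in> X" for x
  proof -
    have "filter (\<lambda>a. a = 0) (concat (map h1 y)) = replicate (length y) 0 \<and>
        filter (\<lambda>a. a \<noteq> 0) (concat (map h1 y)) = concat (map h2 y)" if "set y \<subseteq> \<Sigma>" for y
      using that assms(3) by (induction y) (auto simp: h1_def h2_def)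
    from this[OF g[OF that]] show ?thesis by (simp add: N_def)
  qed
  have "queue_computable X (\<lambda>x. replicate (N x) 0 @ 1 # concat (map h2 (g x)))"
    by (rule queue_computable_cong[OF A]) (use B in simp)
  then have f: "queue_computable X (\<lambda>x. fill 2 [3, 3] (N x) (concat (map h2 (g x))))"
    by (rule computable_fill[where \<Gamma> = "{2, 3} \<union> \<Sigma>"]) (use g assms(2,3) in \<open>auto simp: h2_def\<close>)
  define h4 where "h4 a = (if a = 2 then [6, 7, 3, 3] else [a :: nat])" for a
  define g0 where "g0 x = [4] @ concat (map h4 (fill 2 [3, 3] (N x) (concat (map h2 (g x))))) @ [8]" for x
  have sf: "set (fill 2 [3, 3] n (concat (map h2 y))) \<subseteq> {2, 3} \<union> \<Sigma>" if "set y \<subseteq> \<Sigma>" for n y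
    using that by (auto simp: fill_def h2_def split: if_splits)
  have 0: "queue_computable X g0"
    unfolding g0_def by (rule computable_affine[OF f sf[OF g]]) (use assms(2) in auto)
  define \<Gamma> where "\<Gamma> = {3, 4, 6, 7, 8} \<union> \<Sigma>"
  have fin: "finite \<Gamma>" using assms(2) by (simp add: \<Gamma>_def)
  have s0: "set (g0 x) \<subseteq> \<Gamma>" if "x \<in> X" for x
  proof -
    have "set (concat (map h4 y)) \<subseteq> {3, 6, 7} \<union> \<Sigma>" if "set y \<subseteq> {2, 3} \<union> \<Sigma>" for y
      using that by (auto simp: h4_def split: if_splits)
    from this[OF sf[OF g[OF that]]] show ?thesis by (auto simp: g0_def \<Gamma>_def)
  qed
  define p where "p b y = filter (\<lambda>a. a \<notin> {b}) y @ filter (\<lambda>a. a \<in> {b}) y" for b :: nat and y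
  have part: "queue_computable X (\<lambda>x. p b (k x)) \<and> (\<forall>x \<in> X. set (p b (k x)) \<subseteq> \<Gamma>)"
    if "queue_computable X k \<and> (\<forall>x \<in> X. set (k x) \<subseteq> \<Gamma>)" for b k
    using computable_partition[OF _ _ fin, of X k "{b}"] that by (auto simp: p_def)
  have 1: "queue_computable X (\<lambda>x. p 3 (p 8 (p 7 (p 6 (g0 x)))))" "\<And>x. x \<in> X \<Longrightarrow> set (p 3 (p 8 (p 7 (p 6 (g0 x))))) \<subseteq> \<Gamma>"
    using part[OF part[OF part[OF part]], of g0 3 8 7 6] 0 s0 by simp_all
  have e: "p 3 (p 8 (p 7 (p 6 (g0 x)))) = 4 # g x @ replicate (N x) 6 @ replicate (N x) 7 @ 8 # replicate (2 * N x * (N x + 1)) 3"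
    if "x \<in> X" for x
  proof -
    define w where "w n y = concat (map h4 (fill 2 [3, 3] n (concat (map h2 y))))" for n y
    have r: "concat (map h4 (concat (replicate n [3, 3]))) = concat (replicate n [3, 3])" for n
      by (induction n) (auto simp: h4_def)
    have w_Cons: "w n (a # y) = a # [6, 7, 3, 3] @ concat (replicate n [3, 3]) @ w n y" if "a \<in> \<Sigma>" for n a y
    proof -
      have "a \<noteq> 2" using that assms(3) by auto
      then show ?thesis by (simp add: w_def h2_def fill_def h4_def r)
    qed
    have f3: "filter Q (concat (replicate n [3, 3])) = (if Q 3 then replicate (2 * n) 3 else [])" for Q :: "nat \<Rightarrow> bool" and n
      by (induction n) auto
    have d: "a \<noteq> 3 \<and> a \<noteq> 6 \<and> a \<noteq> 7 \<and> a \<noteq> 8" if "a \<in> \<Sigma>" for a using that assms(3) by auto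
    have "filter (\<lambda>a. a \<noteq> 3 \<and> a \<noteq> 8 \<and> a \<noteq> 7 \<and> a \<noteq> 6) (w n y) = y \<and> filter (\<lambda>a. a = 6) (w n y) = replicate (length y) 6 \<and>
      filter (\<lambda>a. a = 7) (w n y) = replicate (length y) 7 \<and> filter (\<lambda>a. a = 8) (w n y) = [] \<and>
      filter (\<lambda>a. a = 3) (w n y) = replicate (length y * (2 * n + 2)) 3" if "set y \<subseteq> \<Sigma>" for n y
      using that
    proof (induction y)
      case Nil
      then show ?case by (simp add: w_def fill_def)
    next
      case (Cons a y)
      then have a: "a \<in> \<Sigma>" by simp
      have "replicate (2 * n) 3 @ replicate (length y * (2 * n + 2)) 3 = replicate (2 * n + length y * (2 * n + 2)) (3 :: nat)"
        by (simp only: replicate_add)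
      then show ?case using Cons d[OF a] by (simp add: w_Cons[OF a] f3)
    qed
    note W = this[OF g[OF that], of "N x"]
    have pf: "p 3 (p 8 (p 7 (p 6 y))) = filter (\<lambda>a. a \<noteq> 3 \<and> a \<noteq> 8 \<and> a \<noteq> 7 \<and> a \<noteq> 6) y @ filter (\<lambda>a. a = 6) y @
      filter (\<lambda>a. a = 7) y @ filter (\<lambda>a. a = 8) y @ filter (\<lambda>a. a = 3) y" for y
    proof -
      have "filter (\<lambda>x. x \<noteq> 6 \<and> x \<noteq> 7 \<and> x \<noteq> 8 \<and> x \<noteq> 3) y = filter (\<lambda>a. a \<noteq> 3 \<and> a \<noteq> 8 \<and> a \<noteq> 7 \<and> a \<noteq> 6) y"
        "filter (\<lambda>x. x = 6 \<and> x \<noteq> 7 \<and> x \<noteq> 8 \<and> x \<noteq> 3) y = filter (\<lambda>a. a = 6) y"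
        "filter (\<lambda>x. x \<noteq> 6 \<and> x = 7 \<and> x \<noteq> 8 \<and> x \<noteq> 3) y = filter (\<lambda>a. a = 7) y"
        "filter (\<lambda>x. x \<noteq> 6 \<and> x \<noteq> 7 \<and> x = 8 \<and> x \<noteq> 3) y = filter (\<lambda>a. a = 8) y"
        "filter (\<lambda>x. x \<noteq> 6 \<and> x \<noteq> 7 \<and> x \<noteq> 8 \<and> x = 3) y = filter (\<lambda>a. a = 3) y"
        by (induction y) simp_all
      then show ?thesis by (simp add: p_def)
    qed
    have "g0 x = 4 # w (N x) (g x) @ [8]" by (simp add: g0_def w_def)
    then show ?thesis using W by (simp add: pf N_def algebra_simps)
  qed
  define h5 where "h5 a = (if a = 4 then pre else if a = 6 then u else if a = 7 then v else if a = 8 then mid else if a = 3 then [0] else h a)" for a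
  have Q: "queue_computable X (\<lambda>x. [] @ concat (map h5 (p 3 (p 8 (p 7 (p 6 (g0 x)))))) @ [])"
    by (rule computable_affine[OF 1 fin])
  have "concat (map h5 (p 3 (p 8 (p 7 (p 6 (g0 x)))))) =
      pre @ concat (map h (g x)) @ concat (replicate (N x) u) @ concat (replicate (N x) v) @ mid @ replicate (2 * N x * (N x + 1)) 0"
    if x: "x \<in> X" for x
  proof -
    have "map h5 (g x) = map h (g x)" using g[OF x] assms(3) by (auto simp: h5_def)
    then have "concat (map h5 (g x)) = concat (map h (g x))" by (rule arg_cong)
    moreover have "concat (map h5 (replicate n 3)) = replicate n 0" for n by (induction n) (auto simp: h5_def)
    moreover have "h5 4 = pre" "h5 6 = u" "h5 7 = v" "h5 8 = mid" by (simp_all add: h5_def)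
    ultimately show ?thesis unfolding e[OF x] by simp
  qed
  then show ?thesis by (intro queue_computable_cong[OF Q]) (simp add: N_def)
qed

lemma encode_instance_inj: "encode_instance w n = encode_instance w' n' \<Longrightarrow> w = w' \<and> n = n'"
proof -
  assume eq: "encode_instance w n = encode_instance w' n'"
  have pos: "encode_letter l > 0" for l by (cases l) auto
  have inj: "inj encode_letter"
  proof (rule injI)
    fix l l' assume "encode_letter l = encode_letter l'"
    then show "l = l'" by (cases l; cases l') (auto split: if_splits; presburger)
  qed
  have tw: "takeWhile (\<lambda>a. a > 0) (encode_instance w n) = map encode_letter w" for w n
    using pos by (cases n) (auto simp: encode_instance_def takeWhile_append)
  have "map encode_letter w = map encode_letter w'" using eq tw by metis
  then have "w = w'" using inj by (simp add: inj_map_eq_map)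
  then show ?thesis using eq by (auto simp: encode_instance_def dest!: arg_cong[where f = length])
qed

type_synonym utoken = "bool \<times> (ustate, uletter) symbol \<times> bool"

locale reduction =
  fixes S :: "(nat gword \<times> nat gword) list"
  assumes S: "generating_tuple (F2 \<times>\<times> F2) S"
begin

definition token_word :: "utoken \<Rightarrow> nat gword" where
  "token_word t = (SOME w. w \<in> words_over S \<and> word_value (F2 \<times>\<times> F2) S w =
     (if fst t then (red (free_embed_letter (snd t)), []) else ([], red (free_embed_letter (snd t)))))"

lemma S_carrier: "set S \<subseteq> carrier (F2 \<times>\<times> F2)"
  using S by (simp add: generating_tuple_def)

lemma token_word: "token_word t \<in> words_over S"
  "word_value (F2 \<times>\<times> F2) S (token_word t) =
    (if fst t then (red (free_embed_letter (snd t)), []) else ([], red (free_embed_letter (snd t))))"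
proof -
  have "red (free_embed_letter (snd t)) \<in> carrier F2"
    using red_in_F2[OF free_embed_letters[of "[snd t]"]] by simp
  moreover have "[] \<in> carrier F2" by (simp add: carrier_F2)
  ultimately have "(if fst t then (red (free_embed_letter (snd t)), []) else ([], red (free_embed_letter (snd t)))) \<in> generate (F2 \<times>\<times> F2) (set S)"
    using S by (simp add: generating_tuple_def DirProd_def)
  from someI_ex[OF generate_words[OF S_carrier this, unfolded Bex_def]]
  show "token_word t \<in> words_over S" "word_value (F2 \<times>\<times> F2) S (token_word t) =
    (if fst t then (red (free_embed_letter (snd t)), []) else ([], red (free_embed_letter (snd t))))"
    unfolding token_word_def by blast+
qed

lemma tokens_value:
  "concat (map token_word ts) \<in> words_over S"
  "word_value (F2 \<times>\<times> F2) S (concat (map token_word ts)) =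
    (red (free_embed (map snd (filter fst ts))), red (free_embed (map snd (filter (Not \<circ> fst) ts))))"
proof -
  show w: "concat (map token_word ts) \<in> words_over S" for ts
    using token_word(1) by (fastforce simp: words_over_def)
  have "red (flat_word (map fst S) (concat (map token_word ts))) = red (free_embed (map snd (filter fst ts))) \<and>
    red (flat_word (map snd S) (concat (map token_word ts))) = red (free_embed (map snd (filter (Not \<circ> fst) ts)))"
  proof (induction ts)
    case (Cons t ts)
    have t: "red (flat_word (map fst S) (token_word t)) = (if fst t then red (free_embed_letter (snd t)) else [])"
      "red (flat_word (map snd S) (token_word t)) = (if fst t then [] else red (free_embed_letter (snd t)))"
      using token_word(2)[of t] word_value_F2[OF S_carrier token_word(1)[of t]] by (auto split: if_splits)
    have c: "red (a @ b) = red (a' @ b')" if "red a = red a'" "red b = red b'" for a b a' b' :: "nat gword"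
      using red_cong that by blast
    show ?case
    proof (cases "fst t")
      case True
      then show ?thesis using Cons t c[of "flat_word (map fst S) (token_word t)" "free_embed_letter (snd t)"]
          c[of "flat_word (map snd S) (token_word t)" "[]"] by simp
    next
      case False
      then show ?thesis using Cons t c[of "flat_word (map snd S) (token_word t)" "free_embed_letter (snd t)"]
          c[of "flat_word (map fst S) (token_word t)" "[]"] by simp
    qed
  qed simp
  then show "word_value (F2 \<times>\<times> F2) S (concat (map token_word ts)) =
    (red (free_embed (map snd (filter fst ts))), red (free_embed (map snd (filter (Not \<circ> fst) ts))))"
    using word_value_F2[OF S_carrier w] by simp
qed

definition row_tokens :: "uletter list \<Rightarrow> utoken list" where
  "row_tokens v = [(True, State Scan, False)] @ map (\<lambda>z. (True, Row z, False)) v @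
     concat (replicate (length v) [(True, Mark, True), (False, Mark, True)]) @
     replicate (length v) (True, Row Out, True) @ [(True, State Scan, True)]"

definition row_instance :: "uletter list \<Rightarrow> nat list" where
  "row_instance v = encode_instance (concat (map token_word (row_tokens v))) (2 * length v * (length v + 1))"

lemma row_instance_iff:
  "row_instance v \<in> BGWP (F2 \<times>\<times> F2) S universal.subgroup_gens \<longleftrightarrow> (universal.transduce ^^ length v) v (replicate (length v) Out)"
proof -
  have f: "map snd (filter fst (concat (replicate n [(True, Mark, True), (False, Mark, True)]))) = replicate n (Mark, True)"
    "map snd (filter (\<lambda>x. \<not> fst x) (concat (replicate n [(True, Mark, True), (False, Mark, True)]))) = replicate n (Mark, True)" for n
    by (induction n) auto
  have "map snd (filter fst (row_tokens v)) = universal.left_target (length v) v (length v)"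
    "map snd (filter (Not \<circ> fst) (row_tokens v)) = universal.right_target (length v)"
    by (simp_all add: row_tokens_def universal.left_target_def universal.right_target_def f filter_map comp_def)
  then have v: "word_value (F2 \<times>\<times> F2) S (concat (map token_word (row_tokens v))) =
    (red (free_embed (universal.left_target (length v) v (length v))), red (free_embed (universal.right_target (length v))))"
    using tokens_value(2) by simp
  have "row_instance v \<in> BGWP (F2 \<times>\<times> F2) S universal.subgroup_gens \<longleftrightarrow>
    bounded_product (F2 \<times>\<times> F2) universal.subgroup_gens (word_value (F2 \<times>\<times> F2) S (concat (map token_word (row_tokens v))))
      (2 * length v * (length v + 1))"
    unfolding BGWP_def row_instance_def using tokens_value(1) encode_instance_inj by blast
  then show ?thesis unfolding v universal.bounded_product_iff .
qed

lemma row_instance_alphabet: "row_instance v \<in> lists (BGWP_alphabet S)"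
proof -
  have "encode_letter l \<le> 2 * length S" if "fst l < length S" for l using that by (cases l) auto
  then show ?thesis using tokens_value(1)[of "row_tokens v"]
    by (fastforce simp: row_instance_def encode_instance_def words_over_def BGWP_alphabet_def)
qed

lemma row_instance_computable:
  assumes "queue_computable X (\<lambda>x. map (\<lambda>z. 10 + to_nat z) (g x))" "finite A" "\<And>x. x \<in> X \<Longrightarrow> set (g x) \<subseteq> A"
  shows "queue_computable X (\<lambda>x. row_instance (g x))"
proof -
  define e where "e t = map encode_letter (token_word t)" for t
  have Q: "queue_computable X (\<lambda>x. e (True, State Scan, False) @
     concat (map (\<lambda>a. e (True, Row (from_nat (a - 10)), False)) (map (\<lambda>z. 10 + to_nat z) (g x))) @
     concat (replicate (length (map (\<lambda>z. 10 + to_nat z) (g x))) (e (True, Mark, True) @ e (False, Mark, True))) @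
     concat (replicate (length (map (\<lambda>z. 10 + to_nat z) (g x))) (e (True, Row Out, True))) @ e (True, State Scan, True) @
     replicate (2 * length (map (\<lambda>z. 10 + to_nat z) (g x)) * (length (map (\<lambda>z. 10 + to_nat z) (g x)) + 1)) 0)"
    by (rule instance_computable[OF assms(1), where \<Sigma> = "(\<lambda>z. 10 + to_nat z) ` A"]) (use assms(2,3) in auto)
  have "concat (map (\<lambda>a. e (True, Row (from_nat (a - 10)), False)) (map (\<lambda>z. 10 + to_nat z) v)) =
      map encode_letter (concat (map token_word (map (\<lambda>z. (True, Row z, False)) v)))" for v
    by (induction v) (auto simp: e_def)
  moreover have "concat (replicate n (e (True, Mark, True) @ e (False, Mark, True))) =
      map encode_letter (concat (map token_word (concat (replicate n [(True, Mark, True), (False, Mark, True)]))))" for n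
    by (induction n) (auto simp: e_def)
  moreover have "concat (replicate n (e t)) = map encode_letter (concat (map token_word (replicate n t)))" for n t
    by (induction n) (auto simp: e_def)
  ultimately show ?thesis
    by (intro queue_computable_cong[OF Q])
      (simp add: row_instance_def encode_instance_def row_tokens_def e_def[of "(True, State Scan, b)" for b] del: map_replicate map_concat)
qed

lemma reducible:
  assumes "in_NP \<Sigma> L"
  shows "karp_reducible \<Sigma> L (BGWP_alphabet S) (BGWP (F2 \<times>\<times> F2) S universal.subgroup_gens)"
proof -
  have fin: "finite \<Sigma>" using assms by (simp add: in_NP_def)
  obtain M where M: "finite (instructions M)" "polynomial_time_tm \<Sigma> M" "\<And>x. x \<in> lists \<Sigma> \<Longrightarrow> x \<in> L \<longleftrightarrow> accepts M x"
    using assms by (auto simp: in_NP_def well_formed_tm_def)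
  obtain p :: "nat poly" where p: "\<And>x n c. x \<in> lists \<Sigma> \<Longrightarrow> (tm_step M ^^ n) (initial_config M x) c \<Longrightarrow> n \<le> poly p (length x)"
    using M(2) unfolding polynomial_time_tm_def by blast
  obtain C e where Ce: "\<And>n. poly p n \<le> C * (n + 1) ^ e" using poly_le_power by blast
  define A where "A = insert None (Some ` \<Sigma> \<union> (\<lambda>i. fst (snd (snd i))) ` instructions M)"
  interpret simulated_tm M A
    by unfold_locales (use M(1) fin in \<open>auto simp: A_def\<close>)
  define r where "r = e + (3 * C + 6)"
  define W where "W x = (2 * (length x + 1)) ^ (2 ^ r)" for x :: "nat list"
  define B where "B x = C * (length x + 1) ^ e" for x :: "nat list"
  have W: "3 * (B x + 2) \<le> W x" for x
  proof -
    let ?m = "length x + 1"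
    have "r \<le> 2 ^ r" by (simp add: less_imp_le)
    then have "(2 * ?m) ^ r \<le> W x" unfolding W_def by (intro power_increasing) auto
    moreover have "(2 * ?m) ^ r = 2 ^ r * ?m ^ r" by (rule power_mult_distrib)
    moreover have "3 * C + 6 \<le> 2 ^ r"
    proof -
      have "3 * C + 6 \<le> r" by (simp add: r_def)
      then show ?thesis using \<open>r \<le> 2 ^ r\<close> by (rule le_trans)
    qed
    moreover have "?m ^ e \<le> ?m ^ r" by (intro power_increasing) (auto simp: r_def)
    ultimately have "(3 * C + 6) * ?m ^ e \<le> W x" by (metis le_trans mult_le_mono)
    moreover have "1 \<le> ?m ^ e" by (rule one_le_power) simp
    moreover have "3 * (C * P + 2) \<le> (3 * C + 6) * P" if "1 \<le> P" for P using that by (simp add: algebra_simps)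
    ultimately have "3 * (B x + 2) \<le> W x" unfolding B_def by (meson le_trans)
    then show ?thesis .
  qed
  define row where "row x = plain_row (coded_word (start_word (W x) x)) (rule_table coded_rules)" for x
  have letters: "set (map to_nat (start_word (W x) x)) \<subseteq> {..<c}" if "x \<in> lists \<Sigma>" for x
    by (rule start_letters) (use that in \<open>auto simp: A_def\<close>)
  have len: "(B x + 2) * (3 * c + 2) \<le> length (row x)" if "x \<in> lists \<Sigma>" for x
  proof -
    have "length (coded_word (start_word (W x) x)) = c * (2 * W x + length x + 1)"
      using length_encode[OF letters[OF that]] by (simp add: coded_word_def start_word_def config_word_def)
    moreover have "c * (2 * W x) \<le> c * (2 * W x + length x + 1)" by (rule mult_le_mono2) simp
    moreover have "c * (2 * (3 * (B x + 2))) \<le> c * (2 * W x)" using W by (intro mult_le_mono2) simp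
    moreover have "c \<ge> 1" by (simp add: rule_index_def)
    then have "(B x + 2) * (3 * c + 2) \<le> (B x + 2) * (6 * c)" by (intro mult_le_mono2) simp
    moreover have "(B x + 2) * (6 * c) = c * (2 * (3 * (B x + 2)))" by (simp add: algebra_simps)
    ultimately have "(B x + 2) * (3 * c + 2) \<le> length (coded_word (start_word (W x) x))" by linarith
    then show ?thesis by (simp add: row_def plain_row_def)
  qed
  have correct: "x \<in> L \<longleftrightarrow> row_instance (row x) \<in> BGWP (F2 \<times>\<times> F2) S universal.subgroup_gens" if x: "x \<in> lists \<Sigma>" for x
  proof -
    have "W x \<ge> B x + 2" using W[of x] by simp
    have "n \<le> B x" if "(tm_step M ^^ n) (initial_config M x) d" for n d
      using p[OF x that] Ce[of "length x"] by (simp add: B_def)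
    moreover have "Some ` set x \<subseteq> A" using x by (auto simp: A_def)
    ultimately have "(universal.transduce ^^ length (row x)) (row x) (replicate (length (row x)) Out) \<longleftrightarrow> accepts M x"
      using universal_simulation[of x "B x" "W x" "length (row x)"] \<open>W x \<ge> B x + 2\<close> len[OF x] unfolding row_def by blast
    then show ?thesis using M(3)[OF x] row_instance_iff by blast
  qed
  have "queue_computable (lists \<Sigma>) (\<lambda>x. map (\<lambda>z. 10 + to_nat z) (row x))"
  proof -
    define f where "f s = map (\<lambda>z. 10 + to_nat (Cell z False)) (code c (to_nat (s :: tm_symbol)))" for s
    have "queue_computable (lists \<Sigma>) (\<lambda>x. [] @ concat (replicate (W x) (f (Inl None))) @ f (Inr (start_state M)) @
      concat (map (\<lambda>a. f (Inl (Some a))) x) @ concat (replicate (W x) (f (Inl None))) @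
      map (\<lambda>z. 10 + to_nat z) (table (rule_table coded_rules)))"
      unfolding W_def by (rule padded_computable[OF fin])
    moreover have "concat (map f w) = map (\<lambda>z. 10 + to_nat (Cell z False)) (coded_word w)" for w
      by (induction w) (auto simp: f_def coded_word_def)
    then have "map (\<lambda>z. 10 + to_nat z) (row x) = concat (map f (start_word (W x) x)) @ map (\<lambda>z. 10 + to_nat z) (table (rule_table coded_rules))" for x
      by (simp add: row_def plain_row_def)
    moreover have "concat (map f (start_word (W x) x)) = concat (replicate (W x) (f (Inl None))) @ f (Inr (start_state M)) @
      concat (map (\<lambda>a. f (Inl (Some a))) x) @ concat (replicate (W x) (f (Inl None)))" for x
      by (simp add: start_word_def config_word_def comp_def)
    ultimately show ?thesis by simp
  qed
  note R = this
  have "set (row x) \<subseteq> (\<lambda>z. Cell z False) ` {..<3} \<union> set (table (rule_table coded_rules))" for x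
    using set_encode by (auto simp: row_def plain_row_def coded_word_def)
  then have "queue_computable (lists \<Sigma>) (\<lambda>x. row_instance (row x))"
    by (intro row_instance_computable[OF R, where A = "(\<lambda>z. Cell z False) ` {..<3} \<union> set (table (rule_table coded_rules))"]) auto
  then have "polynomial_time_computable \<Sigma> (\<lambda>x. row_instance (row x))"
    by (rule polynomial_time_computable_queueI[OF fin])
  then show ?thesis
    unfolding karp_reducible_def using correct row_instance_alphabet by (intro bexI[of _ "\<lambda>x. row_instance (row x)"]) auto
qed

end

theorem theorem7p4:
  shows "\<exists>H hs. subgroup H (F2 \<times>\<times> F2) \<and> set hs \<subseteq> carrier (F2 \<times>\<times> F2) \<and>
           H = generate (F2 \<times>\<times> F2) (set hs) \<and>
           (\<forall>S. generating_tuple (F2 \<times>\<times> F2) S \<longrightarrow>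
              NP_complete (BGWP_alphabet S) (BGWP (F2 \<times>\<times> F2) S hs))"
proof (intro exI conjI allI impI)
  let ?hs = "universal.subgroup_gens"
  show hs: "set ?hs \<subseteq> carrier (F2 \<times>\<times> F2)" by (rule universal.subgroup_gens_carrier)
  show "subgroup (generate (F2 \<times>\<times> F2) (set ?hs)) (F2 \<times>\<times> F2)"
    by (rule group.generate_is_subgroup[OF DirProd_group[OF group_F2 group_F2] hs])
  show "generate (F2 \<times>\<times> F2) (set ?hs) = generate (F2 \<times>\<times> F2) (set ?hs)" ..
  fix S assume S: "generating_tuple (F2 \<times>\<times> F2) S"
  interpret r: reduction S by unfold_locales (rule S)
  interpret b: bgwp_machine S ?hs by unfold_locales (use S hs in \<open>auto simp: generating_tuple_def\<close>)
  show "NP_complete (BGWP_alphabet S) (BGWP (F2 \<times>\<times> F2) S ?hs)"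
    unfolding NP_complete_def using b.BGWP_in_NP r.reducible by blast
qed

end
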